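(* Assume that the size $\sigma$ of the alphabet of constants $\Sigma$ is a constant. (a) $\mathtt{MatchUniv}(\alpha,k)$ is in $\mathsf P$ when restricted to inputs in which there exists a variable that occurs exactly once in $\alpha$. As such, $\mathtt{MatchUniv}(\alpha,k)$ is in $\mathsf P$ for the class of regular patterns, i.e. patterns in which each variable occurs only once. (b) $\mathtt{MatchUniv}(\alpha,k)$ is in $\mathsf P$ when the number $|\mathrm{var}(\alpha)|$ of distinct variables of $\alpha$ is constant.
   Context: Let $\Sigma=\{1,\ldots,\sigma\}$, $\sigma\ge 2$, be a finite alphabet of constants (terminals) and $\mathcal X$ a possibly infinite set of variables with $\Sigma\cap\mathcal X=\emptyset$. A pattern is a word $\alpha\in(\Sigma\cup\mathcal X)^*$; $\mathrm{var}(\alpha)$ is the set of variables occurring in $\alpha$. A substitution is a morphism $h:(\Sigma\cup\mathcal X)^*\to\Sigma^*$ with $h(a)=a$ for all $a\in\Sigma$; each variable is mapped to an arbitrary, possibly empty, word over $\Sigma$. A word $u$ is a subsequence of $w$ if $u$ is obtained from $w$ by deleting some (possibly no) letters. A word $w\in\Sigma^*$ is $k$-universal if every word over $\Sigma$ of length at most $k$ is a subsequence of $w$; the universality index $\iota(w)$ is the largest $k\in\mathbb N_0$ such that $w$ is $k$-universal. Problem $\mathtt{MatchUniv}(\alpha,k)$. Input: a pattern $\alpha$ and a number $k\in\mathbb N_0$ given in binary. Question: is there a substitution $h$ with $\iota(h(\alpha))=k$? The size $\sigma$ of $\Sigma$ is a constant (not part of the input), and it is in general assumed that every letter of $\Sigma$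 occurs in the input. *)

theory Defs
  imports Main "HOL-Library.Sublist" "HOL-Computational_Algebra.Polynomial"
begin

text \<open>
  Tape symbols and states are natural numbers below the bounds given by the machine; symbol 0 is
  the blank. A tape is infinite in both directions. The pair \<open>(ls, rs)\<close> stands for the tape whose
  cells to the left of the head are \<open>ls\<close> (nearest cell first), whose scanned cell and the cells to
  its right are \<open>rs\<close>, and all of whose remaining cells are blank.
\<close>

type_synonym tape = "nat list \<times> nat list"

datatype direction = MoveLeft | Stay | MoveRight

definition hd_or_blank :: "nat list \<Rightarrow> nat" where
  "hd_or_blank xs = (case xs of [] \<Rightarrow> 0 | x # _ \<Rightarrow> x)"

definition read_tape :: "tape \<Rightarrow> nat" where
  "read_tape t = hd_or_blank (snd t)"

fun write_tape :: "nat \<Rightarrow> tape \<Rightarrow> tape" where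
  "write_tape a (ls, rs) = (ls, a # tl rs)"

fun move_head :: "direction \<Rightarrow> tape \<Rightarrow> tape" where
  "move_head MoveLeft (ls, rs) = (tl ls, hd_or_blank ls # rs)"
| "move_head Stay (ls, rs) = (ls, rs)"
| "move_head MoveRight (ls, rs) = (hd_or_blank rs # ls, tl rs)"

text \<open>
  The transition function takes the current state and the list of scanned symbols (one per tape)
  and returns the next state and, for each tape, the symbol to write and the head movement.
\<close>

record tm =
  num_tapes :: nat
  num_states :: nat
  num_symbols :: nat
  transition :: "nat \<Rightarrow> nat list \<Rightarrow> nat \<times> (nat \<times> direction) list"
  start_state :: nat
  accept_state :: nat
  reject_state :: nat

text \<open>Well-formed machines whose input alphabet is \<open>{1..n}\<close>.\<close>

definition wf_tm :: "nat \<Rightarrow> tm \<Rightarrow> bool" where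
  "wf_tm n M \<longleftrightarrow>
     num_tapes M \<ge> 1 \<and> n < num_symbols M \<and>
     start_state M < num_states M \<and> accept_state M < num_states M \<and>
     reject_state M < num_states M \<and> accept_state M \<noteq> reject_state M \<and>
     (\<forall>q < num_states M. \<forall>syms. length syms = num_tapes M \<and> set syms \<subseteq> {..<num_symbols M} \<longrightarrow>
        (case transition M q syms of (q', acts) \<Rightarrow>
           q' < num_states M \<and> length acts = num_tapes M \<and>
           (\<forall>(a, d) \<in> set acts. a < num_symbols M)))"

type_synonym config = "nat \<times> tape list"

definition initial_config :: "tm \<Rightarrow> nat list \<Rightarrow> config" where
  "initial_config M w = (start_state M, ([], w) # replicate (num_tapes M - 1) ([], []))"

fun tm_step :: "tm \<Rightarrow> config \<Rightarrow> config" where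
  "tm_step M (q, ts) =
     (if q = accept_state M \<or> q = reject_state M then (q, ts)
      else (case transition M q (map read_tape ts) of (q', acts) \<Rightarrow>
              (q', map2 (\<lambda>(a, d) t. move_head d (write_tape a t)) acts ts)))"

text \<open>The machine decides \<open>L\<close> over \<open>{1..n}\<close> within time \<open>T\<close>; it must halt on every input.\<close>

definition decides_in_time :: "nat \<Rightarrow> tm \<Rightarrow> nat list set \<Rightarrow> (nat \<Rightarrow> nat) \<Rightarrow> bool" where
  "decides_in_time n M L T \<longleftrightarrow>
     (\<forall>w \<in> lists {1..n}. \<exists>t \<le> T (length w).
        fst ((tm_step M ^^ t) (initial_config M w)) =
          (if w \<in> L then accept_state M else reject_state M))"

definition in_P :: "nat \<Rightarrow> nat list set \<Rightarrow> bool" where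
  "in_P n L \<longleftrightarrow>
     L \<subseteq> lists {1..n} \<and>
     (\<exists>M (p :: nat poly). wf_tm n M \<and> decides_in_time n M L (poly p))"

definition alphabet :: "nat \<Rightarrow> nat set" where
  "alphabet \<sigma> = {1..\<sigma>}"

definition universal :: "nat \<Rightarrow> nat \<Rightarrow> nat list \<Rightarrow> bool" where
  "universal \<sigma> k w \<longleftrightarrow> (\<forall>u \<in> lists (alphabet \<sigma>). length u \<le> k \<longrightarrow> subseq u w)"

text \<open>The maximum exists for \<open>\<sigma> \<ge> 1\<close>, since then \<open>universal \<sigma> k w\<close> forces \<open>k \<le> length w\<close>.\<close>

definition universality_index :: "nat \<Rightarrow> nat list \<Rightarrow> nat" where
  "universality_index \<sigma> w = (GREATEST k. universal \<sigma> k w)"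

datatype symbol = Terminal nat | Variable nat

definition patterns :: "nat \<Rightarrow> symbol list set" where
  "patterns \<sigma> = lists (Terminal ` alphabet \<sigma> \<union> range Variable)"

definition vars :: "symbol list \<Rightarrow> nat set" where
  "vars \<alpha> = {x. Variable x \<in> set \<alpha>}"

text \<open>
  A substitution is given by the images of the variables; \<open>apply_subst\<close> is the morphism that
  extends it and fixes all terminals.
\<close>

definition substitutions :: "nat \<Rightarrow> (nat \<Rightarrow> nat list) set" where
  "substitutions \<sigma> = {h. \<forall>x. h x \<in> lists (alphabet \<sigma>)}"

definition apply_subst :: "(nat \<Rightarrow> nat list) \<Rightarrow> symbol list \<Rightarrow> nat list" where
  "apply_subst h \<alpha> = concat (map (\<lambda>s. case s of Terminal a \<Rightarrow> [a] | Variable x \<Rightarrow> h x) \<alpha>)"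

definition match_univ :: "nat \<Rightarrow> symbol list \<Rightarrow> nat \<Rightarrow> bool" where
  "match_univ \<sigma> \<alpha> k \<longleftrightarrow>
     (\<exists>h \<in> substitutions \<sigma>. universality_index \<sigma> (apply_subst h \<alpha>) = k)"

definition has_unique_variable :: "symbol list \<Rightarrow> bool" where
  "has_unique_variable \<alpha> \<longleftrightarrow> (\<exists>x. count_list \<alpha> (Variable x) = 1)"

definition regular_pattern :: "symbol list \<Rightarrow> bool" where
  "regular_pattern \<alpha> \<longleftrightarrow> (\<forall>x \<in> vars \<alpha>. count_list \<alpha> (Variable x) = 1)"

text \<open>Binary digits, most significant first and without leading zeros.\<close>

fun binary :: "nat \<Rightarrow> nat list" where
  "binary n = (if n < 2 then [n] else binary (n div 2) @ [n mod 2])"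

declare binary.simps [simp del]

text \<open>
  Input strings are over \<open>{1..\<sigma> + 4}\<close>. A terminal is its own code; \<open>\<sigma> + 1\<close> announces a variable,
  which is followed by its index in binary; \<open>\<sigma> + 2\<close> and \<open>\<sigma> + 3\<close> are the digits 0 and 1; and
  \<open>\<sigma> + 4\<close> separates the pattern from the number.
\<close>

definition encode_nat :: "nat \<Rightarrow> nat \<Rightarrow> nat list" where
  "encode_nat \<sigma> n = map (\<lambda>d. \<sigma> + 2 + d) (binary n)"

fun encode_symbol :: "nat \<Rightarrow> symbol \<Rightarrow> nat list" where
  "encode_symbol \<sigma> (Terminal a) = [a]"
| "encode_symbol \<sigma> (Variable x) = (\<sigma> + 1) # encode_nat \<sigma> x"

definition encode_instance :: "nat \<Rightarrow> symbol list \<Rightarrow> nat \<Rightarrow> nat list" where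
  "encode_instance \<sigma> \<alpha> k = concat (map (encode_symbol \<sigma>) \<alpha>) @ (\<sigma> + 4) # encode_nat \<sigma> k"

definition match_univ_language :: "nat \<Rightarrow> symbol list set \<Rightarrow> nat list set" where
  "match_univ_language \<sigma> C =
     {encode_instance \<sigma> \<alpha> k | \<alpha> k. \<alpha> \<in> patterns \<sigma> \<and> \<alpha> \<in> C \<and> match_univ \<sigma> \<alpha> k}"

definition match_univ_in_P :: "nat \<Rightarrow> symbol list set \<Rightarrow> bool" where
  "match_univ_in_P \<sigma> C \<longleftrightarrow> in_P (\<sigma> + 4) (match_univ_language \<sigma> C)"

end

(*
  A variable occurring exactly once can be filled letter by letter, and one letter raises the
  universality index by at most one, so every k above the index of the erased pattern is attained.
  For boundedly many variables, a word over the alphabet acts on the set of letters seen in the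
  current arch; up to adding a constant number of arches there are finitely many such actions, and a
  word containing all letters can be prolonged by exactly one arch without changing its action
  otherwise. Hence k is attained iff k = C + u_1 m_1 + ... + u_c m_c for one of finitely many choices
  of representatives, where C and the u_j are computed from the pattern, and all but one of the
  numbers m_j can be reduced below some u_i.

  For the machines, while-programs whose registers are heads on read-only copies of the input are
  simulated step by step. The functions they compute in polynomial time, on arguments and with values
  polynomially bounded in the input length, are closed under composition, bounded primitive recursion
  and bounded quantification, which suffices to express the criteria above.
*)

theory Submission
  imports Defs
begin

section \<open>Multi-head while-programs\<close>

text \<open>Neither \<open>k\<close> nor the variable indices are bounded by a polynomial in the
  input length, since both are written in binary, whereas the computations below handle only
  polynomially bounded numbers. Hence neither is ever computed. The number \<open>k\<close> enters
  only through its minimum with, and its remainder modulo, a small number. This dictates the form of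
  the criteria: a comparison with the index of the erased pattern, or, for boundedly many variables,
  a bounded choice of the m_j whose value is at most \<open>k\<close> and congruent to
  \<open>k\<close> modulo u_i; the one unbounded m_i absorbs the missing multiple of u_i. Variables
  are represented by input positions and compared through their digit strings. The alphabet and the
  bound on the number of variables are constants, so the representatives and their actions on letter
  sets are built into the program as finite tables; their mere existence suffices. Head positions
  serve as registers because a polynomially bounded number can be kept in unary.\<close>

datatype com = Skip | Inc nat | Dec nat | Seq com com | Cond nat "nat set" com com | Loop nat "nat set" com

text \<open>
  Register contents are head positions on copies of the input \<open>w\<close>, which is preceded by the marker
  \<open>A + 1\<close> at position 0, followed by the end marker \<open>A + 2\<close>, and then by blanks.
\<close>

definition cell :: "nat \<Rightarrow> nat list \<Rightarrow> nat \<Rightarrow> nat" where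
  "cell A w p = (if p = 0 then A + 1 else if p \<le> length w then w ! (p - 1)
     else if p = length w + 1 then A + 2 else 0)"

text \<open>The step sees only the scanned symbols \<open>v\<close>, not the head positions;
  together with the finiteness of the set of residual programs this makes it realizable by a finite
  control. \<open>Dec\<close> stays on the left marker, which gives truncated subtraction.\<close>

fun act :: "nat \<Rightarrow> com \<Rightarrow> (nat \<Rightarrow> nat) \<Rightarrow> com \<times> (nat \<Rightarrow> direction)" where
  "act A Skip v = (Skip, \<lambda>_. Stay)"
| "act A (Inc r) v = (Skip, (\<lambda>_. Stay)(r := MoveRight))"
| "act A (Dec r) v = (Skip, (\<lambda>_. Stay)(r := if v r = A + 1 then Stay else MoveLeft))"
| "act A (Seq c1 c2) v =
     (if c1 = Skip then (c2, \<lambda>_. Stay) else (case act A c1 v of (c, d) \<Rightarrow> (Seq c c2, d)))"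
| "act A (Cond r B c1 c2) v = (if v r \<in> B then c1 else c2, \<lambda>_. Stay)"
| "act A (Loop r B c) v = (if v r \<in> B then Seq c (Loop r B c) else Skip, \<lambda>_. Stay)"

fun move :: "direction \<Rightarrow> nat \<Rightarrow> nat" where
  "move MoveLeft p = p - 1"
| "move Stay p = p"
| "move MoveRight p = Suc p"

definition sstep :: "nat \<Rightarrow> nat list \<Rightarrow> com \<times> (nat \<Rightarrow> nat) \<Rightarrow> com \<times> (nat \<Rightarrow> nat)" where
  "sstep A w = (\<lambda>(c, s). case act A c (\<lambda>r. cell A w (s r)) of
     (c', d) \<Rightarrow> (c', \<lambda>r. move (d r) (s r)))"

definition runs :: "nat \<Rightarrow> nat list \<Rightarrow> com \<Rightarrow> (nat \<Rightarrow> nat) \<Rightarrow> nat \<Rightarrow> (nat \<Rightarrow> nat) \<Rightarrow> bool" where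
  "runs A w c s t s' \<longleftrightarrow> (sstep A w ^^ t) (c, s) = (Skip, s')"

section \<open>Residual programs as finitely many control states\<close>

fun registers :: "com \<Rightarrow> nat set" where
  "registers Skip = {}"
| "registers (Inc r) = {r}"
| "registers (Dec r) = {r}"
| "registers (Seq c1 c2) = registers c1 \<union> registers c2"
| "registers (Cond r B c1 c2) = insert r (registers c1 \<union> registers c2)"
| "registers (Loop r B c) = insert r (registers c)"

text \<open>A finite superset of the programs that can remain after any number of steps; its
  elements become machine states.\<close>

fun derivatives :: "com \<Rightarrow> com set" where
  "derivatives Skip = {Skip}"
| "derivatives (Inc r) = {Inc r, Skip}"
| "derivatives (Dec r) = {Dec r, Skip}"
| "derivatives (Seq c1 c2) = (\<lambda>c. Seq c c2) ` derivatives c1 \<union> derivatives c2"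
| "derivatives (Cond r B c1 c2) = {Cond r B c1 c2} \<union> derivatives c1 \<union> derivatives c2"
| "derivatives (Loop r B c) = {Loop r B c, Skip} \<union> (\<lambda>c'. Seq c' (Loop r B c)) ` derivatives c"

lemma finite_registers [simp]: "finite (registers c)"
  by (induction c) auto

lemma finite_derivatives [simp]: "finite (derivatives c)"
  by (induction c) auto

lemma self_in_derivatives [simp]: "c \<in> derivatives c"
  by (induction c) auto

lemma Skip_in_derivatives [simp]: "Skip \<in> derivatives c"
  by (induction c) auto

lemma act_in_derivatives: "c' \<in> derivatives c \<Longrightarrow> fst (act A c' v) \<in> derivatives c"
proof (induction c arbitrary: c')
  case (Seq c1 c2)
  then show ?case by (auto split: prod.splits) (metis fst_conv imageI)
next
  case (Loop r B c)
  show ?case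
  proof (cases "c' \<in> (\<lambda>c'. Seq c' (Loop r B c)) ` derivatives c")
    case True
    then obtain d where d: "c' = Seq d (Loop r B c)" "d \<in> derivatives c" by blast
    show ?thesis using Loop.IH[OF d(2)] d(1) by (auto split: prod.splits)
  next
    case False
    then show ?thesis using Loop.prems by auto
  qed
qed (auto split: prod.splits)

lemma derivatives_registers: "c' \<in> derivatives c \<Longrightarrow> registers c' \<subseteq> registers c"
  by (induction c arbitrary: c') fastforce+

lemma act_cong: "(\<And>r. r \<in> registers c \<Longrightarrow> v r = v' r) \<Longrightarrow> act A c v = act A c v'"
  by (induction c) auto

text \<open>Letters of the input are at most \<open>A\<close>, so the marker cannot recur. Scanning
  it is therefore the test whether a register is zero.\<close>

lemma cell_eq_marker: 
  assumes w: "w \<in> lists {1..A}"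
  shows "cell A w p = A + 1 \<longleftrightarrow> p = 0"
proof
  assume c: "cell A w p = A + 1"
  show "p = 0"
  proof (rule ccontr)
    assume p: "p \<noteq> 0"
    then have "p \<le> length w" "w ! (p - 1) = A + 1"
      using c by (auto simp: cell_def split: if_splits)
    then have "A + 1 \<in> set w" using p by (metis Suc_pred' bot_nat_0.not_eq_extremum less_eq_Suc_le nth_mem)
    with w show False by auto
  qed
qed (simp add: cell_def)

section \<open>Execution rules with running times\<close>

lemma runs_Skip: "runs A w Skip s 0 s"
  by (simp add: runs_def)

lemma runs_Inc: "runs A w (Inc r) s 1 (s(r := Suc (s r)))"
  by (auto simp: runs_def sstep_def)

lemma runs_Dec:
  assumes "w \<in> lists {1..A}"
  shows "runs A w (Dec r) s 1 (s(r := s r - 1))"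
  using cell_eq_marker[OF assms, of "s r"] by (auto simp: runs_def sstep_def)

text \<open>\<open>Skip\<close> idles under \<open>sstep\<close>, while the sequence would already
  go on with \<open>c2\<close>. The count \<open>t'\<close> thus stops at the first arrival at
  \<open>Skip\<close>, which may come before \<open>t\<close>.\<close>

lemma sstep_Seq:
  assumes "(sstep A w ^^ t) (c1, s) = (Skip, s')"
  shows "\<exists>t' \<le> t. (sstep A w ^^ t') (Seq c1 c2, s) = (Seq Skip c2, s')"
  using assms
proof (induction t arbitrary: c1 s)
  case 0
  then show ?case by auto
next
  case (Suc t)
  show ?case
  proof (cases "c1 = Skip")
    case True
    have "(sstep A w ^^ n) (Skip, s) = (Skip, s)" for n
      by (induction n) (auto simp: sstep_def)
    with Suc.prems True have "s' = s" by (metis prod.inject)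
    then show ?thesis using True by (intro exI[of _ 0]) auto
  next
    case False
    obtain c s1 where 1: "sstep A w (c1, s) = (c, s1)" by fastforce
    have "(sstep A w ^^ t) (c, s1) = (Skip, s')"
      using Suc.prems 1 by (simp add: funpow_swap1)
    then obtain t' where t': "t' \<le> t" "(sstep A w ^^ t') (Seq c c2, s1) = (Seq Skip c2, s')"
      using Suc.IH by blast
    have "sstep A w (Seq c1 c2, s) = (Seq c c2, s1)"
      using 1 False by (auto simp: sstep_def split: prod.splits)
    then show ?thesis using t' by (intro exI[of _ "Suc t'"]) (simp add: funpow_swap1)
  qed
qed

lemma runs_Seq:
  assumes "\<exists>t \<le> T1. runs A w c1 s t s'" "\<exists>t \<le> T2. runs A w c2 s' t s''"
  shows "\<exists>t \<le> T1 + T2 + 1. runs A w (Seq c1 c2) s t s''"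
proof -
  obtain t1 t2 where t: "t1 \<le> T1" "t2 \<le> T2" "(sstep A w ^^ t1) (c1, s) = (Skip, s')"
    "(sstep A w ^^ t2) (c2, s') = (Skip, s'')"
    using assms by (auto simp: runs_def)
  obtain t1' where t1': "t1' \<le> t1" "(sstep A w ^^ t1') (Seq c1 c2, s) = (Seq Skip c2, s')"
    using sstep_Seq[OF t(3)] by blast
  have "sstep A w (Seq Skip c2, s') = (c2, s')" by (simp add: sstep_def)
  then have "(sstep A w ^^ (t2 + (1 + t1'))) (Seq c1 c2, s) = (Skip, s'')"
    using t t1' unfolding funpow_add by simp
  then show ?thesis using t t1' unfolding runs_def by (intro exI[of _ "t2 + (1 + t1')"]) auto
qed

lemma runs_Cond:
  assumes "cell A w (s r) \<in> B \<Longrightarrow> \<exists>t \<le> T. runs A w c1 s t s'"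
    and "cell A w (s r) \<notin> B \<Longrightarrow> \<exists>t \<le> T. runs A w c2 s t s'"
  shows "\<exists>t \<le> T + 1. runs A w (Cond r B c1 c2) s t s'"
proof -
  have 1: "sstep A w (Cond r B c1 c2, s) = (if cell A w (s r) \<in> B then c1 else c2, s)"
    by (simp add: sstep_def)
  obtain t where "t \<le> T" "(sstep A w ^^ t) (if cell A w (s r) \<in> B then c1 else c2, s) = (Skip, s')"
    using assms by (cases "cell A w (s r) \<in> B") (auto simp: runs_def)
  then show ?thesis using 1 unfolding runs_def by (intro exI[of _ "Suc t"]) (simp add: funpow_swap1)
qed

lemma runs_Loop_end:
  assumes "cell A w (s r) \<notin> B"
  shows "runs A w (Loop r B c) s 1 s"
  using assms by (simp add: runs_def sstep_def)

lemma runs_Loop_step: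
  assumes "cell A w (s r) \<in> B" "\<exists>t \<le> T1. runs A w c s t s'" "\<exists>t \<le> T2. runs A w (Loop r B c) s' t s''"
  shows "\<exists>t \<le> T1 + T2 + 2. runs A w (Loop r B c) s t s''"
proof -
  have 1: "sstep A w (Loop r B c, s) = (Seq c (Loop r B c), s)"
    using assms by (simp add: sstep_def)
  obtain t where "t \<le> T1 + T2 + 1" "(sstep A w ^^ t) (Seq c (Loop r B c), s) = (Skip, s'')"
    using runs_Seq[OF assms(2,3)] by (auto simp: runs_def)
  then show ?thesis using 1 unfolding runs_def by (intro exI[of _ "Suc t"]) (simp add: funpow_swap1)
qed

text \<open>The closed form \<open>S i\<close> of the store after \<open>i\<close> rounds takes the
  place of a loop invariant.\<close>

lemma runs_Loop:
  assumes "\<And>i. i < n \<Longrightarrow> cell A w (S i r) \<in> B \<and> (\<exists>t \<le> T. runs A w c (S i) t (S (Suc i)))"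
    and "cell A w (S n r) \<notin> B"
  shows "\<exists>t \<le> n * (T + 2) + 1. runs A w (Loop r B c) (S 0) t (S n)"
  using assms
proof (induction n arbitrary: S)
  case 0
  then show ?case using runs_Loop_end by (intro exI[of _ 1]) auto
next
  case (Suc n)
  have "\<exists>t \<le> n * (T + 2) + 1. runs A w (Loop r B c) (S 1) t (S (Suc n))"
    using Suc.IH[of "\<lambda>i. S (Suc i)"] Suc.prems by auto
  from runs_Loop_step[of A w "S 0" r B T c, OF _ _ this] Suc.prems(1)[of 0]
  have "\<exists>t \<le> T + (n * (T + 2) + 1) + 2. runs A w (Loop r B c) (S 0) t (S (Suc n))" by auto
  then show ?case by (simp add: algebra_simps)
qed

section \<open>Simulation by Turing machines\<close>

text \<open>Visited blanks remain in the tape as explicit zeros, so the same tape content has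
  several list representations; \<open>j\<close> is the number of these zeros.\<close>

definition tape_at :: "nat \<Rightarrow> nat list \<Rightarrow> nat \<Rightarrow> tape \<Rightarrow> bool" where
  "tape_at A w p t \<longleftrightarrow> (\<exists>j. let X = (A + 1) # w @ (A + 2) # replicate j 0 in
     p \<le> length X \<and> t = (rev (take p X), drop p X))"

lemma hd_or_blank_drop: "hd_or_blank (drop p X) = (if p < length X then X ! p else 0)"
  by (auto simp: hd_or_blank_def split: list.splits simp flip: hd_drop_conv_nth)

lemma read_tape_at:
  assumes "tape_at A w p t"
  shows "read_tape t = cell A w p"
proof -
  obtain j where "p \<le> length ((A + 1) # w @ (A + 2) # replicate j 0)"
    "read_tape t = hd_or_blank (drop p ((A + 1) # w @ (A + 2) # replicate j 0))"
    using assms by (auto simp: tape_at_def Let_def read_tape_def)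
  then show ?thesis
    unfolding hd_or_blank_drop by (auto simp: cell_def nth_append nth_Cons' split: if_splits)
qed

lemma tape_at_move:
  assumes "tape_at A w p t" "d = MoveLeft \<Longrightarrow> p > 0"
  shows "tape_at A w (move d p) (move_head d (write_tape (cell A w p) t))"
proof -
  obtain j Z where Z: "Z = (A + 1) # w @ (A + 2) # replicate j 0" "p \<le> length Z"
    "t = (rev (take p Z), drop p Z)"
    using assms by (auto simp: tape_at_def Let_def)
  have Z0: "Z @ [0] = (A + 1) # w @ (A + 2) # replicate (Suc j) 0"
    by (simp add: Z(1) replicate_append_same)
  have c: "cell A w p = (if p < length Z then Z ! p else 0)"
    using Z(1) by (auto simp: cell_def nth_append nth_Cons' split: if_splits)
  obtain j' where w: "write_tape (cell A w p) t =
     (rev (take p ((A + 1) # w @ (A + 2) # replicate j' 0)), drop p ((A + 1) # w @ (A + 2) # replicate j' 0))"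
    and p: "p < length ((A + 1) # w @ (A + 2) # replicate j' 0)"
  proof (cases "p < length Z")
    case True
    have "Z ! p # tl (drop p Z) = drop p Z"
      using True by (metis Cons_nth_drop_Suc drop_Suc tl_drop)
    then have "write_tape (cell A w p) t = (rev (take p Z), drop p Z)"
      using True Z(3) c by simp
    then show thesis using that True Z(1) by blast
  next
    case False
    then have "p = length Z" using Z(2) by simp
    then have "write_tape (cell A w p) t = (rev (take p (Z @ [0])), drop p (Z @ [0]))"
      using Z(3) c by simp
    then show thesis using that[of "Suc j"] \<open>p = length Z\<close> unfolding Z0[symmetric] by simp
  qed
  define Y where "Y = (A + 1) # w @ (A + 2) # replicate j' 0"
  note w = w[folded Y_def] and p = p[folded Y_def]
  have "\<exists>q \<le> length Y. q = move d p \<and> move_head d (write_tape (cell A w p) t) = (rev (take q Y), drop q Y)"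
  proof (cases d)
    case MoveLeft
    then obtain p' where p': "p = Suc p'" using assms(2) by (cases p) auto
    have "take p Y = take p' Y @ [Y ! p']" "drop p' Y = Y ! p' # drop p Y"
      using p p' by (simp_all add: take_Suc_conv_app_nth Cons_nth_drop_Suc)
    then show ?thesis using MoveLeft w p p' by (auto simp: hd_or_blank_def)
  next
    case Stay
    then show ?thesis using w p by auto
  next
    case MoveRight
    have "take (Suc p) Y = take p Y @ [Y ! p]" "drop p Y = Y ! p # drop (Suc p) Y"
      using p by (simp_all add: take_Suc_conv_app_nth Cons_nth_drop_Suc)
    then show ?thesis using MoveRight w p by (auto simp: hd_or_blank_def)
  qed
  then show ?thesis unfolding tape_at_def Let_def Y_def by auto
qed

text \<open>
  States 0 to 3 copy the input with its markers to all tapes and rewind the heads, states 4 and 5 are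
  halting, and state \<open>6 + idx c\<close> stands for the remaining program \<open>c\<close>.
\<close>

definition sim_tm :: "nat \<Rightarrow> nat \<Rightarrow> com \<Rightarrow> (com \<Rightarrow> nat) \<Rightarrow> tm" where
  "sim_tm A K c0 idx = \<lparr>num_tapes = K, num_states = 6 + card (derivatives c0), num_symbols = A + 3,
     transition = (\<lambda>q syms.
       if q = 0 then (1, (syms ! 0, MoveLeft) # replicate (K - 1) (A + 1, Stay))
       else if q = 1 then (2, replicate K (A + 1, MoveRight))
       else if q = 2 then
         (if syms ! 0 = 0 then (3, replicate K (A + 2, Stay)) else (2, replicate K (syms ! 0, MoveRight)))
       else if q = 3 then
         (if syms ! 0 = A + 1 then (6 + idx c0, map (\<lambda>a. (a, Stay)) syms)
          else (3, map (\<lambda>a. (a, MoveLeft)) syms))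
       else let c = inv_into (derivatives c0) idx (q - 6) in
         if c = Skip then (if syms ! 0 = A + 1 then 5 else 4, map (\<lambda>a. (a, Stay)) syms)
         else case act A c (\<lambda>r. syms ! r) of
           (c', d) \<Rightarrow> (6 + idx c', map (\<lambda>r. (syms ! r, d r)) [0..<K])),
     start_state = 0, accept_state = 4, reject_state = 5\<rparr>"

context
  fixes A K :: nat and c0 :: com and idx :: "com \<Rightarrow> nat" and M :: tm
  assumes K: "K > 0" "registers c0 \<subseteq> {..<K}"
    and idx: "bij_betw idx (derivatives c0) {0..<card (derivatives c0)}"
  defines "M \<equiv> sim_tm A K c0 idx"
begin

lemma sim_tm_sel [simp]:
  "num_tapes M = K" "start_state M = 0" "accept_state M = 4" "reject_state M = 5"
  "num_states M = 6 + card (derivatives c0)" "num_symbols M = A + 3"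
  by (simp_all add: M_def sim_tm_def)

lemma transition_sim: "transition M = transition (sim_tm A K c0 idx)"
  by (simp add: M_def)

lemma inv_idx: "c \<in> derivatives c0 \<Longrightarrow> inv_into (derivatives c0) idx (idx c) = c"
  using idx by (meson bij_betw_inv_into_left)

lemma wf_sim_tm: "wf_tm A M"
proof -
  have *: "case transition M q syms of (q', acts) \<Rightarrow>
           q' < num_states M \<and> length acts = num_tapes M \<and>
           (\<forall>(a, d) \<in> set acts. a < num_symbols M)"
    if q: "q < num_states M" and syms: "length syms = num_tapes M" "set syms \<subseteq> {..<num_symbols M}" for q syms
  proof -
    have cd: "card (derivatives c0) > 0" by (metis card_gt_0_iff empty_iff finite_derivatives self_in_derivatives)
    have id: "c \<in> derivatives c0 \<Longrightarrow> idx c < card (derivatives c0)" for c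
      using idx bij_betwE by fastforce
    have sr: "r < K \<Longrightarrow> syms ! r < A + 3" for r
      using syms nth_mem[of r syms] by (auto simp del: nth_mem)
    then have s0: "syms ! 0 < A + 3" using K(1) by blast
    define c where "c = inv_into (derivatives c0) idx (q - 6)"
    have "idx ` derivatives c0 = {0..<card (derivatives c0)}" using idx by (simp add: bij_betw_def)
    then have "q - 6 \<in> idx ` derivatives c0" using q cd by auto
    then have c: "c \<in> derivatives c0" unfolding c_def by (rule inv_into_into)
    obtain c' d where a: "act A c (\<lambda>r. syms ! r) = (c', d)" by fastforce
    with act_in_derivatives[OF c] have "c' \<in> derivatives c0" by (metis fst_conv)
    then have "idx c' < card (derivatives c0)" "idx c0 < card (derivatives c0)" using id by auto
    then show ?thesis
      using syms s0 K sr a by (auto simp: transition_sim sim_tm_def Let_def c_def[symmetric])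
  qed
  show ?thesis unfolding wf_tm_def using * K(1) by auto
qed

lemma map2_replicate: "map2 f (replicate n a) (replicate n b) = replicate n (f a b)"
  by (simp add: zip_replicate)

lemma funpow_trans: "(f ^^ m) x = y \<Longrightarrow> (f ^^ n) y = z \<Longrightarrow> (f ^^ (m + n)) x = z"
  by (subst add.commute) (simp add: funpow_add)

lemma sim_tm_init:
  assumes w: "w \<in> lists {1..A}"
  shows "(tm_step M ^^ (2 * length w + 5)) (initial_config M w) =
     (6 + idx c0, replicate K ([], (A + 1) # w @ [A + 2]))"
proof -
  obtain K' where K': "K = Suc K'" using K(1) by (cases K) auto
  \<comment> \<open>Writing the scanned blank back turns an empty input into the explicit cell
    \<open>[0]\<close>.\<close>
  define w' where "w' = (if w = [] then [0] else w)"
  define l where "l = (\<lambda>i. rev (take i w) @ [A + 1])"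
  have 0: "initial_config M w = (0, ([], w) # replicate K' ([], []))"
    by (simp add: initial_config_def K')
  have 1: "tm_step M (initial_config M w) = (1, ([], 0 # w') # replicate K' ([], [A + 1]))"
    unfolding 0 by (cases w) (auto simp: transition_sim sim_tm_def K' map2_replicate read_tape_def hd_or_blank_def w'_def)
  have 2: "tm_step M (1, ([], 0 # w') # replicate K' ([], [A + 1])) =
     (2, (l 0, drop 0 w') # replicate K' (l 0, []))"
    by (auto simp: transition_sim sim_tm_def K' map2_replicate read_tape_def hd_or_blank_def l_def)
  have wi: "w ! i \<in> {1..A}" if "i < length w" for i
    using w nth_mem[OF that] by blast
  then have nz: "w ! i \<noteq> 0" if "i < length w" for i
    using that by fastforce
  have 3: "(tm_step M ^^ i) (2, (l 0, drop 0 w') # replicate K' (l 0, [])) =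
     (2, (l i, drop i w') # replicate K' (l i, []))" if "i \<le> length w" for i
    using that
  proof (induction i)
    case (Suc i)
    then have i: "i < length w" "w' = w" by (auto simp: w'_def)
    then have "drop i w = w ! i # drop (Suc i) w" by (simp add: Cons_nth_drop_Suc)
    moreover have "l (Suc i) = w ! i # l i" using i by (simp add: l_def take_Suc_conv_app_nth)
    ultimately have "tm_step M (2, (l i, drop i w') # replicate K' (l i, [])) =
       (2, (l (Suc i), drop (Suc i) w') # replicate K' (l (Suc i), []))"
      using i nz by (auto simp: transition_sim sim_tm_def K' map2_replicate read_tape_def hd_or_blank_def)
    then show ?case using Suc by simp
  qed simp
  define X where "X = (A + 1) # w @ [A + 2]"
  define T where "T = (\<lambda>p. replicate K (rev (take p X), drop p X))"
  have "drop (length w) w' = [] \<or> drop (length w) w' = [0]" by (auto simp: w'_def)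
  then have 4: "tm_step M (2, (l (length w), drop (length w) w') # replicate K' (l (length w), [])) =
     (3, T (length w + 1))"
    by (auto simp: transition_sim sim_tm_def K' map2_replicate read_tape_def hd_or_blank_def l_def T_def X_def)
  have 5: "(tm_step M ^^ p) (3, T p) = (3, T 0)" if "p \<le> length w + 1" for p
    using that
  proof (induction p)
    case (Suc p)
    then have p: "Suc p < length X" by (simp add: X_def)
    have x: "X ! Suc p \<noteq> A + 1"
      using Suc.prems wi[of p] by (auto simp: X_def nth_append)
    have "take (Suc p) X = take p X @ [X ! p]" "drop p X = X ! p # drop (Suc p) X"
      "drop (Suc p) X = X ! Suc p # drop (Suc (Suc p)) X"
      using p by (simp_all add: take_Suc_conv_app_nth Cons_nth_drop_Suc)
    then have "tm_step M (3, T (Suc p)) = (3, T p)"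
      using x by (auto simp: transition_sim sim_tm_def T_def K' map2_replicate read_tape_def hd_or_blank_def)
    then show ?case using Suc by (simp add: funpow_swap1)
  qed simp
  have 6: "tm_step M (3, T 0) = (6 + idx c0, T 0)"
    by (auto simp: transition_sim sim_tm_def T_def X_def K' map2_replicate read_tape_def hd_or_blank_def)
  have f1: "(f ^^ 1) x = f x" for f :: "config \<Rightarrow> config" and x by simp
  have "(tm_step M ^^ (1 + 1 + length w + 1 + (length w + 1) + 1)) (initial_config M w) = (6 + idx c0, T 0)"
    by (intro funpow_trans[OF funpow_trans[OF funpow_trans[OF funpow_trans[OF funpow_trans]]]],
        unfold f1, rule 1, rule 2, rule 3, simp, rule 4, rule 5, simp, rule 6)
  moreover have "1 + 1 + length w + 1 + (length w + 1) + 1 = 2 * length w + 5" by simp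
  ultimately have "(tm_step M ^^ (2 * length w + 5)) (initial_config M w) = (6 + idx c0, T 0)"
    by (simp only:)
  then show ?thesis by (simp add: T_def X_def)
qed

lemma sim_tm_step:
  assumes w: "w \<in> lists {1..A}" and c: "c \<in> derivatives c0" "c \<noteq> Skip"
    and ts: "length ts = K" "\<And>r. r < K \<Longrightarrow> tape_at A w (s r) (ts ! r)"
    and st: "sstep A w (c, s) = (c', s')"
  obtains ts' where "tm_step M (6 + idx c, ts) = (6 + idx c', ts')" "length ts' = K"
    "\<And>r. r < K \<Longrightarrow> tape_at A w (s' r) (ts' ! r)" "c' \<in> derivatives c0"
proof -
  obtain d where a: "act A c (\<lambda>r. cell A w (s r)) = (c', d)" and s': "s' = (\<lambda>r. move (d r) (s r))"
    using st by (auto simp: sstep_def split: prod.splits)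
  have rc: "registers c \<subseteq> {..<K}" using derivatives_registers[OF c(1)] K by blast
  have read: "r < K \<Longrightarrow> map read_tape ts ! r = cell A w (s r)" for r
    using ts read_tape_at by auto
  then have a': "act A c (\<lambda>r. map read_tape ts ! r) = (c', d)"
    using a rc by (subst act_cong[of c _ "\<lambda>r. cell A w (s r)"]) auto
  \<comment> \<open>Only \<open>Dec\<close> moves left, and never from the marker, so the simulated
    head stays on the cells covered by \<open>tape_at\<close>.\<close>
  have left: "s r > 0" if "d r = MoveLeft" for r
  proof -
    have "snd (act A c v) r = MoveLeft \<Longrightarrow> v r \<noteq> A + 1" for v
      by (induction c) (auto split: prod.splits if_splits)
    then show ?thesis using that a cell_eq_marker[OF w, of "s r"]
      by (metis bot_nat_0.not_eq_extremum snd_conv)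
  qed
  define ts' where "ts' = map2 (\<lambda>(a, d) t. move_head d (write_tape a t))
    (map (\<lambda>r. (map read_tape ts ! r, d r)) [0..<K]) ts"
  have len: "length ts' = K" by (simp add: ts'_def ts)
  have "tape_at A w (s' r) (ts' ! r)" if "r < K" for r
    using that read[OF that] tape_at_move[OF ts(2)[OF that] left] ts(1) by (simp add: ts'_def s')
  moreover have "tm_step M (6 + idx c, ts) = (6 + idx c', ts')"
    using c inv_idx a' by (simp add: transition_sim sim_tm_def ts'_def Let_def)
  moreover have "c' \<in> derivatives c0" using act_in_derivatives[OF c(1)] a by (metis fst_conv)
  ultimately show thesis using len that by blast
qed

text \<open>The additional machine step is the one taken in \<open>Skip\<close>, which inspects
  register 0 and halts. Steps in which \<open>sstep\<close> idles in \<open>Skip\<close> have no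
  counterpart in the machine, whence an inequality for \<open>t'\<close>.\<close>

lemma sim_tm_runs:
  assumes w: "w \<in> lists {1..A}" and c: "c \<in> derivatives c0"
    and ts: "length ts = K" "\<And>r. r < K \<Longrightarrow> tape_at A w (s r) (ts ! r)"
    and st: "(sstep A w ^^ t) (c, s) = (Skip, s')"
  shows "\<exists>t' \<le> t + 1. fst ((tm_step M ^^ t') (6 + idx c, ts)) = (if s' 0 = 0 then 5 else 4)"
  using c ts st
proof (induction t arbitrary: c s ts)
  case 0
  then have cs: "c = Skip" "s = s'" by auto
  have r: "map read_tape ts ! 0 = cell A w (s 0)" using 0 K read_tape_at by simp
  have "map read_tape ts ! 0 = A + 1 \<longleftrightarrow> s' 0 = 0" using cell_eq_marker[OF w, of "s 0"] r cs by simp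
  then have "fst (tm_step M (6 + idx c, ts)) = (if s' 0 = 0 then 5 else 4)"
    using cs 0 inv_idx[of Skip] by (simp add: transition_sim sim_tm_def Let_def)
  then show ?case by (intro exI[of _ 1]) simp
next
  case (Suc t)
  obtain c1 s1 where s1: "sstep A w (c, s) = (c1, s1)" by fastforce
  have s1': "(sstep A w ^^ t) (c1, s1) = (Skip, s')" using Suc.prems(4) s1 by (simp add: funpow_swap1)
  show ?case
  proof (cases "c = Skip")
    case True
    then have "(c1, s1) = (c, s)" using s1 by (simp add: sstep_def)
    then obtain t' where "t' \<le> t + 1" "fst ((tm_step M ^^ t') (6 + idx c, ts)) = (if s' 0 = 0 then 5 else 4)"
      using Suc.IH[OF Suc.prems(1-3)] s1' by auto
    then show ?thesis by (intro exI[of _ t']) auto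
  next
    case False
    obtain ts' where ts': "tm_step M (6 + idx c, ts) = (6 + idx c1, ts')" "length ts' = K"
      "\<And>r. r < K \<Longrightarrow> tape_at A w (s1 r) (ts' ! r)" "c1 \<in> derivatives c0"
      using sim_tm_step[OF w Suc.prems(1) False Suc.prems(2,3) s1] by blast
    obtain t' where "t' \<le> t + 1" "fst ((tm_step M ^^ t') (6 + idx c1, ts')) = (if s' 0 = 0 then 5 else 4)"
      using Suc.IH[OF ts'(4,2,3) s1'] by blast
    then show ?thesis using ts'(1) by (intro exI[of _ "Suc t'"]) (simp add: funpow_swap1 del: tm_step.simps)
  qed
qed

end

theorem in_P_runs:
  assumes L: "L \<subseteq> lists {1..A}"
    and run: "\<And>w. w \<in> lists {1..A} \<Longrightarrow>
      \<exists>t \<le> (length w + 2) ^ d. \<exists>s'. runs A w c (\<lambda>_. 0) t s' \<and> (w \<in> L \<longleftrightarrow> s' 0 \<noteq> 0)"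
  shows "in_P A L"
proof -
  define K where "K = Suc (Max (insert 0 (registers c)))"
  have K: "K > 0" "registers c \<subseteq> {..<K}" by (auto simp: K_def less_Suc_eq_le)
  obtain idx where idx: "bij_betw idx (derivatives c) {0..<card (derivatives c)}"
    using ex_bij_betw_finite_nat[OF finite_derivatives] by blast
  define M where "M = sim_tm A K c idx"
  \<comment> \<open>The summand \<open>2 * n + 6\<close> pays for the \<open>2 * n + 5\<close> steps
    that prepare the tapes and for the final test of register 0.\<close>
  define p :: "nat poly" where "p = [:2, 1:] ^ d + [:6, 2:]"
  have p: "poly p n = (n + 2) ^ d + 2 * n + 6" for n by (simp add: p_def poly_power)
  have "\<exists>t \<le> poly p (length w). fst ((tm_step M ^^ t) (initial_config M w)) =
     (if w \<in> L then accept_state M else reject_state M)" if w: "w \<in> lists {1..A}" for w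
  proof -
    obtain t s' where t: "t \<le> (length w + 2) ^ d" "(sstep A w ^^ t) (c, \<lambda>_. 0) = (Skip, s')"
      "w \<in> L \<longleftrightarrow> s' 0 \<noteq> 0" using run[OF w] by (auto simp: runs_def)
    have "tape_at A w 0 ([], (A + 1) # w @ [A + 2])"
      by (auto simp: tape_at_def intro!: exI[of _ 0])
    then obtain t' where t': "t' \<le> t + 1" "fst ((tm_step M ^^ t') (6 + idx c, replicate K ([], (A + 1) # w @ [A + 2])))
        = (if s' 0 = 0 then 5 else 4)"
      using sim_tm_runs[OF K idx w self_in_derivatives _ _ t(2), of "replicate K ([], (A + 1) # w @ [A + 2])"]
      by (auto simp: M_def)
    have "fst ((tm_step M ^^ (t' + (2 * length w + 5))) (initial_config M w)) = (if w \<in> L then 4 else 5)"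
      using t' t(3) by (simp only: funpow_add[of t'] o_apply sim_tm_init[OF K idx w, folded M_def]) simp
    then show ?thesis using t' t(1)
      by (intro exI[of _ "t' + (2 * length w + 5)"]) (auto simp: p M_def sim_tm_def)
  qed
  then have "decides_in_time A M L (poly p)" unfolding decides_in_time_def by blast
  moreover have "wf_tm A M" unfolding M_def by (rule wf_sim_tm[OF K idx])
  ultimately show ?thesis unfolding in_P_def using L by blast
qed

section \<open>Polynomial-time functions on bounded arguments\<close>

text \<open>From 2 on, a single power absorbs constants and sums as well as products. The shift by 2
  in \<open>input_size\<close> keeps all sizes in this range.\<close>

definition poly_growth :: "(nat \<Rightarrow> nat) \<Rightarrow> bool" where
  "poly_growth T \<longleftrightarrow> (\<exists>d. \<forall>N \<ge> 2. T N \<le> N ^ d)"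

lemma poly_growth_const: "poly_growth (\<lambda>_. c)"
proof -
  have "c \<le> N ^ c" if "N \<ge> 2" for N :: nat
    using that by (meson less_exp less_imp_le order_trans power_mono zero_le)
  then show ?thesis unfolding poly_growth_def by blast
qed

lemma poly_growth_power: "poly_growth (\<lambda>N. N ^ d)"
  by (auto simp: poly_growth_def)

lemma poly_growth_id: "poly_growth (\<lambda>N. N)"
  using poly_growth_power[of 1] by simp

lemma poly_growth_mult:
  assumes "poly_growth S" "poly_growth T"
  shows "poly_growth (\<lambda>N. S N * T N)"
proof -
  obtain d e where "\<forall>N \<ge> 2. S N \<le> N ^ d" "\<forall>N \<ge> 2. T N \<le> N ^ e"
    using assms by (auto simp: poly_growth_def)
  then have "\<forall>N \<ge> 2. S N * T N \<le> N ^ (d + e)" by (simp add: power_add mult_le_mono)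
  then show ?thesis by (auto simp: poly_growth_def)
qed

lemma poly_growth_add:
  assumes "poly_growth S" "poly_growth T"
  shows "poly_growth (\<lambda>N. S N + T N)"
proof -
  obtain d e where de: "\<forall>N \<ge> 2. S N \<le> N ^ d" "\<forall>N \<ge> 2. T N \<le> N ^ e"
    using assms by (auto simp: poly_growth_def)
  have "S N + T N \<le> N ^ (d + e + 1)" if N: "N \<ge> 2" for N
  proof -
    have "S N \<le> N ^ (d + e)" "T N \<le> N ^ (d + e)"
      using de N by (meson le_add1 le_add2 le_trans one_le_numeral power_increasing)+
    then have "S N + T N \<le> 2 * N ^ (d + e)" by simp
    also have "\<dots> \<le> N ^ (d + e + 1)" using N by simp
    finally show ?thesis .
  qed
  then show ?thesis unfolding poly_growth_def by blast
qed

lemma poly_growth_Suc: "poly_growth T \<Longrightarrow> poly_growth (\<lambda>N. Suc (T N))"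
  using poly_growth_add[OF _ poly_growth_const[of 1]] by simp

lemmas poly_growth_intros = poly_growth_const poly_growth_Suc poly_growth_power poly_growth_id poly_growth_add poly_growth_mult

definition input_size :: "nat list \<Rightarrow> nat" where
  "input_size w = length w + 2"

abbreviation args_le :: "nat list \<Rightarrow> nat \<Rightarrow> nat list \<Rightarrow> bool" where
  "args_le w m xs \<equiv> \<forall>x \<in> set xs. x \<le> input_size w ^ m"

abbreviation runs_within where
  "runs_within A w c s T s' \<equiv> \<exists>t \<le> T. runs A w c s t s'"

definition poly_bounded :: "nat \<Rightarrow> nat \<Rightarrow> (nat list \<Rightarrow> nat list \<Rightarrow> nat) \<Rightarrow> bool" where
  "poly_bounded A k f \<longleftrightarrow> (\<forall>m. \<exists>T. poly_growth T \<and> (\<forall>w \<in> lists {1..A}. \<forall>xs.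
     length xs = k \<and> args_le w m xs \<longrightarrow> f w xs \<le> T (input_size w)))"

text \<open>
  The program finds the arguments in the registers \<open>rs\<close>, uses as scratch space only registers from \<open>L\<close>
  on, which must be zero at the start and are zero again at the end, and leaves the result in \<open>L\<close>.
\<close>

definition computes ::
  "nat \<Rightarrow> com \<Rightarrow> nat list \<Rightarrow> nat \<Rightarrow> nat \<Rightarrow> (nat \<Rightarrow> nat) \<Rightarrow> (nat list \<Rightarrow> nat list \<Rightarrow> nat) \<Rightarrow> bool" where
  "computes A c rs L m T f \<longleftrightarrow> poly_growth T \<and> (\<forall>w \<in> lists {1..A}. \<forall>s.
     (\<forall>r \<in> set rs. s r \<le> input_size w ^ m) \<and> (\<forall>i \<ge> L. s i = 0) \<longrightarrow>
     runs_within A w c s (T (input_size w)) (s(L := f w (map s rs))))"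

text \<open>The exponent \<open>m\<close> is arbitrary so that the notion is closed under
  composition: the values of one function, bounded by a larger power, are the arguments of the next.
  The registers \<open>rs\<close> and \<open>L\<close> are arbitrary so that programs can be
  combined without renaming.\<close>

definition pc :: "nat \<Rightarrow> nat \<Rightarrow> (nat list \<Rightarrow> nat list \<Rightarrow> nat) \<Rightarrow> bool" where
  "pc A k f \<longleftrightarrow> poly_bounded A k f \<and>
     (\<forall>m rs L. length rs = k \<and> set rs \<subseteq> {..<L} \<longrightarrow> (\<exists>c T. computes A c rs L m T f))"

lemma input_size_ge: "input_size w \<ge> 2"
  by (simp add: input_size_def)

lemma runs_within_mono: "runs_within A w c s T s' \<Longrightarrow> T \<le> T' \<Longrightarrow> runs_within A w c s T' s'"
  using le_trans by blast

lemma poly_growth_le_power: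
  assumes "poly_growth T"
  obtains d where "d \<ge> m" "\<And>w. T (input_size w) \<le> input_size w ^ d"
proof -
  obtain d where d: "\<forall>N \<ge> 2. T N \<le> N ^ d" using assms by (auto simp: poly_growth_def)
  have "T (input_size w) \<le> input_size w ^ (d + m)" for w
    using d input_size_ge[of w] by (meson le_add1 le_trans one_le_numeral power_increasing)
  then show thesis using that[of "d + m"] by simp
qed

lemma power_mono_exp: "x \<le> input_size w ^ m \<Longrightarrow> m \<le> d \<Longrightarrow> x \<le> input_size w ^ d"
  using input_size_ge[of w] by (meson le_trans one_le_numeral power_increasing)

lemma poly_boundedI:
  assumes "\<And>m. \<exists>T. poly_growth T \<and> (\<forall>w xs. w \<in> lists {1..A} \<longrightarrow> length xs = k \<longrightarrow>
      args_le w m xs \<longrightarrow> f w xs \<le> T (input_size w))"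
  shows "poly_bounded A k f"
  using assms unfolding poly_bounded_def by blast

lemma poly_boundedE:
  assumes "poly_bounded A k f"
  obtains d where "d \<ge> m" "\<And>w xs. w \<in> lists {1..A} \<Longrightarrow> length xs = k \<Longrightarrow>
      args_le w m xs \<Longrightarrow> f w xs \<le> input_size w ^ d"
proof -
  obtain T where T: "poly_growth T" "\<forall>w \<in> lists {1..A}. \<forall>xs. length xs = k \<and>
      args_le w m xs \<longrightarrow> f w xs \<le> T (input_size w)"
    using assms unfolding poly_bounded_def by blast
  obtain d where "d \<ge> m" "\<And>w. T (input_size w) \<le> input_size w ^ d"
    using poly_growth_le_power[OF T(1)] by blast
  with T(2) show thesis using that by (meson le_trans)
qed

lemma poly_bounded_mono:
  assumes "poly_bounded A k g" "\<And>w xs. w \<in> lists {1..A} \<Longrightarrow> length xs = k \<Longrightarrow> f w xs \<le> g w xs"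
  shows "poly_bounded A k f"
  using assms unfolding poly_bounded_def by (meson le_trans)

lemma poly_bounded_const: "poly_bounded A k (\<lambda>w xs. c)"
  by (rule poly_boundedI) (use poly_growth_const in blast)

lemma poly_bounded_nth: "j < k \<Longrightarrow> poly_bounded A k (\<lambda>w xs. xs ! j)"
  by (rule poly_boundedI) (use poly_growth_power nth_mem in blast)

lemma poly_bounded_add:
  assumes "poly_bounded A k f" "poly_bounded A k g"
  shows "poly_bounded A k (\<lambda>w xs. f w xs + g w xs)"
proof (rule poly_boundedI)
  fix m
  obtain d where d: "\<And>w xs. w \<in> lists {1..A} \<Longrightarrow> length xs = k \<Longrightarrow>
      args_le w m xs \<Longrightarrow> f w xs \<le> input_size w ^ d"
    using poly_boundedE[OF assms(1)] by metis
  obtain e where e: "\<And>w xs. w \<in> lists {1..A} \<Longrightarrow> length xs = k \<Longrightarrow>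
      args_le w m xs \<Longrightarrow> g w xs \<le> input_size w ^ e"
    using poly_boundedE[OF assms(2)] by metis
  show "\<exists>T. poly_growth T \<and> (\<forall>w xs. w \<in> lists {1..A} \<longrightarrow> length xs = k \<longrightarrow>
      args_le w m xs \<longrightarrow> f w xs + g w xs \<le> T (input_size w))"
    using d e by (intro exI[of _ "\<lambda>N. N ^ d + N ^ e"] conjI poly_growth_intros allI impI add_mono) blast+
qed

lemma poly_bounded_mult:
  assumes "poly_bounded A k f" "poly_bounded A k g"
  shows "poly_bounded A k (\<lambda>w xs. f w xs * g w xs)"
proof (rule poly_boundedI)
  fix m
  obtain d where d: "\<And>w xs. w \<in> lists {1..A} \<Longrightarrow> length xs = k \<Longrightarrow>
      args_le w m xs \<Longrightarrow> f w xs \<le> input_size w ^ d"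
    using poly_boundedE[OF assms(1)] by metis
  obtain e where e: "\<And>w xs. w \<in> lists {1..A} \<Longrightarrow> length xs = k \<Longrightarrow>
      args_le w m xs \<Longrightarrow> g w xs \<le> input_size w ^ e"
    using poly_boundedE[OF assms(2)] by metis
  show "\<exists>T. poly_growth T \<and> (\<forall>w xs. w \<in> lists {1..A} \<longrightarrow> length xs = k \<longrightarrow>
      args_le w m xs \<longrightarrow> f w xs * g w xs \<le> T (input_size w))"
    using d e by (intro exI[of _ "\<lambda>N. N ^ d * N ^ e"] conjI poly_growth_intros allI impI mult_le_mono) blast+
qed

lemma pc_imp_poly_bounded: "pc A k f \<Longrightarrow> poly_bounded A k f"
  by (simp add: pc_def)

lemmas pc_boundedE = poly_boundedE[OF pc_imp_poly_bounded]

lemma pc_computesE: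
  assumes "pc A k f" "length rs = k" "set rs \<subseteq> {..<L}"
  obtains c T where "computes A c rs L m T f"
  using assms unfolding pc_def by blast

lemma computesD:
  assumes "computes A c rs L m T f" "w \<in> lists {1..A}" "\<And>r. r \<in> set rs \<Longrightarrow> s r \<le> input_size w ^ m"
    "\<And>i. i \<ge> L \<Longrightarrow> s i = 0" "s' = s(L := f w (map s rs))"
  shows "runs_within A w c s (T (input_size w)) s'"
  using assms unfolding computes_def by blast

lemma computesI:
  assumes "poly_growth T" and "\<And>w s. w \<in> lists {1..A} \<Longrightarrow> \<forall>r \<in> set rs. s r \<le> input_size w ^ m \<Longrightarrow>
    \<forall>i \<ge> L. s i = 0 \<Longrightarrow> runs_within A w c s (T (input_size w)) (s(L := f w (map s rs)))"
  shows "\<exists>c T. computes A c rs L m T f"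
  using assms unfolding computes_def by blast

lemma pcI:
  assumes "poly_bounded A k f" "\<And>m rs L. length rs = k \<Longrightarrow> set rs \<subseteq> {..<L} \<Longrightarrow> \<exists>c T. computes A c rs L m T f"
  shows "pc A k f"
  using assms unfolding pc_def by blast

lemma computes_poly_growth: "computes A c rs L m T f \<Longrightarrow> poly_growth T"
  by (simp add: computes_def)

lemma pc_cong:
  assumes "\<And>w xs. w \<in> lists {1..A} \<Longrightarrow> length xs = k \<Longrightarrow> f w xs = g w xs" "pc A k f"
  shows "pc A k g"
proof -
  have "poly_bounded A k g" using assms unfolding pc_def poly_bounded_def by metis
  moreover have "computes A c rs L m T g" if "computes A c rs L m T f" "length rs = k" for c rs L m T
    using that assms(1) unfolding computes_def by (metis length_map)
  ultimately show ?thesis using assms(2) unfolding pc_def by blast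
qed

section \<open>Programs for basic functions, composition and bounded recursion\<close>

abbreviation nonzero :: "nat \<Rightarrow> nat set" where
  "nonzero A \<equiv> - {A + 1}"

definition clear :: "nat \<Rightarrow> nat \<Rightarrow> com" where
  "clear A r = Loop r (nonzero A) (Dec r)"

definition add_to :: "nat \<Rightarrow> nat \<Rightarrow> nat \<Rightarrow> com" where
  "add_to A x y = Loop x (nonzero A) (Seq (Dec x) (Inc y))"

lemma runs_within_Inc: "runs_within A w (Inc r) s 1 (s(r := Suc (s r)))"
  using runs_Inc by blast

lemma runs_within_Dec: "w \<in> lists {1..A} \<Longrightarrow> runs_within A w (Dec r) s 1 (s(r := s r - 1))"
  using runs_Dec by blast

lemma runs_clear:
  assumes w: "w \<in> lists {1..A}"
  shows "runs_within A w (clear A r) s (s r * 3 + 1) (s(r := 0))"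
proof -
  define S where "S = (\<lambda>i. s(r := s r - i))"
  have "runs_within A w (clear A r) (S 0) (s r * (1 + 2) + 1) (S (s r))"
    unfolding clear_def
  proof (rule runs_Loop)
    fix i assume i: "i < s r"
    have "S (Suc i) = (S i)(r := S i r - 1)" by (simp add: S_def)
    then have "runs_within A w (Dec r) (S i) 1 (S (Suc i))"
      using runs_within_Dec[OF w, of r "S i"] by simp
    then show "cell A w (S i r) \<in> nonzero A \<and> runs_within A w (Dec r) (S i) 1 (S (Suc i))"
      using cell_eq_marker[OF w] i by (simp add: S_def)
  qed (simp add: S_def cell_def)
  from runs_within_mono[OF this, of "s r * 3 + 1"] show ?thesis by (simp add: S_def)
qed

lemma runs_add_to:
  assumes w: "w \<in> lists {1..A}" and "x \<noteq> y"
  shows "runs_within A w (add_to A x y) s (s x * 5 + 1) (s(x := 0, y := s y + s x))"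
proof -
  define S where "S = (\<lambda>i. s(x := s x - i, y := s y + i))"
  have "runs_within A w (add_to A x y) (S 0) (s x * ((1 + 1 + 1) + 2) + 1) (S (s x))"
    unfolding add_to_def
  proof (rule runs_Loop)
    fix i assume i: "i < s x"
    have "S (Suc i) = ((S i)(x := S i x - 1))(y := Suc (((S i)(x := S i x - 1)) y))"
      using assms(2) by (auto simp: S_def fun_eq_iff)
    then have "runs_within A w (Seq (Dec x) (Inc y)) (S i) (1 + 1 + 1) (S (Suc i))"
      by (simp only:) (rule runs_Seq[OF runs_within_Dec[OF w] runs_within_Inc])
    then show "cell A w (S i x) \<in> nonzero A \<and>
        runs_within A w (Seq (Dec x) (Inc y)) (S i) (1 + 1 + 1) (S (Suc i))"
      using cell_eq_marker[OF w] i assms(2) by (simp add: S_def)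
  qed (use assms(2) in \<open>simp add: S_def cell_def\<close>)
  from runs_within_mono[OF this, of "s x * 5 + 1"] show ?thesis by (simp add: S_def)
qed

text \<open>A loop copies a register only by counting it down. The argument is therefore moved into
  two scratch registers at once and then restored from one of them.\<close>

lemma pc_nth:
  assumes j: "j < k"
  shows "pc A k (\<lambda>w xs. xs ! j)"
proof (rule pcI[OF poly_bounded_nth[OF j]])
  fix m L and rs :: "nat list" assume rs: "length rs = k" "set rs \<subseteq> {..<L}"
  define x where "x = rs ! j"
  have x: "x \<in> set rs" "x < L" using rs j by (auto simp: x_def subset_iff)
  define c where "c = Seq (Loop x (nonzero A) (Seq (Dec x) (Seq (Inc L) (Inc (Suc L))))) (add_to A (Suc L) x)"
  show "\<exists>c T. computes A c rs L m T (\<lambda>w xs. xs ! j)"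
  proof (rule computesI)
    fix w and s :: "nat \<Rightarrow> nat" assume w: "w \<in> lists {1..A}" and s: "\<forall>r \<in> set rs. s r \<le> input_size w ^ m" "\<forall>i \<ge> L. s i = 0"
    define S where "S = (\<lambda>i. s(x := s x - i, L := i, Suc L := i))"
    have sx: "s x \<le> input_size w ^ m" using s x by blast
    have "runs_within A w (Loop x (nonzero A) (Seq (Dec x) (Seq (Inc L) (Inc (Suc L))))) (S 0)
      (s x * ((1 + (1 + 1 + 1) + 1) + 2) + 1) (S (s x))"
    proof (rule runs_Loop)
      fix i assume i: "i < s x"
      let ?s1 = "(S i)(x := S i x - 1)"
      let ?s2 = "?s1(L := Suc (?s1 L))"
      have "S (Suc i) = ?s2(Suc L := Suc (?s2 (Suc L)))"
        using x by (auto simp: S_def fun_eq_iff)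
      then have "runs_within A w (Seq (Dec x) (Seq (Inc L) (Inc (Suc L)))) (S i)
          (1 + (1 + 1 + 1) + 1) (S (Suc i))"
        by (simp only:) (rule runs_Seq[OF runs_within_Dec[OF w] runs_Seq[OF runs_within_Inc runs_within_Inc]])
      then show "cell A w (S i x) \<in> nonzero A \<and> runs_within A w
         (Seq (Dec x) (Seq (Inc L) (Inc (Suc L)))) (S i) (1 + (1 + 1 + 1) + 1) (S (Suc i))"
        using cell_eq_marker[OF w] i x by (simp add: S_def)
    qed (use x in \<open>simp add: S_def cell_def\<close>)
    moreover have "S 0 = s" using s by (auto simp: S_def fun_eq_iff)
    ultimately have 1: "runs_within A w (Loop x (nonzero A) (Seq (Dec x) (Seq (Inc L) (Inc (Suc L))))) s
      (input_size w ^ m * 7 + 1) (S (s x))"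
      using runs_within_mono[of _ A w _ s "S (s x)" "input_size w ^ m * 7 + 1"] sx by simp
    have "(S (s x))(Suc L := 0, x := S (s x) x + S (s x) (Suc L)) = s(L := map s rs ! j)"
      using x s j rs by (auto simp: S_def fun_eq_iff x_def)
    then have 2: "runs_within A w (add_to A (Suc L) x) (S (s x)) (input_size w ^ m * 5 + 1) (s(L := map s rs ! j))"
      using runs_within_mono[OF runs_add_to[OF w, of "Suc L" x "S (s x)"], of "input_size w ^ m * 5 + 1"] sx x
      by (simp add: S_def)
    show "runs_within A w c s (input_size w ^ m * 7 + 1 + (input_size w ^ m * 5 + 1) + 1) (s(L := map s rs ! j))"
      unfolding c_def by (rule runs_Seq[OF 1 2])
  qed (intro poly_growth_intros)
qed

lemma pc_zero: "pc A k (\<lambda>w xs. 0)"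
proof (rule pcI[OF poly_bounded_const])
  fix m L and rs :: "nat list"
  show "\<exists>c T. computes A c rs L m T (\<lambda>w xs. 0)"
    by (rule computesI[OF poly_growth_const[of 0], where c = Skip]) (simp add: runs_Skip fun_upd_idem)
qed

lemma pc_Suc:
  assumes f: "pc A k f"
  shows "pc A k (\<lambda>w xs. Suc (f w xs))"
proof (rule pcI)
  show "poly_bounded A k (\<lambda>w xs. Suc (f w xs))"
    using poly_bounded_add[OF pc_imp_poly_bounded[OF f] poly_bounded_const[of A k 1]] by simp
  fix m L and rs :: "nat list" assume rs: "length rs = k" "set rs \<subseteq> {..<L}"
  obtain c T where c: "computes A c rs L m T f" using pc_computesE[OF f rs] .
  show "\<exists>c T. computes A c rs L m T (\<lambda>w xs. Suc (f w xs))"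
  proof (rule computesI)
    fix w and s :: "nat \<Rightarrow> nat" assume w: "w \<in> lists {1..A}" and s: "\<forall>r \<in> set rs. s r \<le> input_size w ^ m" "\<forall>i \<ge> L. s i = 0"
    have "runs_within A w c s (T (input_size w)) (s(L := f w (map s rs)))"
      using s by (intro computesD[OF c w]) auto
    from runs_Seq[OF this runs_within_Inc[of A w L "s(L := f w (map s rs))"]]
    show "runs_within A w (Seq c (Inc L)) s (T (input_size w) + 1 + 1) (s(L := Suc (f w (map s rs))))" by simp
  qed (intro poly_growth_intros computes_poly_growth[OF c])
qed

lemma pc_pred:
  assumes f: "pc A k f"
  shows "pc A k (\<lambda>w xs. f w xs - 1)"
proof (rule pcI)
  show "poly_bounded A k (\<lambda>w xs. f w xs - 1)"
    by (rule poly_bounded_mono[OF pc_imp_poly_bounded[OF f]]) simp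
  fix m L and rs :: "nat list" assume rs: "length rs = k" "set rs \<subseteq> {..<L}"
  obtain c T where c: "computes A c rs L m T f" using pc_computesE[OF f rs] .
  show "\<exists>c T. computes A c rs L m T (\<lambda>w xs. f w xs - 1)"
  proof (rule computesI)
    fix w and s :: "nat \<Rightarrow> nat" assume w: "w \<in> lists {1..A}" and s: "\<forall>r \<in> set rs. s r \<le> input_size w ^ m" "\<forall>i \<ge> L. s i = 0"
    have "runs_within A w c s (T (input_size w)) (s(L := f w (map s rs)))"
      using s by (intro computesD[OF c w]) auto
    from runs_Seq[OF this runs_within_Dec[OF w, of L "s(L := f w (map s rs))"]]
    show "runs_within A w (Seq c (Dec L)) s (T (input_size w) + 1 + 1) (s(L := f w (map s rs) - 1))" by simp
  qed (intro poly_growth_intros computes_poly_growth[OF c])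
qed

lemma pc_const: "pc A k (\<lambda>w xs. c)"
  by (induction c) (simp_all add: pc_zero pc_Suc)

text \<open>The end marker stands at position \<open>Suc (length w)\<close>, so a head that walks to
  it has measured the input; this explains the offset of 1.\<close>

lemma pc_length: "pc A k (\<lambda>w xs. Suc (length w))"
proof (rule pcI)
  show "poly_bounded A k (\<lambda>w xs. Suc (length w))"
    by (rule poly_boundedI, rule exI[of _ "\<lambda>N. N"]) (simp add: poly_growth_id input_size_def)
  fix m L and rs :: "nat list"
  define c where "c = Loop L (- {A + 2}) (Inc L)"
  show "\<exists>c T. computes A c rs L m T (\<lambda>w xs. Suc (length w))"
  proof (rule computesI)
    fix w and s :: "nat \<Rightarrow> nat" assume w: "w \<in> lists {1..A}" and s: "\<forall>i \<ge> L. s i = 0"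
    define S where "S = (\<lambda>i. s(L := i))"
    have "runs_within A w c (S 0) (Suc (length w) * (1 + 2) + 1) (S (Suc (length w)))"
      unfolding c_def
    proof (rule runs_Loop)
      fix i assume i: "i < Suc (length w)"
      have "cell A w i \<noteq> A + 2"
      proof
        assume a: "cell A w i = A + 2"
        then have i': "i \<noteq> 0" "w ! (i - 1) = A + 2" using i by (auto simp: cell_def split: if_splits)
        then have "A + 2 \<in> set w" using i by (metis Suc_less_eq Suc_pred' bot_nat_0.not_eq_extremum nth_mem)
        then show False using w by auto
      qed
      then show "cell A w (S i L) \<in> - {A + 2} \<and> runs_within A w (Inc L) (S i) 1 (S (Suc i))"
        using runs_within_Inc[of A w L "S i"] by (simp add: S_def)
    qed (simp add: S_def cell_def)
    moreover have "S 0 = s" using s by (auto simp: S_def fun_eq_iff)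
    ultimately have "runs_within A w c s (Suc (length w) * (1 + 2) + 1) (S (Suc (length w)))" by simp
    then show "runs_within A w c s (input_size w * 3 + 1) (s(L := Suc (length w)))"
      unfolding S_def by (rule runs_within_mono) (simp add: input_size_def)
  qed (intro poly_growth_intros)
qed

fun set_to :: "nat \<Rightarrow> nat \<Rightarrow> com" where
  "set_to r 0 = Skip"
| "set_to r (Suc n) = Seq (set_to r n) (Inc r)"

lemma runs_set_to:
  assumes "s r = 0"
  shows "runs_within A w (set_to r n) s (2 * n) (s(r := n))"
proof (induction n)
  case 0
  then show ?case using runs_Skip[of A w s] assms by (auto simp: fun_upd_idem)
next
  case (Suc n)
  show "runs_within A w (set_to r (Suc n)) s (2 * Suc n) (s(r := Suc n))"
    using runs_Seq[OF Suc.IH runs_within_Inc[of A w r "s(r := n)"]] by simp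
qed

text \<open>Scanned symbols are available only as branching conditions; a cascade of tests over all
  candidates below a constant turns one into a register value.\<close>

fun read_cell :: "nat \<Rightarrow> nat \<Rightarrow> nat \<Rightarrow> com" where
  "read_cell x r 0 = Skip"
| "read_cell x r (Suc b) = Cond x {b} (set_to r b) (read_cell x r b)"

lemma runs_read_cell:
  assumes "s r = 0"
  shows "runs_within A w (read_cell x r b) s (3 * b) (s(r := if cell A w (s x) < b then cell A w (s x) else 0))"
proof (induction b)
  case 0
  then show ?case using runs_Skip[of A w s] assms by (auto simp: fun_upd_idem)
next
  case (Suc b)
  let ?s' = "s(r := if cell A w (s x) < Suc b then cell A w (s x) else 0)"
  have "runs_within A w (read_cell x r (Suc b)) s ((3 * b) + 1) ?s'"
    unfolding read_cell.simps
  proof (rule runs_Cond)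
    assume "cell A w (s x) \<in> {b}"
    then show "runs_within A w (set_to r b) s (3 * b) ?s'"
      using runs_within_mono[OF runs_set_to[where s = s and r = r and n = b and A = A and w = w, OF assms], of "3 * b"] by simp
  next
    assume "cell A w (s x) \<notin> {b}"
    then have b: "(cell A w (s x) < Suc b) = (cell A w (s x) < b)" by auto
    show "runs_within A w (read_cell x r b) s (3 * b) ?s'" unfolding b by (rule Suc.IH)
  qed
  then show ?case by (rule runs_within_mono) simp
qed

lemma cell_less:
  assumes w: "w \<in> lists {1..A}"
  shows "cell A w p < A + 3"
proof (cases "p \<noteq> 0 \<and> p \<le> length w")
  case True
  then have "w ! (p - 1) \<in> set w" by (intro nth_mem) auto
  with w have "w ! (p - 1) \<in> {1..A}" by blast
  with True show ?thesis by (simp add: cell_def)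
qed (auto simp: cell_def)

lemma pc_cell:
  assumes j: "j < k"
  shows "pc A k (\<lambda>w xs. cell A w (xs ! j))"
proof (rule pcI)
  show "poly_bounded A k (\<lambda>w xs. cell A w (xs ! j))"
    by (rule poly_bounded_mono[OF poly_bounded_const less_imp_le[OF cell_less]])
  fix m L and rs :: "nat list" assume rs: "length rs = k" "set rs \<subseteq> {..<L}"
  show "\<exists>c T. computes A c rs L m T (\<lambda>w xs. cell A w (xs ! j))"
  proof (rule computesI[OF poly_growth_const])
    fix w and s :: "nat \<Rightarrow> nat" assume w: "w \<in> lists {1..A}" and "\<forall>i \<ge> L. s i = 0"
    then have "s L = 0" by simp
    from runs_read_cell[where s = s and r = L and x = "rs ! j" and b = "A + 3" and A = A and w = w, OF this]
    show "runs_within A w (read_cell (rs ! j) L (A + 3)) s (3 * (A + 3)) (s(L := cell A w (map s rs ! j)))"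
      using cell_less[OF w, of "s (rs ! j)"] rs(1) j by simp
  qed
qed

text \<open>Rearranging, duplicating or dropping arguments needs no code: the program for
  \<open>f\<close> is taken for another list of argument registers.\<close>

lemma pc_reindex:
  assumes f: "pc A k f" and js: "length js = k" "set js \<subseteq> {..<k'}"
  shows "pc A k' (\<lambda>w xs. f w (map ((!) xs) js))"
proof (rule pcI)
  show "poly_bounded A k' (\<lambda>w xs. f w (map ((!) xs) js))"
  proof (rule poly_boundedI)
    fix m
    obtain d where d: "\<And>w xs. w \<in> lists {1..A} \<Longrightarrow> length xs = k \<Longrightarrow>
        args_le w m xs \<Longrightarrow> f w xs \<le> input_size w ^ d"
      using pc_boundedE[OF f] by metis
    have "f w (map ((!) xs) js) \<le> input_size w ^ d"
      if "w \<in> lists {1..A}" "length xs = k'" "args_le w m xs" for w xs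
      using that js by (intro d) auto
    then show "\<exists>T. poly_growth T \<and> (\<forall>w xs. w \<in> lists {1..A} \<longrightarrow> length xs = k' \<longrightarrow>
        args_le w m xs \<longrightarrow> f w (map ((!) xs) js) \<le> T (input_size w))"
      using poly_growth_power by blast
  qed
  fix m L and rs :: "nat list" assume rs: "length rs = k'" "set rs \<subseteq> {..<L}"
  define rs' where "rs' = map ((!) rs) js"
  have rs': "length rs' = k" "set rs' \<subseteq> set rs" using js rs by (auto simp: rs'_def)
  obtain c T where c: "computes A c rs' L m T f" using pc_computesE[OF f rs'(1)] rs'(2) rs(2) by (meson order_trans)
  have "map ((!) (map s rs)) js = map s rs'" for s :: "nat \<Rightarrow> nat" using js rs by (auto simp: rs'_def)
  then show "\<exists>c T. computes A c rs L m T (\<lambda>w xs. f w (map ((!) xs) js))"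
    using c rs'(2) by (intro computesI[OF computes_poly_growth[OF c], where c = c]) (simp add: computes_def subset_iff)
qed

text \<open>The value of \<open>f\<close> stays in \<open>L\<close> as a further argument of
  \<open>g\<close>, whose scratch space begins at \<open>Suc L\<close>; afterwards that value is
  erased and the result moved down to \<open>L\<close>.\<close>

lemma pc_Let:
  assumes f: "pc A k f" and g: "pc A (Suc k) g"
  shows "pc A k (\<lambda>w xs. g w (f w xs # xs))"
proof -
  have bounds: "\<exists>d \<ge> m. \<exists>e. \<forall>w xs. w \<in> lists {1..A} \<longrightarrow> length xs = k \<longrightarrow> args_le w m xs \<longrightarrow>
      f w xs \<le> input_size w ^ d \<and> g w (f w xs # xs) \<le> input_size w ^ e" for m
  proof -
    obtain d where d: "d \<ge> m" "\<And>w xs. w \<in> lists {1..A} \<Longrightarrow> length xs = k \<Longrightarrow>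
        args_le w m xs \<Longrightarrow> f w xs \<le> input_size w ^ d"
      using pc_boundedE[OF f] by metis
    obtain e where e: "\<And>w xs. w \<in> lists {1..A} \<Longrightarrow> length xs = Suc k \<Longrightarrow>
        args_le w d xs \<Longrightarrow> g w xs \<le> input_size w ^ e"
      using pc_boundedE[OF g] by metis
    have "g w (f w xs # xs) \<le> input_size w ^ e"
      if "w \<in> lists {1..A}" "length xs = k" "args_le w m xs" for w xs
      using that by (intro e) (auto intro: d(2) power_mono_exp[OF _ d(1)])
    with d show ?thesis by blast
  qed
  show ?thesis
  proof (rule pcI)
    show "poly_bounded A k (\<lambda>w xs. g w (f w xs # xs))"
      using bounds poly_growth_power by (intro poly_boundedI) metis
    fix m L and rs :: "nat list" assume rs: "length rs = k" "set rs \<subseteq> {..<L}"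
    obtain d e where d: "d \<ge> m" and de: "\<forall>w xs. w \<in> lists {1..A} \<longrightarrow> length xs = k \<longrightarrow>
        args_le w m xs \<longrightarrow>
        f w xs \<le> input_size w ^ d \<and> g w (f w xs # xs) \<le> input_size w ^ e" using bounds by blast
    obtain c T where c: "computes A c rs L m T f" using pc_computesE[OF f rs] .
    have "length (L # rs) = Suc k" "set (L # rs) \<subseteq> {..<Suc L}" using rs by auto
    then obtain c' T' where c': "computes A c' (L # rs) (Suc L) d T' g" using pc_computesE[OF g] by blast
    show "\<exists>c T. computes A c rs L m T (\<lambda>w xs. g w (f w xs # xs))"
    proof (rule computesI)
      fix w and s :: "nat \<Rightarrow> nat" assume w: "w \<in> lists {1..A}" and s: "\<forall>r \<in> set rs. s r \<le> input_size w ^ m" "\<forall>i \<ge> L. s i = 0"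
      define x where "x = f w (map s rs)"
      define y where "y = g w (x # map s rs)"
      have x: "x \<le> input_size w ^ d" using de w rs s by (simp add: x_def)
      have y: "y \<le> input_size w ^ e" using de w rs s by (simp add: y_def x_def)
      have L: "L \<notin> set rs" using rs by auto
      have 1: "runs_within A w c s (T (input_size w)) (s(L := x))"
        using s by (intro computesD[OF c w]) (auto simp: x_def)
      have "map (s(L := x)) rs = map s rs" using L by auto
      then have 2: "runs_within A w c' (s(L := x)) (T' (input_size w)) (s(L := x, Suc L := y))"
        using s x L by (intro computesD[OF c' w]) (auto simp: y_def intro: power_mono_exp[OF _ d])
      have 3: "runs_within A w (clear A L) (s(L := x, Suc L := y)) (input_size w ^ d * 3 + 1) (s(L := 0, Suc L := y))"
        using runs_within_mono[OF runs_clear[OF w, of "s(L := x, Suc L := y)" L], of "input_size w ^ d * 3 + 1"] x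
        by (simp add: fun_upd_twist)
      have "(s(L := 0, Suc L := y))(Suc L := 0, L := y) = s(L := y)"
        using s by (auto simp: fun_eq_iff)
      then have 4: "runs_within A w (add_to A (Suc L) L) (s(L := 0, Suc L := y)) (input_size w ^ e * 5 + 1) (s(L := y))"
        using runs_within_mono[OF runs_add_to[OF w, of "Suc L" L "s(L := 0, Suc L := y)"], of "input_size w ^ e * 5 + 1"] y
        by simp
      from runs_Seq[OF runs_Seq[OF 1 2] runs_Seq[OF 3 4]]
      show "runs_within A w (Seq (Seq c c') (Seq (clear A L) (add_to A (Suc L) L))) s
        (T (input_size w) + T' (input_size w) + 1 + ((input_size w ^ d * 3 + 1) + (input_size w ^ e * 5 + 1) + 1) + 1)
        (s(L := g w (f w (map s rs) # map s rs)))" unfolding x_def y_def .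
    qed (intro poly_growth_intros computes_poly_growth[OF c] computes_poly_growth[OF c'])
  qed
qed

lemma pc_If:
  assumes f: "pc A k f" and g: "pc A k g" and h: "pc A k h"
  shows "pc A k (\<lambda>w xs. if f w xs = 0 then g w xs else h w xs)"
proof (rule pcI)
  show "poly_bounded A k (\<lambda>w xs. if f w xs = 0 then g w xs else h w xs)"
    by (rule poly_bounded_mono[OF poly_bounded_add[OF g[THEN pc_imp_poly_bounded] h[THEN pc_imp_poly_bounded]]]) simp
  fix m L and rs :: "nat list" assume rs: "length rs = k" "set rs \<subseteq> {..<L}"
  obtain d where d: "\<And>w xs. w \<in> lists {1..A} \<Longrightarrow> length xs = k \<Longrightarrow>
      args_le w m xs \<Longrightarrow> f w xs \<le> input_size w ^ d"
    using pc_boundedE[OF f] by metis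
  obtain c T where c: "computes A c rs L m T f" using pc_computesE[OF f rs] .
  obtain c1 T1 where c1: "computes A c1 rs L m T1 g" using pc_computesE[OF g rs] .
  obtain c2 T2 where c2: "computes A c2 rs L m T2 h" using pc_computesE[OF h rs] .
  show "\<exists>c T. computes A c rs L m T (\<lambda>w xs. if f w xs = 0 then g w xs else h w xs)"
  proof (rule computesI)
    fix w and s :: "nat \<Rightarrow> nat" assume w: "w \<in> lists {1..A}" and s: "\<forall>r \<in> set rs. s r \<le> input_size w ^ m" "\<forall>i \<ge> L. s i = 0"
    define x where "x = f w (map s rs)"
    have x: "x \<le> input_size w ^ d" unfolding x_def using w rs s by (intro d) auto
    have 1: "runs_within A w c s (T (input_size w)) (s(L := x))"
      using s by (intro computesD[OF c w]) (auto simp: x_def)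
    let ?s' = "s(L := if x = 0 then g w (map s rs) else h w (map s rs))"
    have 2: "runs_within A w (Cond L {A + 1} c1 (Seq (clear A L) c2)) (s(L := x))
      ((T1 (input_size w) + (input_size w ^ d * 3 + 1 + T2 (input_size w) + 1)) + 1) ?s'"
    proof (rule runs_Cond)
      assume "cell A w ((s(L := x)) L) \<in> {A + 1}"
      then have x0: "x = 0" using cell_eq_marker[OF w] by simp
      then have "s(L := x) = s" using s by (auto simp: fun_eq_iff)
      moreover have "runs_within A w c1 s (T1 (input_size w)) ?s'"
        using s x0 by (intro computesD[OF c1 w]) auto
      ultimately show "runs_within A w c1 (s(L := x))
        (T1 (input_size w) + (input_size w ^ d * 3 + 1 + T2 (input_size w) + 1)) ?s'"
        using runs_within_mono by simp
    next
      assume "cell A w ((s(L := x)) L) \<notin> {A + 1}"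
      then have x0: "x \<noteq> 0" using cell_eq_marker[OF w] by auto
      have "(s(L := x))(L := 0) = s" using s by (auto simp: fun_eq_iff)
      then have 3: "runs_within A w (clear A L) (s(L := x)) (input_size w ^ d * 3 + 1) s"
        using runs_within_mono[OF runs_clear[OF w, of "s(L := x)" L], of "input_size w ^ d * 3 + 1"] x
        by simp
      have 4: "runs_within A w c2 s (T2 (input_size w)) ?s'"
        using s x0 by (intro computesD[OF c2 w]) auto
      show "runs_within A w (Seq (clear A L) c2) (s(L := x))
        (T1 (input_size w) + (input_size w ^ d * 3 + 1 + T2 (input_size w) + 1)) ?s'"
        by (rule runs_within_mono[OF runs_Seq[OF 3 4]]) simp
    qed
    from runs_Seq[OF 1 2]
    show "runs_within A w (Seq c (Cond L {A + 1} c1 (Seq (clear A L) c2))) s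
      (T (input_size w) + ((T1 (input_size w) + (input_size w ^ d * 3 + 1 + T2 (input_size w) + 1)) + 1) + 1)
      (s(L := if f w (map s rs) = 0 then g w (map s rs) else h w (map s rs)))" unfolding x_def .
  qed (intro poly_growth_intros c[THEN computes_poly_growth] c1[THEN computes_poly_growth] c2[THEN computes_poly_growth])
qed

lemma pc_rec:
  assumes f: "pc A k f" and g: "pc A (Suc (Suc k)) g" and b: "pc A k b" and bd: "poly_bounded A k bd"
    and le: "\<And>w xs i. w \<in> lists {1..A} \<Longrightarrow> length xs = k \<Longrightarrow> i \<le> b w xs \<Longrightarrow>
      rec_nat (f w xs) (\<lambda>i a. g w (i # a # xs)) i \<le> bd w xs"
  shows "pc A k (\<lambda>w xs. rec_nat (f w xs) (\<lambda>i a. g w (i # a # xs)) (b w xs))"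
proof (rule pcI)
  show "poly_bounded A k (\<lambda>w xs. rec_nat (f w xs) (\<lambda>i a. g w (i # a # xs)) (b w xs))"
    using bd by (rule poly_bounded_mono) (rule le[OF _ _ order_refl])
  define R where "R = (\<lambda>w xs. rec_nat (f w xs) (\<lambda>i a. g w (i # a # xs)))"
  fix m L and rs :: "nat list" assume rs: "length rs = k" "set rs \<subseteq> {..<L}"
  obtain d where d: "d \<ge> m" "\<And>w xs. w \<in> lists {1..A} \<Longrightarrow> length xs = k \<Longrightarrow>
      args_le w m xs \<Longrightarrow> b w xs \<le> input_size w ^ d"
    using pc_boundedE[OF b] by metis
  obtain e0 where e0: "e0 \<ge> m" "\<And>w xs. w \<in> lists {1..A} \<Longrightarrow> length xs = k \<Longrightarrow>
      args_le w m xs \<Longrightarrow> bd w xs \<le> input_size w ^ e0"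
    using poly_boundedE[OF bd] by metis
  \<comment> \<open>Index and accumulator are both arguments of \<open>g\<close>, so one exponent
    has to cover the bounds of both.\<close>
  define e where "e = d + e0"
  have e: "e \<ge> d" by (simp add: e_def)
  have R: "R w xs i \<le> input_size w ^ e" if "w \<in> lists {1..A}" "length xs = k"
    "args_le w m xs" "i \<le> b w xs" for w xs i
    using le_trans[OF le[OF that(1,2,4)] e0(2)[OF that(1-3)]] power_mono_exp[of _ w e0 e]
    by (simp add: R_def e_def)
  \<comment> \<open>Register \<open>L\<close> holds the accumulator, \<open>B\<close> the number of
    remaining rounds, \<open>I\<close> the number of completed rounds, and \<open>S1\<close> is the
    start of the scratch space of \<open>g\<close>.\<close>
  define I B S1 where "I = Suc (Suc L)" and "B = Suc L" and "S1 = Suc (Suc (Suc L))"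
  note IBS = I_def B_def S1_def
  obtain c T where c: "computes A c rs L m T f" using pc_computesE[OF f rs] .
  have "set rs \<subseteq> {..<B}" using rs by (auto simp: IBS)
  then obtain c1 T1 where c1: "computes A c1 rs B m T1 b" using pc_computesE[OF b rs(1)] by blast
  have "length (I # L # rs) = Suc (Suc k)" "set (I # L # rs) \<subseteq> {..<S1}" using rs by (auto simp: IBS)
  then obtain c2 T2 where c2: "computes A c2 (I # L # rs) S1 e T2 g" using pc_computesE[OF g] by blast
  define body where "body = Seq (Seq c2 (Seq (clear A L) (add_to A S1 L))) (Seq (Inc I) (Dec B))"
  define P where "P = Seq (Seq c c1) (Seq (Loop B (nonzero A) body) (clear A I))"
  define TB where "TB = (\<lambda>N. (T2 N + ((N ^ e * 3 + 1) + (N ^ e * 5 + 1) + 1) + 1) + (1 + 1 + 1) + 1)"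
  define TP where "TP = (\<lambda>N. (T N + T1 N + 1) + ((N ^ d * (TB N + 2) + 1) + (N ^ d * 3 + 1) + 1) + 1)"
  show "\<exists>c T. computes A c rs L m T (\<lambda>w xs. rec_nat (f w xs) (\<lambda>i a. g w (i # a # xs)) (b w xs))"
  proof (rule computesI)
    fix w and s :: "nat \<Rightarrow> nat" assume w: "w \<in> lists {1..A}" and s: "\<forall>r \<in> set rs. s r \<le> input_size w ^ m" "\<forall>i \<ge> L. s i = 0"
    define xs where "xs = map s rs"
    define n where "n = b w xs"
    define S where "S = (\<lambda>i. s(L := R w xs i, B := n - i, I := i))"
    define N where "N = input_size w"
    have xs: "length xs = k" "args_le w m xs"
      using rs s by (auto simp: xs_def)
    have n: "n \<le> N ^ d" unfolding n_def N_def using d(2)[OF w xs] by blast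
    have L: "\<And>r. r \<in> set rs \<Longrightarrow> r < L" using rs by auto
    have not_rs: "L \<notin> set rs" "Suc L \<notin> set rs" "Suc (Suc L) \<notin> set rs" using L by fastforce+
    have 1: "runs_within A w c s (T N) (s(L := f w xs))"
      unfolding N_def using s by (intro computesD[OF c w]) (auto simp: xs_def)
    have "map (s(L := f w xs)) rs = xs" using L by (auto simp: xs_def)
    then have 2: "runs_within A w c1 (s(L := f w xs)) (T1 N) (s(L := f w xs, B := n))"
      unfolding N_def using s L by (intro computesD[OF c1 w]) (auto simp: n_def IBS)
    have S0: "s(L := f w xs, B := n) = S 0" using s by (auto simp: S_def R_def IBS fun_eq_iff)
    have 3: "runs_within A w (Loop B (nonzero A) body) (S 0) (n * (TB N + 2) + 1) (S n)"
    proof (rule runs_Loop)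
      fix i assume i: "i < n"
      have Ri: "R w xs i \<le> N ^ e" "R w xs (Suc i) \<le> N ^ e"
        using R[OF w xs] i unfolding N_def n_def by auto
      have "N \<ge> 2" by (simp add: N_def input_size_ge)
      have ie: "i \<le> N ^ e"
        using i n power_mono_exp[OF _ e, of n w] by (simp add: N_def)
      have mapS: "map (S i) (I # L # rs) = i # R w xs i # xs"
        using L not_rs by (auto simp: S_def xs_def IBS)
      have bnd: "\<And>r. r \<in> set (I # L # rs) \<Longrightarrow> S i r \<le> N ^ e"
        using L not_rs s Ri ie by (auto simp: S_def IBS N_def intro: power_mono_exp[OF _ order_trans[OF d(1) e]])
      have a1: "runs_within A w c2 (S i) (T2 N) ((S i)(S1 := R w xs (Suc i)))"
        unfolding N_def
      proof (rule computesD[OF c2 w])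
        show "\<And>r. r \<in> set (I # L # rs) \<Longrightarrow> S i r \<le> input_size w ^ e" using bnd by (simp add: N_def)
        show "\<And>j. S1 \<le> j \<Longrightarrow> S i j = 0" using s by (auto simp: S_def IBS)
        show "(S i)(S1 := R w xs (Suc i)) = (S i)(S1 := g w (map (S i) (I # L # rs)))"
          unfolding mapS by (simp add: R_def)
      qed
      let ?s1 = "(S i)(S1 := R w xs (Suc i))"
      have a2: "runs_within A w (clear A L) ?s1 (N ^ e * 3 + 1) (?s1(L := 0))"
        by (rule runs_within_mono[OF runs_clear[OF w]]) (use Ri in \<open>simp add: S_def IBS\<close>)
      let ?s2 = "(S i)(L := R w xs (Suc i))"
      have "(?s1(L := 0))(S1 := 0, L := (?s1(L := 0)) L + (?s1(L := 0)) S1) = ?s2"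
        using s by (auto simp: S_def IBS fun_eq_iff)
      then have a3: "runs_within A w (add_to A S1 L) (?s1(L := 0)) (N ^ e * 5 + 1) ?s2"
        using runs_within_mono[OF runs_add_to[OF w, of S1 L "?s1(L := 0)"], of "N ^ e * 5 + 1"] Ri
        by (simp add: IBS)
      have "S (Suc i) = (?s2(I := Suc (?s2 I)))(B := (?s2(I := Suc (?s2 I))) B - 1)"
        by (auto simp: S_def IBS fun_eq_iff)
      then have a4: "runs_within A w (Seq (Inc I) (Dec B)) ?s2 (1 + 1 + 1) (S (Suc i))"
        by (simp only:) (rule runs_Seq[OF runs_within_Inc runs_within_Dec[OF w]])
      have "runs_within A w body (S i) (TB N) (S (Suc i))"
        unfolding body_def TB_def by (rule runs_Seq[OF runs_Seq[OF a1 runs_Seq[OF a2 a3]] a4])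
      moreover have "cell A w (S i B) \<in> nonzero A"
        using cell_eq_marker[OF w, of "n - i"] i by (simp add: S_def IBS)
      ultimately show "cell A w (S i B) \<in> nonzero A \<and> runs_within A w body (S i) (TB N) (S (Suc i))" by blast
    qed (simp add: S_def IBS cell_def)
    then have 3: "runs_within A w (Loop B (nonzero A) body) (S 0) (N ^ d * (TB N + 2) + 1) (S n)"
      by (rule runs_within_mono) (intro add_mono mult_le_mono n order_refl)
    have "(S n)(I := 0) = s(L := R w xs n)" using s by (auto simp: S_def IBS fun_eq_iff)
    then have 4: "runs_within A w (clear A I) (S n) (N ^ d * 3 + 1) (s(L := R w xs n))"
      using runs_within_mono[OF runs_clear[OF w, of "S n" I], of "N ^ d * 3 + 1"] n by (simp add: S_def IBS)
    have "runs_within A w P s (TP N) (s(L := R w xs n))"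
      unfolding P_def TP_def by (rule runs_Seq[OF runs_Seq[OF 1 2[unfolded S0]] runs_Seq[OF 3 4]])
    then show "runs_within A w P s (TP (input_size w))
        (s(L := rec_nat (f w (map s rs)) (\<lambda>i a. g w (i # a # map s rs)) (b w (map s rs))))"
      unfolding N_def n_def xs_def R_def .
  next
    show "poly_growth TP"
      unfolding TP_def TB_def
      by (intro poly_growth_intros c[THEN computes_poly_growth] c1[THEN computes_poly_growth] c2[THEN computes_poly_growth])
  qed
qed

text \<open>Without arguments and with \<open>L = 0\<close> the result is left in register 0, which
  is the one that decides acceptance.\<close>

theorem pc_in_P:
  assumes f: "pc A 0 f"
  shows "in_P A {w \<in> lists {1..A}. f w [] \<noteq> 0}"
proof -
  obtain c T where c: "computes A c [] 0 0 T f" using pc_computesE[OF f, of "[]" 0] by auto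
  obtain d where d: "\<And>w. T (input_size w) \<le> input_size w ^ d"
    using c poly_growth_le_power unfolding computes_def by metis
  show ?thesis
  proof (rule in_P_runs[where c = c and d = d])
    fix w assume w: "w \<in> lists {1..A}"
    have "runs_within A w c (\<lambda>_. 0) (T (input_size w)) ((\<lambda>_. 0)(0 := f w []))"
      by (intro computesD[OF c w]) auto
    then have r: "runs_within A w c (\<lambda>_. 0) (input_size w ^ d) ((\<lambda>_. 0)(0 := f w []))"
      using d runs_within_mono by blast
    then show "\<exists>t \<le> (length w + 2) ^ d. \<exists>s'. runs A w c (\<lambda>_. 0) t s' \<and>
       (w \<in> {w \<in> lists {1..A}. f w [] \<noteq> 0} \<longleftrightarrow> s' 0 \<noteq> 0)"
      using w unfolding input_size_def by fastforce
  qed auto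
qed

text \<open>
  In \<open>pc A k f\<close> and \<open>pd A k P\<close> the list argument has length \<open>k\<close> and serves as an environment: a
  variable bound by a quantifier, a sum or a recursion is put in front of it.
\<close>

abbreviation pd :: "nat \<Rightarrow> nat \<Rightarrow> (nat list \<Rightarrow> nat list \<Rightarrow> bool) \<Rightarrow> bool" where
  "pd A k P \<equiv> pc A k (\<lambda>w xs. of_bool (P w xs))"

section \<open>Arithmetic, bounded quantifiers and finite case distinctions\<close>

lemma pc_drop:
  assumes "pc A k f"
  shows "pc A (n + k) (\<lambda>w xs. f w (drop n xs))"
proof (rule pc_cong[OF _ pc_reindex[OF assms, of "[n..<n + k]"]])
  fix w and xs :: "nat list" assume "length xs = n + k"
  then have "map ((!) xs) [n..<n + k] = drop n xs" by (intro nth_equalityI) auto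
  then show "f w (map ((!) xs) [n..<n + k]) = f w (drop n xs)" by simp
qed auto

lemma pc_take:
  assumes "pc A n f"
  shows "pc A (n + k) (\<lambda>w xs. f w (take n xs))"
proof (rule pc_cong[OF _ pc_reindex[OF assms, of "[0..<n]"]])
  fix w and xs :: "nat list" assume "length xs = n + k"
  then have "map ((!) xs) [0..<n] = take n xs" by (intro nth_equalityI) auto
  then show "f w (map ((!) xs) [0..<n]) = f w (take n xs)" by simp
qed auto

lemma pc_tl: "pc A k f \<Longrightarrow> pc A (Suc k) (\<lambda>w xs. f w (tl xs))"
  using pc_drop[of A k f 1] by (simp add: drop_Suc)

lemma pc_tl_tl: "pc A k f \<Longrightarrow> pc A (Suc (Suc k)) (\<lambda>w xs. f w (tl (tl xs)))"
  using pc_tl[OF pc_tl] by simp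

text \<open>\<open>pc_Let\<close> pushes the values one by one, from the last function to the first;
  each function has to skip the values pushed before it.\<close>

lemma pc_apply:
  assumes "pc A (length fs + k) g" "\<And>f. f \<in> set fs \<Longrightarrow> pc A k f"
  shows "pc A k (\<lambda>w xs. g w (map (\<lambda>f. f w xs) fs @ xs))"
  using assms
proof (induction fs arbitrary: g)
  case (Cons f fs)
  have f: "pc A (length fs + k) (\<lambda>w xs. f w (drop (length fs) xs))"
    using Cons.prems(2) by (intro pc_drop) simp
  have "pc A k (\<lambda>w xs. (\<lambda>w xs. g w (f w (drop (length fs) xs) # xs)) w (map (\<lambda>f. f w xs) fs @ xs))"
    using Cons.prems by (intro Cons.IH pc_Let[OF f]) auto
  then show ?case by simp
qed simp

lemma pc_comp1:
  assumes F: "pc A 1 (\<lambda>w xs. F w (xs ! 0))" and f: "pc A k f"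
  shows "pc A k (\<lambda>w xs. F w (f w xs))"
  using pc_apply[of A "[f]" k "\<lambda>w xs. F w (take 1 xs ! 0)"] f pc_take[OF F, of k] by simp

lemma pc_comp2:
  assumes F: "pc A 2 (\<lambda>w xs. F w (xs ! 0) (xs ! 1))" and f: "pc A k f" and g: "pc A k g"
  shows "pc A k (\<lambda>w xs. F w (f w xs) (g w xs))"
  using pc_apply[of A "[f, g]" k "\<lambda>w xs. F w (take 2 xs ! 0) (take 2 xs ! 1)"] f g pc_take[OF F, of k]
  by auto

lemma pc_add:
  assumes "pc A k f" "pc A k g"
  shows "pc A k (\<lambda>w xs. f w xs + g w xs)"
proof (rule pc_comp2[OF _ assms, of "\<lambda>w x y. x + y"])
  have rec: "rec_nat x (\<lambda>i a. Suc ((i # a # xs) ! 1)) y = x + y" for x y :: nat and xs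
    by (induction y) auto
  have "pc A 2 (\<lambda>w xs. rec_nat (xs ! 0) (\<lambda>i a. Suc ((i # a # xs) ! 1)) (xs ! 1))"
  proof (rule pc_rec[where g = "\<lambda>w ys. Suc (ys ! 1)" and bd = "\<lambda>w xs. xs ! 0 + xs ! 1"])
    show "poly_bounded A 2 (\<lambda>w xs. xs ! 0 + xs ! 1)"
      by (intro poly_bounded_add poly_bounded_nth) auto
  qed (auto intro!: pc_nth pc_Suc simp only: rec)
  then show "pc A 2 (\<lambda>w xs. xs ! 0 + xs ! 1)" by (simp only: rec)
qed

lemma pc_minus:
  assumes "pc A k f" "pc A k g"
  shows "pc A k (\<lambda>w xs. f w xs - g w xs)"
proof (rule pc_comp2[OF _ assms, of "\<lambda>w x y. x - y"])
  have rec: "rec_nat x (\<lambda>i a. (i # a # xs) ! 1 - 1) y = x - y" for x y :: nat and xs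
    by (induction y) auto
  have "pc A 2 (\<lambda>w xs. rec_nat (xs ! 0) (\<lambda>i a. (i # a # xs) ! 1 - 1) (xs ! 1))"
  proof (rule pc_rec[where g = "\<lambda>w ys. ys ! 1 - 1" and bd = "\<lambda>w xs. xs ! 0"])
    show "poly_bounded A 2 (\<lambda>w xs. xs ! 0)"
      by (intro poly_bounded_nth) auto
  qed (auto intro!: pc_nth pc_pred[of A _ "\<lambda>w ys. ys ! 1"] simp only: rec diff_le_self)
  then show "pc A 2 (\<lambda>w xs. xs ! 0 - xs ! 1)" by (simp only: rec)
qed

lemma pc_mult:
  assumes "pc A k f" "pc A k g"
  shows "pc A k (\<lambda>w xs. f w xs * g w xs)"
proof (rule pc_comp2[OF _ assms, of "\<lambda>w x y. x * y"])
  have rec: "rec_nat 0 (\<lambda>i a. (i # a # xs) ! 1 + (i # a # xs) ! 2) y = xs ! 0 * y" for xs y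
    by (induction y) auto
  have "pc A 2 (\<lambda>w xs. rec_nat 0 (\<lambda>i a. (i # a # xs) ! 1 + (i # a # xs) ! 2) (xs ! 1))"
  proof (rule pc_rec[where g = "\<lambda>w ys. ys ! 1 + ys ! 2" and bd = "\<lambda>w xs. xs ! 0 * xs ! 1"])
    show "poly_bounded A 2 (\<lambda>w xs. xs ! 0 * xs ! 1)"
      by (intro poly_bounded_mult poly_bounded_nth) auto
  qed (auto intro!: pc_zero pc_nth pc_add mult_le_mono2 simp only: rec)
  then show "pc A 2 (\<lambda>w xs. xs ! 0 * xs ! 1)" by (simp only: rec)
qed

lemma pd_If:
  assumes "pd A k P" "pc A k f" "pc A k g"
  shows "pc A k (\<lambda>w xs. if P w xs then f w xs else g w xs)"
proof -
  have "(\<lambda>w xs. if of_bool (P w xs) = (0 :: nat) then g w xs else f w xs) =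
    (\<lambda>w xs. if P w xs then f w xs else g w xs)" by (intro ext) simp
  with pc_If[OF assms(1,3,2)] show ?thesis by simp
qed

lemma pd_cong:
  assumes "\<And>w xs. w \<in> lists {1..A} \<Longrightarrow> length xs = k \<Longrightarrow> P w xs \<longleftrightarrow> Q w xs" "pd A k P"
  shows "pd A k Q"
  using assms(2) by (rule pc_cong[rotated]) (simp add: assms(1))

lemma pd_not: "pd A k P \<Longrightarrow> pd A k (\<lambda>w xs. \<not> P w xs)"
  by (rule pc_cong[OF _ pd_If[OF _ pc_const[of A k 0] pc_const[of A k 1]]]) auto

lemma pd_conj:
  assumes "pd A k P" "pd A k Q"
  shows "pd A k (\<lambda>w xs. P w xs \<and> Q w xs)"
  using pd_If[OF assms pc_const[of A k 0]] by (rule pc_cong[rotated]) auto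

lemma pd_disj:
  assumes "pd A k P" "pd A k Q"
  shows "pd A k (\<lambda>w xs. P w xs \<or> Q w xs)"
  using pd_If[OF assms(1) pc_const[of A k 1] assms(2)] by (rule pc_cong[rotated]) auto

lemma pd_imp:
  assumes "pd A k P" "pd A k Q"
  shows "pd A k (\<lambda>w xs. P w xs \<longrightarrow> Q w xs)"
  using pd_disj[OF pd_not[OF assms(1)] assms(2)] by (rule pc_cong[rotated]) auto

lemma pd_le: "pc A k f \<Longrightarrow> pc A k g \<Longrightarrow> pd A k (\<lambda>w xs. f w xs \<le> g w xs)"
  by (rule pc_cong[OF _ pc_If[OF pc_minus[of A k f g] pc_const[of A k 1] pc_const[of A k 0]]]) auto

lemma pd_less: "pc A k f \<Longrightarrow> pc A k g \<Longrightarrow> pd A k (\<lambda>w xs. f w xs < g w xs)"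
  using pd_le[OF pc_Suc] by (simp add: Suc_le_eq)

lemma pd_eq: "pc A k f \<Longrightarrow> pc A k g \<Longrightarrow> pd A k (\<lambda>w xs. f w xs = g w xs)"
  using pd_conj[OF pd_le pd_le, of A k f g g f] by (simp add: eq_iff)

lemma pc_min: "pc A k f \<Longrightarrow> pc A k g \<Longrightarrow> pc A k (\<lambda>w xs. min (f w xs) (g w xs))"
  unfolding min_def by (intro pd_If pd_le)

text \<open>A counter that returns to 0 on reaching the modulus. With modulus 0 it never returns, in
  agreement with \<open>x mod 0 = x\<close>.\<close>

lemma pc_mod:
  assumes "pc A k f" "pc A k g"
  shows "pc A k (\<lambda>w xs. f w xs mod g w xs)"
proof (rule pc_comp2[OF _ assms, of "\<lambda>w x y. x mod y"])
  have rec: "rec_nat 0 (\<lambda>i a. if Suc ((i # a # xs) ! 1) = (i # a # xs) ! 3 then 0 else Suc ((i # a # xs) ! 1)) x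
      = x mod xs ! 1" for x xs
    by (induction x) (auto simp: mod_Suc numeral_3_eq_3)
  have "pc A 2 (\<lambda>w xs. rec_nat 0 (\<lambda>i a. if Suc ((i # a # xs) ! 1) = (i # a # xs) ! 3 then 0
      else Suc ((i # a # xs) ! 1)) (xs ! 0))"
  proof (rule pc_rec[where g = "\<lambda>w ys. if Suc (ys ! 1) = ys ! 3 then 0 else Suc (ys ! 1)"
      and bd = "\<lambda>w xs. xs ! 0"])
    show "poly_bounded A 2 (\<lambda>w xs. xs ! 0)"
      by (intro poly_bounded_nth) auto
    show "pc A (Suc (Suc 2)) (\<lambda>w ys. if Suc (ys ! 1) = ys ! 3 then 0 else Suc (ys ! 1))"
      by (intro pd_If pd_eq pc_zero pc_Suc pc_nth) auto
  next
    fix xs :: "nat list" and i assume "i \<le> xs ! 0"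
    then show "rec_nat 0 (\<lambda>i a. if Suc ((i # a # xs) ! 1) = (i # a # xs) ! 3 then 0
      else Suc ((i # a # xs) ! 1)) i \<le> xs ! 0"
      unfolding rec by (meson le_trans mod_less_eq_dividend)
  qed (auto intro!: pc_zero pc_nth)
  then show "pc A 2 (\<lambda>w xs. xs ! 0 mod xs ! 1)" by (simp only: rec)
qed

text \<open>A recursion puts index and accumulator in front of the environment; summands and events
  expect the index alone.\<close>

lemma pc_skip_acc:
  assumes "pc A (Suc k) g"
  shows "pc A (Suc (Suc k)) (\<lambda>w ys. g w (ys ! 0 # tl (tl ys)))"
proof (rule pc_cong[OF _ pc_reindex[OF assms, of "0 # [2..<Suc (Suc k)]"]])
  fix w and xs :: "nat list" assume l: "length xs = Suc (Suc k)"
  have "map ((!) xs) (0 # [2..<Suc (Suc k)]) = xs ! 0 # tl (tl xs)"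
  proof -
    have "map ((!) xs) [2..<Suc (Suc k)] = drop 2 xs"
      by (rule nth_equalityI) (use l in \<open>auto simp del: upt_Suc\<close>)
    then show ?thesis by (simp add: numeral_2_eq_2 drop_Suc del: upt_Suc)
  qed
  then show "g w (map ((!) xs) (0 # [2..<Suc (Suc k)])) = g w (xs ! 0 # tl (tl xs))" by (simp only:)
qed auto

lemma pc_sum:
  assumes b: "pc A k b" and g: "pc A (Suc k) g"
  shows "pc A k (\<lambda>w xs. \<Sum>i<b w xs. g w (i # xs))"
proof -
  have rec: "rec_nat 0 (\<lambda>i a. a + h i) n = (\<Sum>i<n. h i)" for h :: "nat \<Rightarrow> nat" and n
    by (induction n) auto
  have "pc A k (\<lambda>w xs. rec_nat 0 (\<lambda>i a. (\<lambda>w ys. ys ! 1 + g w (ys ! 0 # tl (tl ys))) w (i # a # xs)) (b w xs))"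
  proof (rule pc_rec[where bd = "\<lambda>w xs. \<Sum>i<b w xs. g w (i # xs)"])
    show "poly_bounded A k (\<lambda>w xs. \<Sum>i<b w xs. g w (i # xs))"
    proof (rule poly_boundedI)
      fix m
      obtain d where d: "d \<ge> m" "\<And>w xs. w \<in> lists {1..A} \<Longrightarrow> length xs = k \<Longrightarrow>
          args_le w m xs \<Longrightarrow> b w xs \<le> input_size w ^ d"
        using pc_boundedE[OF b] by metis
      obtain e where e: "\<And>w xs. w \<in> lists {1..A} \<Longrightarrow> length xs = Suc k \<Longrightarrow>
          args_le w d xs \<Longrightarrow> g w xs \<le> input_size w ^ e"
        using pc_boundedE[OF g] by metis
      have "(\<Sum>i<b w xs. g w (i # xs)) \<le> input_size w ^ d * input_size w ^ e"
        if w: "w \<in> lists {1..A}" "length xs = k" "args_le w m xs" for w xs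
      proof -
        have bw: "b w xs \<le> input_size w ^ d" using d(2) w by blast
        have "g w (i # xs) \<le> input_size w ^ e" if "i < b w xs" for i
          using w that bw by (intro e) (auto intro: power_mono_exp[OF _ d(1)])
        then have "(\<Sum>i<b w xs. g w (i # xs)) \<le> b w xs * input_size w ^ e"
          using sum_bounded_above[of "{..<b w xs}" "\<lambda>i. g w (i # xs)"] by simp
        also have "\<dots> \<le> input_size w ^ d * input_size w ^ e" using bw by simp
        finally show ?thesis .
      qed
      then show "\<exists>T. poly_growth T \<and> (\<forall>w xs. w \<in> lists {1..A} \<longrightarrow> length xs = k \<longrightarrow>
          args_le w m xs \<longrightarrow> (\<Sum>i<b w xs. g w (i # xs)) \<le> T (input_size w))"
        by (intro exI[of _ "\<lambda>N. N ^ d * N ^ e"]) (auto intro!: poly_growth_intros)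
    qed
  next
    fix w xs i assume "i \<le> b w xs"
    then have "(\<Sum>j<i. g w (j # xs)) \<le> (\<Sum>j<b w xs. g w (j # xs))"
      by (intro sum_mono2) auto
    then show "rec_nat 0 (\<lambda>i a. (i # a # xs) ! 1 + g w ((i # a # xs) ! 0 # tl (tl (i # a # xs)))) i
      \<le> (\<Sum>j<b w xs. g w (j # xs))" by (simp add: rec)
  qed (auto intro!: pc_zero pc_add pc_nth pc_skip_acc g b)
  then show ?thesis by (simp add: rec)
qed

lemma pd_ex:
  assumes b: "pc A k b" and P: "pd A (Suc k) P"
  shows "pd A k (\<lambda>w xs. \<exists>i<b w xs. P w (i # xs))"
proof (rule pd_cong[OF _ pd_less[OF pc_const[of A k 0] pc_sum[OF b P]]])
  fix w xs
  show "0 < (\<Sum>i<b w xs. of_bool (P w (i # xs)) :: nat) \<longleftrightarrow> (\<exists>i<b w xs. P w (i # xs))"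
    by (auto simp: card_gt_0_iff)
qed

lemma pd_all:
  assumes "pc A k b" "pd A (Suc k) P"
  shows "pd A k (\<lambda>w xs. \<forall>i<b w xs. P w (i # xs))"
  using pd_not[OF pd_ex[OF assms(1) pd_not[OF assms(2)]]] by simp

lemma pd_finite_ex:
  assumes "finite F" "\<And>a. a \<in> F \<Longrightarrow> pd A k (P a)"
  shows "pd A k (\<lambda>w xs. \<exists>a \<in> F. P a w xs)"
  using assms
proof (induction F)
  case (insert x F)
  have "pd A k (\<lambda>w xs. P x w xs \<or> (\<exists>a \<in> F. P a w xs))"
    using insert by (intro pd_disj) auto
  then show ?case by (rule pc_cong[rotated]) auto
qed (simp add: pc_zero)

text \<open>Branching over the finitely many values makes \<open>v\<close> a constant of the
  program, so \<open>F\<close> may depend on \<open>v\<close> in an arbitrary way.\<close>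

lemma pc_finite_case:
  assumes f: "pc A k f" and F: "\<And>v. v < Q \<Longrightarrow> pc A k (F v)"
  shows "pc A k (\<lambda>w xs. if f w xs < Q then F (f w xs) w xs else 0)"
  using F
proof (induction Q)
  case (Suc Q)
  have "pc A k (\<lambda>w xs. if f w xs = Q then F Q w xs else (if f w xs < Q then F (f w xs) w xs else 0))"
    by (intro pd_If pd_eq f pc_const Suc) auto
  then show ?case by (rule pc_cong[rotated]) (auto simp: less_Suc_eq)
qed (simp add: pc_zero)

text \<open>The length \<open>c\<close> is a constant, so searching for a list amounts to
  \<open>c\<close> nested bounded searches for a number.\<close>

lemma pd_list_ex:
  assumes b: "pc A k b" and P: "pd A (c + k) P"
  shows "pd A k (\<lambda>w xs. \<exists>ps. length ps = c \<and> (\<forall>p \<in> set ps. p < b w xs) \<and> P w (ps @ xs))"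
  using P
proof (induction c arbitrary: P)
  case 0
  then show ?case by simp
next
  case (Suc c)
  have "pd A (c + k) (\<lambda>w ys. \<exists>p < b w (drop c ys). P w (p # ys))"
    using Suc.prems by (intro pd_ex[OF pc_drop[OF b]]) simp
  from Suc.IH[OF this]
  show ?case
  proof (rule pd_cong[rotated])
    fix w and xs :: "nat list"
    show "(\<exists>ps. length ps = c \<and> (\<forall>p\<in>set ps. p < b w xs) \<and> (\<exists>p<b w (drop c (ps @ xs)). P w (p # ps @ xs))) \<longleftrightarrow>
       (\<exists>ps. length ps = Suc c \<and> (\<forall>p\<in>set ps. p < b w xs) \<and> P w (ps @ xs))"
      (is "?L \<longleftrightarrow> ?R")
    proof
      assume ?L
      then obtain ps p where "length ps = c" "\<forall>p\<in>set ps. p < b w xs" "p < b w xs" "P w (p # ps @ xs)" by auto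
      then show ?R by (intro exI[of _ "p # ps"]) auto
    next
      assume ?R
      then obtain p ps where "length ps = c" "\<forall>p\<in>set ps. p < b w xs" "p < b w xs" "P w (p # ps @ xs)"
        by (auto simp: length_Suc_conv)
      then show ?L by (intro exI[of _ ps]) auto
    qed
  qed
qed

lemma pc_rec_finite:
  assumes f: "pc A k f" and g: "pc A (Suc (Suc k)) g" and b: "pc A k b"
    and Q: "\<And>w (xs :: nat list). w \<in> lists {1..A} \<Longrightarrow> length xs = k \<Longrightarrow> f w xs < Q"
      "\<And>w i a (xs :: nat list). w \<in> lists {1..A} \<Longrightarrow> length xs = k \<Longrightarrow> a < Q \<Longrightarrow> g w (i # a # xs) < Q"
  shows "pc A k (\<lambda>w xs. rec_nat (f w xs) (\<lambda>i a. g w (i # a # xs)) (b w xs))"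
proof (rule pc_rec[OF f g b, where bd = "\<lambda>w xs. Q"])
  show "poly_bounded A k (\<lambda>w xs. Q)" by (rule poly_bounded_const)
next
  fix w i and xs :: "nat list" assume "w \<in> lists {1..A}" "length xs = k"
  then have "rec_nat (f w xs) (\<lambda>i a. g w (i # a # xs)) i < Q" by (induction i) (auto simp: Q)
  then show "rec_nat (f w xs) (\<lambda>i a. g w (i # a # xs)) i \<le> Q" by simp
qed

theorem pd_in_P:
  assumes "pd A 0 P"
  shows "in_P A {w \<in> lists {1..A}. P w []}"
  using pc_in_P[OF assms] by simp

section \<open>Arches and universality\<close>

context
  fixes \<sigma> :: nat
begin

abbreviation \<Sigma> :: "nat set" where
  "\<Sigma> \<equiv> alphabet \<sigma>"

text \<open>One step of the greedy arch factorization from the left: the state is the set of letters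
  seen since the last completed arch, a proper subset of \<open>\<Sigma>\<close>, and it is emptied
  on completion. \<open>rest\<close> and \<open>arches\<close> below give the final state and the
  number of completions.\<close>

definition add_letter :: "nat \<Rightarrow> nat set \<Rightarrow> nat set" where
  "add_letter a S = (if insert a S = \<Sigma> then {} else insert a S)"

fun rest :: "nat list \<Rightarrow> nat set \<Rightarrow> nat set" where
  "rest [] S = S"
| "rest (a # w) S = rest w (add_letter a S)"

fun arches :: "nat list \<Rightarrow> nat set \<Rightarrow> nat" where
  "arches [] S = 0"
| "arches (a # w) S = of_bool (insert a S = \<Sigma>) + arches w (add_letter a S)"

lemma rest_append [simp]: "rest (u @ v) S = rest v (rest u S)"
  by (induction u arbitrary: S) auto

lemma arches_append [simp]: "arches (u @ v) S = arches u S + arches v (rest u S)"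
  by (induction u arbitrary: S) auto

lemma add_letter_psubset: "a \<in> \<Sigma> \<Longrightarrow> S \<subset> \<Sigma> \<Longrightarrow> add_letter a S \<subset> \<Sigma>"
  by (auto simp: add_letter_def)

lemma rest_psubset: "w \<in> lists (\<Sigma>) \<Longrightarrow> S \<subset> \<Sigma> \<Longrightarrow> rest w S \<subset> \<Sigma>"
  by (induction w arbitrary: S) (auto simp: add_letter_psubset)

text \<open>Two runs on the same word keep letter sets that are comparable by inclusion. When only
  the run with the larger set closes its arch, its set becomes empty and the roles are swapped; so
  its lead never exceeds one arch and is lost at the next swap.\<close>

lemma arches_dominate:
  assumes "w \<in> lists (\<Sigma>)" "S \<subseteq> S'" "S' \<subset> \<Sigma>"
  shows "(arches w S' = arches w S \<and> rest w S \<subseteq> rest w S') \<or>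
    (arches w S' = Suc (arches w S) \<and> rest w S' \<subseteq> rest w S)"
  using assms
proof (induction w arbitrary: S S' rule: list.induct)
  case (Cons a w)
  then have a: "a \<in> \<Sigma>" and w: "w \<in> lists (\<Sigma>)" by auto
  have p: "add_letter a S \<subset> \<Sigma>" "add_letter a S' \<subset> \<Sigma>"
    using add_letter_psubset[OF a] Cons.prems by auto
  have sub: "insert a S \<subseteq> insert a S'" "insert a S' \<subseteq> \<Sigma>" using Cons.prems a by auto
  consider "insert a S = \<Sigma>" "insert a S' = \<Sigma>"
    | "insert a S \<noteq> \<Sigma>" "insert a S' = \<Sigma>"
    | "insert a S \<noteq> \<Sigma>" "insert a S' \<noteq> \<Sigma>"
    using sub by blast
  then show ?case
  proof cases
    case 1
    then show ?thesis by (simp add: add_letter_def)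
  next
    case 2
    then show ?thesis using Cons.IH[OF w, of "{}" "insert a S"] p by (auto simp: add_letter_def)
  next
    case 3
    then show ?thesis using Cons.IH[OF w sub(1)] p by (auto simp: add_letter_def)
  qed
qed auto

text \<open>A letter not yet in \<open>S\<close> has to occur before the current arch closes, so
  every arch supplies one letter of \<open>u\<close>. The condition on \<open>hd u\<close> expresses
  that its letter has not been passed.\<close>

lemma arches_ge_subseq:
  assumes "w \<in> lists (\<Sigma>)" "u \<in> lists (\<Sigma>)" "S \<subset> \<Sigma>"
    "length u \<le> arches w S" "u = [] \<or> hd u \<notin> S"
  shows "subseq u w"
  using assms
proof (induction w arbitrary: u S rule: list.induct)
  case (Cons a w)
  show ?case
  proof (cases u)
    case (Cons x u')
    have a: "a \<in> \<Sigma>" and w: "w \<in> lists (\<Sigma>)" using Cons.prems by auto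
    have u': "u' \<in> lists (\<Sigma>)" and x: "x \<in> \<Sigma>" "x \<notin> S" using Cons.prems Cons by auto
    have p: "add_letter a S \<subset> \<Sigma>" using add_letter_psubset[OF a] Cons.prems by auto
    have p0: "{} \<subset> \<Sigma>" using a by auto
    show ?thesis
    proof (cases "x = a")
      case True
      \<comment> \<open>After a match the set is reset to \<open>{}\<close>, so that the next letter
        of \<open>u\<close> may be arbitrary. This costs at most the arch in progress, which has
        just supplied \<open>x\<close>.\<close>
      have "arches w (add_letter a S) \<le> Suc (arches w {})"
        using arches_dominate[OF w, of "{}" "add_letter a S"] p by auto
      then have "length u' \<le> arches w {}"
        using Cons.prems(4) Cons by (auto simp: add_letter_def split: if_splits)
      then have "subseq u' w" using Cons.IH[OF w u' p0] by simp
      then show ?thesis using True Cons by simp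
    next
      case False
      then have i: "insert a S \<noteq> \<Sigma>" using x by auto
      then have "length u \<le> arches w (insert a S)" "insert a S \<subset> \<Sigma>"
        using Cons.prems(4) p by (auto simp: add_letter_def)
      then have "subseq u w" using Cons.IH[OF w Cons.prems(2), of "insert a S"] False x Cons by auto
      then show ?thesis by (rule list_emb_Cons)
    qed
  qed simp
qed auto

text \<open>The witness consists of the letters that close the arches, followed by a letter missing
  from the unfinished rest. Each of the former occurs in its arch for the first time at its end, so
  a greedy match uses up the whole arch.\<close>

lemma arches_non_subseq:
  assumes "w \<in> lists (\<Sigma>)" "S \<subset> \<Sigma>"
  shows "\<exists>u \<in> lists (\<Sigma>). length u = Suc (arches w S) \<and> hd u \<notin> S \<and> \<not> subseq u w"
  using assms
proof (induction w arbitrary: S rule: list.induct)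
  case Nil
  then obtain x where "x \<in> \<Sigma>" "x \<notin> S" by auto
  then show ?case by (intro bexI[of _ "[x]"]) auto
next
  case (Cons a w)
  then have a: "a \<in> \<Sigma>" and w: "w \<in> lists (\<Sigma>)" by auto
  show ?case
  proof (cases "insert a S = \<Sigma>")
    case True
    then have "a \<notin> S" using Cons.prems by auto
    obtain u where "u \<in> lists (\<Sigma>)" "length u = Suc (arches w {})" "\<not> subseq u w"
      using Cons.IH[OF w, of "{}"] a by auto
    then show ?thesis using True a \<open>a \<notin> S\<close> by (intro bexI[of _ "a # u"]) (auto simp: add_letter_def)
  next
    case False
    then obtain u where u: "u \<in> lists (\<Sigma>)" "length u = Suc (arches w (insert a S))"
      "hd u \<notin> insert a S" "\<not> subseq u w"
      using Cons.IH[OF w, of "insert a S"] Cons.prems a by auto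
    then have "\<not> subseq u (a # w)" by (cases u) auto
    then show ?thesis using u False by (intro bexI[of _ u]) (auto simp: add_letter_def)
  qed
qed

section \<open>The universality index as the number of arches\<close>

lemma alphabet_nonempty: "\<sigma> \<ge> 1 \<Longrightarrow> {} \<subset> \<Sigma>"
  by (auto simp: alphabet_def)

lemma finite_alphabet: "finite (\<Sigma>)"
  by (simp add: alphabet_def)

lemma universal_iff:
  assumes "\<sigma> \<ge> 1" "w \<in> lists (\<Sigma>)"
  shows "universal \<sigma> k w \<longleftrightarrow> k \<le> arches w {}"
proof
  assume "k \<le> arches w {}"
  then show "universal \<sigma> k w"
    unfolding universal_def
    using arches_ge_subseq[OF assms(2) _ alphabet_nonempty[OF assms(1)]] by auto
next
  assume "universal \<sigma> k w"
  moreover obtain u where "u \<in> lists (\<Sigma>)" "length u = Suc (arches w {})" "\<not> subseq u w"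
    using arches_non_subseq[OF assms(2) alphabet_nonempty[OF assms(1)]] by auto
  ultimately show "k \<le> arches w {}" unfolding universal_def by (metis not_less_eq_eq)
qed

lemma universality_index_eq:
  assumes "\<sigma> \<ge> 1" "w \<in> lists (\<Sigma>)"
  shows "universality_index \<sigma> w = arches w {}"
  unfolding universality_index_def universal_iff[OF assms] by (rule Greatest_equality) auto

text \<open>The factorizations of \<open>v\<close> and \<open>w\<close> need not be aligned, so the
  numbers of arches are compared through universality, which passes to superwords.\<close>

lemma arches_subseq_mono:
  assumes "\<sigma> \<ge> 1" "w \<in> lists (\<Sigma>)" "v \<in> lists (\<Sigma>)" "subseq v w"
  shows "arches v {} \<le> arches w {}"
proof -
  have "universal \<sigma> (arches v {}) v" using universal_iff[OF assms(1,3)] by simp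
  then have "universal \<sigma> (arches v {}) w"
    using assms(4) unfolding universal_def by (meson subseq_order.trans)
  then show ?thesis using universal_iff[OF assms(1,2)] by simp
qed

text \<open>If \<open>a\<close> closes an arch, this is the only gain, since a restart from
  \<open>{}\<close> cannot get ahead of the run from \<open>R\<close>. Otherwise \<open>a\<close>
  only enlarges the current set, which gains at most one arch.\<close>

lemma arches_insert_letter:
  assumes "\<sigma> \<ge> 1" "u @ a # v \<in> lists (\<Sigma>)"
  shows "arches (u @ a # v) {} \<le> Suc (arches (u @ v) {})"
proof -
  have a: "a \<in> \<Sigma>" and uv: "u \<in> lists (\<Sigma>)" "v \<in> lists (\<Sigma>)"
    using assms(2) by auto
  define R where "R = rest u {}"
  have R: "R \<subset> \<Sigma>" using rest_psubset[OF uv(1) alphabet_nonempty[OF assms(1)]] by (simp add: R_def)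
  show ?thesis
  proof (cases "insert a R = \<Sigma>")
    case True
    then show ?thesis using arches_dominate[OF uv(2), of "{}" R] R
      by (auto simp: R_def[symmetric] add_letter_def)
  next
    case False
    then have "insert a R \<subset> \<Sigma>" using R a by auto
    then have "arches v (insert a R) \<le> Suc (arches v R)"
      using arches_dominate[OF uv(2) subset_insertI, of a R] by auto
    then show ?thesis using False by (simp add: R_def[symmetric] add_letter_def)
  qed
qed

section \<open>Prolonging a word by exactly one arch\<close>

lemma arches_none:
  "set w \<union> S \<subset> \<Sigma> \<Longrightarrow> arches w S = 0 \<and> rest w S = set w \<union> S"
proof (induction w arbitrary: S)
  case (Cons a w)
  then have "insert a S \<noteq> \<Sigma>" by auto
  then show ?case using Cons.IH[of "insert a S"] Cons.prems by (auto simp: add_letter_def)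
qed simp

lemma arches_complement:
  "distinct w \<Longrightarrow> w \<noteq> [] \<Longrightarrow> set w \<inter> S = {} \<Longrightarrow> set w \<union> S = \<Sigma> \<Longrightarrow>
   arches w S = 1 \<and> rest w S = {}"
proof (induction w arbitrary: S)
  case (Cons a w)
  show ?case
  proof (cases "w = []")
    case True
    then show ?thesis using Cons.prems by (auto simp: add_letter_def)
  next
    case False
    then obtain b where "b \<in> set w" by (cases w) auto
    then have "insert a S \<noteq> \<Sigma>" using Cons.prems by auto
    then show ?thesis using Cons.IH[of "insert a S"] Cons.prems False by (auto simp: add_letter_def)
  qed
qed simp

lemma arches_zero:
  "arches w S = 0 \<Longrightarrow> rest w S = set w \<union> S"
  by (induction w arbitrary: S) (auto simp: add_letter_def split: if_splits)

lemma arches_pos: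
  assumes "\<sigma> \<ge> 1" "set w = \<Sigma>" "S \<subset> \<Sigma>"
  shows "arches w S > 0"
proof (rule ccontr)
  assume "\<not> arches w S > 0"
  then have "rest w S = \<Sigma>" using arches_zero[of w S] assms by auto
  moreover have "rest w S \<subset> \<Sigma>" using assms by (intro rest_psubset) auto
  ultimately show False by simp
qed

text \<open>Once an arch has been closed, the state was empty at that point and has since collected
  exactly the letters read after it.\<close>

lemma rest_suffix:
  assumes "arches w S > 0"
  shows "\<exists>u v. w = u @ v \<and> rest w S = set v"
  using assms
proof (induction w rule: rev_induct)
  case (snoc a w)
  show ?case
  proof (cases "insert a (rest w S) = \<Sigma>")
    case True
    then show ?thesis by (intro exI[of _ "w @ [a]"] exI[of _ "[]"]) (auto simp: add_letter_def)
  next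
    case False
    then have "arches w S > 0" using snoc.prems by simp
    then obtain u v where "w = u @ v" "rest w S = set v" using snoc.IH by blast
    then show ?thesis using False
      by (intro exI[of _ u] exI[of _ "v @ [a]"]) (simp add: add_letter_def del: rest_append, simp add: add_letter_def)
  qed
qed simp

lemma remdups_append_filter: "remdups (u @ v) = filter (\<lambda>x. x \<notin> set v) (remdups u) @ remdups v"
  by (induction u) auto

text \<open>
  Since \<^const>\<open>remdups\<close> keeps last occurrences, it lists the letters missing from any suffix of
  \<open>w\<close> before the letters of that suffix.
\<close>

lemma arches_pump:
  assumes "\<sigma> \<ge> 1" "set w = \<Sigma>" "S \<subset> \<Sigma>"
  shows "arches (w @ remdups w) S = Suc (arches w S) \<and> rest (w @ remdups w) S = rest w S"
proof -
  \<comment> \<open>The split depends on \<open>S\<close>, the appended word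
    \<open>remdups w\<close> does not; so one extension serves all starting sets.\<close>
  obtain u v where uv: "w = u @ v" "rest w S = set v"
    using rest_suffix[OF arches_pos[OF assms]] by blast
  have "w \<in> lists (\<Sigma>)" using assms(2) by auto
  then have v: "set v \<subset> \<Sigma>" using rest_psubset[of w S] assms(3) uv(2) by simp
  define x where "x = filter (\<lambda>x. x \<notin> set v) (remdups u)"
  have r: "remdups w = x @ remdups v" by (simp add: uv remdups_append_filter x_def)
  have sx: "set x = \<Sigma> - set v" using assms(2) uv by (auto simp: x_def)
  then have "x \<noteq> []" using v by force
  moreover have "distinct x" by (simp add: x_def)
  \<comment> \<open>The last letter of \<open>x\<close> closes the open arch, and
    \<open>remdups v\<close> then rebuilds the state \<open>set v\<close>.\<close>
  ultimately have "arches x (set v) = 1 \<and> rest x (set v) = {}"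
    using sx v by (intro arches_complement) auto
  moreover have "arches (remdups v) {} = 0 \<and> rest (remdups v) {} = set v"
    using arches_none[of "remdups v" "{}"] v by simp
  ultimately show ?thesis by (simp add: r uv(2))
qed

definition pump :: "nat list \<Rightarrow> nat list" where
  "pump w = w @ remdups w"

lemma set_pump [simp]: "set ((pump ^^ m) w) = set w"
  by (induction m) (auto simp: pump_def)

lemma arches_pump_funpow:
  assumes "\<sigma> \<ge> 1" "set w = \<Sigma>" "S \<subset> \<Sigma>"
  shows "arches ((pump ^^ m) w) S = arches w S + m \<and> rest ((pump ^^ m) w) S = rest w S"
proof (induction m)
  case (Suc m)
  then show ?case using arches_pump[OF assms(1) _ assms(3), of "(pump ^^ m) w"] assms(2)
    by (simp add: pump_def[of "(pump ^^ m) w"])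
qed simp

section \<open>Words up to a constant number of arches\<close>

definition shifts :: "nat \<Rightarrow> nat list \<Rightarrow> nat list \<Rightarrow> bool" where
  "shifts m v w \<longleftrightarrow> (\<forall>S. S \<subset> \<Sigma> \<longrightarrow> arches w S = arches v S + m \<and> rest w S = rest v S)"

text \<open>By \<open>arches_dominate\<close>, a start in \<open>S\<close> gains 0 or 1 arches over
  a start in \<open>{}\<close>. So there are finitely many possibilities for the map from
  \<open>S\<close> to this gain and the final state. The key also records whether all letters occur,
  as only such words can be pumped. A member with the fewest arches represents its class, so that no
  offset is negative.\<close>

lemma finite_representatives:
  assumes "\<sigma> \<ge> 1"
  obtains W where "finite W" "W \<subseteq> lists (\<Sigma>)"
    "\<forall>w \<in> lists (\<Sigma>). \<exists>v \<in> W. \<exists>m. shifts m v w \<and> (set v \<noteq> \<Sigma> \<longrightarrow> m = 0)"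
proof -
  define L where "L = lists (\<Sigma>)"
  define key where "key = (\<lambda>w. (set w = \<Sigma>,
    (\<lambda>S. (S, arches w S - arches w {}, rest w S)) ` {S. S \<subset> \<Sigma>}))"
  define rep where "rep = (\<lambda>t. ARG_MIN (\<lambda>w. arches w {}) w. w \<in> L \<and> key w = t)"
  have ne: "{} \<subset> \<Sigma>" using alphabet_nonempty[OF assms] .
  have ge: "arches w {} \<le> arches w S \<and> arches w S \<le> Suc (arches w {})"
    if "w \<in> L" "S \<subset> \<Sigma>" for w S
    using arches_dominate[of w "{}" S] that by (auto simp: L_def)
  have "key w \<in> UNIV \<times> Pow (Pow (\<Sigma>) \<times> {0, 1} \<times> Pow (\<Sigma>))" if w: "w \<in> L" for w
  proof -
    have "(S, arches w S - arches w {}, rest w S) \<in> Pow (\<Sigma>) \<times> {0, 1} \<times> Pow (\<Sigma>)"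
      if S: "S \<subset> \<Sigma>" for S
    proof -
      have "arches w S - arches w {} = 0 \<or> arches w S - arches w {} = 1" using ge[OF w S] by linarith
      then show ?thesis using rest_psubset[of w S] w S by (auto simp: L_def)
    qed
    then have "(\<lambda>S. (S, arches w S - arches w {}, rest w S)) ` {S. S \<subset> \<Sigma>}
      \<subseteq> Pow (\<Sigma>) \<times> {0, 1} \<times> Pow (\<Sigma>)" by blast
    then show ?thesis unfolding key_def by simp
  qed
  then have "key ` L \<subseteq> UNIV \<times> Pow (Pow (\<Sigma>) \<times> {0, 1} \<times> Pow (\<Sigma>))" by blast
  then have fin: "finite (key ` L)"
    by (rule finite_subset) (simp add: finite_alphabet)
  have rep: "rep (key w) \<in> L \<and> key (rep (key w)) = key w \<and> arches (rep (key w)) {} \<le> arches w {}"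
    if "w \<in> L" for w
    unfolding rep_def using arg_min_nat_lemma[of "\<lambda>v. v \<in> L \<and> key v = key w" w "\<lambda>w. arches w {}"] that by auto
  show thesis
  proof (rule that[of "rep ` key ` L"])
    show "finite (rep ` key ` L)" using fin by simp
    show "rep ` key ` L \<subseteq> lists (\<Sigma>)" using rep unfolding L_def by blast
    show "\<forall>w \<in> lists (\<Sigma>). \<exists>v \<in> rep ` key ` L. \<exists>m. shifts m v w \<and> (set v \<noteq> \<Sigma> \<longrightarrow> m = 0)"
    proof
      fix w assume w: "w \<in> lists (\<Sigma>)"
      define v where "v = rep (key w)"
      have v: "v \<in> L" "key v = key w" "arches v {} \<le> arches w {}" and wL: "w \<in> L"
        using rep[of w] w by (auto simp: v_def L_def)
      \<comment> \<open>Each triple in the key contains its own \<open>S\<close>, so equal sets of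
        triples give equal entries for every \<open>S\<close>.\<close>
      have keyS: "arches v S - arches v {} = arches w S - arches w {} \<and> rest v S = rest w S"
        if "S \<subset> \<Sigma>" for S
      proof -
        have "(S, arches w S - arches w {}, rest w S) \<in> snd (key v)"
          using that unfolding v(2) by (auto simp: key_def)
        then show ?thesis by (auto simp: key_def)
      qed
      have "shifts (arches w {} - arches v {}) v w"
        unfolding shifts_def
      proof (intro allI impI)
        fix S assume "S \<subset> \<Sigma>"
        then show "arches w S = arches v S + (arches w {} - arches v {}) \<and> rest w S = rest v S"
          using keyS[of S] ge[OF v(1), of S] ge[OF wL, of S] v(3) by auto
      qed
      \<comment> \<open>A word that misses a letter closes no arch from \<open>{}\<close>, which
        makes the offset \<open>arches w {} - arches v {}\<close> zero.\<close>
      moreover have "arches w {} = 0" if "set v \<noteq> \<Sigma>"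
      proof -
        have "set w \<noteq> \<Sigma>" using v(2) that by (simp add: key_def)
        then have "set w \<subset> \<Sigma>" using w by auto
        then show ?thesis using arches_none[of w "{}"] by simp
      qed
      ultimately show "\<exists>v \<in> rep ` key ` L. \<exists>m. shifts m v w \<and> (set v \<noteq> \<Sigma> \<longrightarrow> m = 0)"
        using wL by (intro bexI[of _ v] exI[of _ "arches w {} - arches v {}"]) (auto simp: v_def)
    qed
  qed
qed

section \<open>Substitutions and variables occurring exactly once\<close>

lemma apply_subst_simps [simp]:
  "apply_subst h [] = []"
  "apply_subst h (Terminal a # \<alpha>) = a # apply_subst h \<alpha>"
  "apply_subst h (Variable x # \<alpha>) = h x @ apply_subst h \<alpha>"
  "apply_subst h (\<alpha> @ \<beta>) = apply_subst h \<alpha> @ apply_subst h \<beta>"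
  by (simp_all add: apply_subst_def)

lemma vars_simps [simp]:
  "vars [] = {}" "vars (Terminal a # \<alpha>) = vars \<alpha>" "vars (Variable x # \<alpha>) = insert x (vars \<alpha>)"
  "vars (\<alpha> @ \<beta>) = vars \<alpha> \<union> vars \<beta>"
  by (auto simp: vars_def)

lemma finite_vars: "finite (vars \<alpha>)"
proof -
  have "vars \<alpha> = Variable -` set \<alpha>" by (auto simp: vars_def)
  then show ?thesis by (simp add: finite_vimageI inj_def)
qed

lemma Nil_in_patterns [simp]: "[] \<in> patterns \<sigma>"
  by (simp add: patterns_def)

lemma Cons_in_patterns [simp]:
  "Terminal a # \<alpha> \<in> patterns \<sigma> \<longleftrightarrow> a \<in> \<Sigma> \<and> \<alpha> \<in> patterns \<sigma>"
  "Variable x # \<alpha> \<in> patterns \<sigma> \<longleftrightarrow> \<alpha> \<in> patterns \<sigma>"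
  by (auto simp: patterns_def)

lemma append_in_patterns [simp]: "\<alpha> @ \<beta> \<in> patterns \<sigma> \<longleftrightarrow> \<alpha> \<in> patterns \<sigma> \<and> \<beta> \<in> patterns \<sigma>"
  by (auto simp: patterns_def)

lemma apply_subst_in_lists:
  "\<alpha> \<in> patterns \<sigma> \<Longrightarrow> (\<And>x. x \<in> vars \<alpha> \<Longrightarrow> h x \<in> lists (\<Sigma>)) \<Longrightarrow> apply_subst h \<alpha> \<in> lists (\<Sigma>)"
proof (induction \<alpha>)
  case (Cons s \<alpha>)
  then show ?case by (cases s) auto
qed simp

lemma apply_subst_cong: "(\<And>x. x \<in> vars \<alpha> \<Longrightarrow> h x = h' x) \<Longrightarrow> apply_subst h \<alpha> = apply_subst h' \<alpha>"
proof (induction \<alpha>)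
  case (Cons s \<alpha>)
  then show ?case by (cases s) auto
qed simp

abbreviation erase :: "symbol list \<Rightarrow> nat list" where
  "erase \<equiv> apply_subst (\<lambda>_. [])"

lemma subseq_erase: "subseq (erase \<alpha>) (apply_subst h \<alpha>)"
proof (induction \<alpha>)
  case (Cons s \<alpha>)
  then show ?case by (cases s) (auto intro: list_emb_append2)
qed simp

lemma match_univ_arches:
  assumes "\<sigma> \<ge> 1" "\<alpha> \<in> patterns \<sigma>"
  shows "match_univ \<sigma> \<alpha> k \<longleftrightarrow> (\<exists>h \<in> substitutions \<sigma>. arches (apply_subst h \<alpha>) {} = k)"
  unfolding match_univ_def
  using universality_index_eq[OF assms(1) apply_subst_in_lists[OF assms(2)]]
  by (auto simp: substitutions_def)

lemma match_univ_ge: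
  assumes "\<sigma> \<ge> 1" "\<alpha> \<in> patterns \<sigma>" "match_univ \<sigma> \<alpha> k"
  shows "arches (erase \<alpha>) {} \<le> k"
proof -
  obtain h where h: "\<And>x. h x \<in> lists (\<Sigma>)" "arches (apply_subst h \<alpha>) {} = k"
    using assms by (auto simp: match_univ_arches substitutions_def)
  have "arches (erase \<alpha>) {} \<le> arches (apply_subst h \<alpha>) {}"
    using assms h by (intro arches_subseq_mono apply_subst_in_lists subseq_erase) auto
  then show ?thesis using h by simp
qed

lemma arches_replicate_alphabet:
  assumes "\<sigma> \<ge> 1"
  shows "arches (concat (replicate k [1..<Suc \<sigma>])) {} = k"
proof (induction k)
  case (Suc k)
  have "arches [1..<Suc \<sigma>] {} = 1 \<and> rest [1..<Suc \<sigma>] {} = {}"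
    using assms by (intro arches_complement) (auto simp: alphabet_def)
  then show ?case using Suc by (simp del: upt_Suc)
qed simp

lemma match_univ_unique_variable:
  assumes \<sigma>: "\<sigma> \<ge> 1" and \<alpha>: "\<alpha> \<in> patterns \<sigma>" and x: "count_list \<alpha> (Variable x) = 1"
  shows "match_univ \<sigma> \<alpha> k \<longleftrightarrow> arches (erase \<alpha>) {} \<le> k"
proof
  assume k: "arches (erase \<alpha>) {} \<le> k"
  have "Variable x \<in> set \<alpha>" using x by (metis count_list_0_iff zero_neq_one)
  then obtain \<beta> \<gamma> where \<beta>\<gamma>: "\<alpha> = \<beta> @ Variable x # \<gamma>" by (meson split_list)
  then have nx: "Variable x \<notin> set \<beta>" "Variable x \<notin> set \<gamma>" using x by (auto simp: count_list_0_iff)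
  \<comment> \<open>\<open>P\<close> alone has \<open>k\<close> arches, so substituting all of it
    reaches at least \<open>k\<close>; its prefixes lead there from the empty word one letter at a
    time.\<close>
  define P where "P = concat (replicate k [1..<Suc \<sigma>])"
  define f where "f = (\<lambda>j. erase \<beta> @ take j P @ erase \<gamma>)"
  have P: "P \<in> lists (\<Sigma>)" by (auto simp: P_def alphabet_def simp del: upt_Suc split: if_splits)
  then have tP: "take j P \<in> lists (\<Sigma>)" for j by (auto dest: in_set_takeD)
  have fL: "f j \<in> lists (\<Sigma>)" for j
  proof -
    have "erase \<beta> \<in> lists (\<Sigma>)" "erase \<gamma> \<in> lists (\<Sigma>)"
      using \<alpha> \<beta>\<gamma> apply_subst_in_lists[of \<beta> "\<lambda>_. []"] apply_subst_in_lists[of \<gamma> "\<lambda>_. []"] by simp_all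
    then show ?thesis using tP by (simp add: f_def)
  qed
  have f0: "arches (f 0) {} \<le> k" using k by (simp add: f_def \<beta>\<gamma>)
  have "subseq (P @ []) (P @ erase \<gamma>)" by (rule list_emb_append_mono) simp_all
  then have "subseq P (f (length P))" unfolding f_def by (simp add: list_emb_append2)
  then have "arches P {} \<le> arches (f (length P)) {}" by (rule arches_subseq_mono[OF \<sigma> fL P])
  then have fP: "k \<le> arches (f (length P)) {}" using arches_replicate_alphabet[OF \<sigma>] by (simp add: P_def)
  \<comment> \<open>At the first prefix that reaches \<open>k\<close> the value is exactly
    \<open>k\<close>: either the prefix is empty, or the preceding one was still below
    \<open>k\<close> and a letter adds at most one arch.\<close>
  define j where "j = (LEAST j. k \<le> arches (f j) {})"
  have j: "k \<le> arches (f j) {}" unfolding j_def using fP by (rule LeastI)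
  have jl: "j \<le> length P" unfolding j_def using fP by (rule Least_le)
  have "arches (f j) {} \<le> k"
  proof (cases j)
    case (Suc i)
    then have "i < j" by simp
    then have i: "arches (f i) {} < k" unfolding j_def by (meson not_le not_less_Least)
    have fj: "f j = (erase \<beta> @ take i P) @ P ! i # erase \<gamma>" and fi: "f i = (erase \<beta> @ take i P) @ erase \<gamma>"
      using Suc jl by (auto simp: f_def take_Suc_conv_app_nth)
    have "arches (f j) {} \<le> Suc (arches (f i) {})"
      unfolding fj fi by (rule arches_insert_letter[OF \<sigma>]) (use fL[of j] in \<open>simp only: fj\<close>)
    then show ?thesis using i by linarith
  qed (use f0 in simp)
  with j have fj: "arches (f j) {} = k" by simp
  define h where "h = (\<lambda>y. if y = x then take j P else [])"
  have "apply_subst h \<beta> = erase \<beta>" "apply_subst h \<gamma> = erase \<gamma>"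
    using nx by (auto intro!: apply_subst_cong simp: h_def vars_def)
  then have "apply_subst h \<alpha> = f j" by (simp add: \<beta>\<gamma> f_def h_def)
  moreover have "h \<in> substitutions \<sigma>" using tP by (auto simp: h_def substitutions_def)
  ultimately show "match_univ \<sigma> \<alpha> k" using fj match_univ_arches[OF \<sigma> \<alpha>] by metis
qed (use match_univ_ge[OF \<sigma> \<alpha>] in blast)

lemma match_univ_no_variable:
  assumes "\<sigma> \<ge> 1" "\<alpha> \<in> patterns \<sigma>" "vars \<alpha> = {}"
  shows "match_univ \<sigma> \<alpha> k \<longleftrightarrow> arches (erase \<alpha>) {} = k"
proof -
  have "apply_subst h \<alpha> = erase \<alpha>" for h using assms(3) by (intro apply_subst_cong) auto
  moreover have "(\<lambda>_. []) \<in> substitutions \<sigma>" by (simp add: substitutions_def)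
  ultimately show ?thesis unfolding match_univ_arches[OF assms(1,2)] by metis
qed

section \<open>Patterns with boundedly many variables\<close>

abbreviation sum_vars :: "(nat \<Rightarrow> nat) \<Rightarrow> symbol list \<Rightarrow> nat" where
  "sum_vars f \<alpha> \<equiv> \<Sum>s\<leftarrow>\<alpha>. case s of Terminal a \<Rightarrow> 0 | Variable x \<Rightarrow> f x"

text \<open>Both words reach the same state after each symbol of the pattern, so the offsets add up,
  \<open>m x\<close> once for every occurrence of \<open>x\<close>.\<close>

lemma apply_subst_shifts:
  assumes "\<sigma> \<ge> 1" "\<alpha> \<in> patterns \<sigma>" "\<And>x. x \<in> vars \<alpha> \<Longrightarrow> v x \<in> lists (\<Sigma>)"
    "\<And>x. x \<in> vars \<alpha> \<Longrightarrow> shifts (m x) (v x) (h x)"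
  shows "shifts (sum_vars m \<alpha>) (apply_subst v \<alpha>) (apply_subst h \<alpha>)"
  using assms(2-)
proof (induction \<alpha>)
  case (Cons s \<alpha>)
  show ?case
  proof (cases s)
    case (Terminal a)
    then show ?thesis using Cons add_letter_psubset by (auto simp: shifts_def)
  next
    case (Variable x)
    then have "shifts (m x) (v x) (h x)" "v x \<in> lists (\<Sigma>)" using Cons.prems by auto
    then show ?thesis using Cons Variable rest_psubset by (auto simp: shifts_def)
  qed
qed (simp add: shifts_def)

text \<open>
  Reducing all \<open>m\<^sub>j\<close> modulo a nonzero \<open>u\<^sub>i\<close> changes the sum by a multiple of \<open>u\<^sub>i\<close>, which can be given
  back to \<open>m\<^sub>i\<close>.
\<close>

lemma representable_iff:
  fixes C k c :: nat and u :: "nat \<Rightarrow> nat"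
  assumes "\<And>j. j < c \<Longrightarrow> u j < N"
  shows "(\<exists>ms. length ms = c \<and> k = C + (\<Sum>j<c. u j * ms ! j)) \<longleftrightarrow>
    k = C \<or> (\<exists>i<c. u i > 0 \<and> (\<exists>ms. length ms = c \<and> (\<forall>m \<in> set ms. m < N) \<and>
       C + (\<Sum>j<c. u j * ms ! j) \<le> k \<and> (C + (\<Sum>j<c. u j * ms ! j)) mod u i = k mod u i))"
  (is "?L \<longleftrightarrow> _ \<or> ?R")
proof
  assume ?L
  then obtain ms where ms: "length ms = c" "k = C + (\<Sum>j<c. u j * ms ! j)" by blast
  show "k = C \<or> ?R"
  proof (cases "\<exists>i<c. u i > 0")
    case True
    then obtain i where i: "i < c" "u i > 0" by blast
    define ms' where "ms' = map (\<lambda>m. m mod u i) ms"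
    have nth: "j < c \<Longrightarrow> ms' ! j = ms ! j mod u i" for j using ms(1) by (simp add: ms'_def)
    have "(\<Sum>j<c. u j * ms' ! j) \<le> (\<Sum>j<c. u j * ms ! j)" by (intro sum_mono) (simp add: nth)
    moreover have "(\<Sum>j<c. u j * ms' ! j) mod u i = (\<Sum>j<c. u j * ms ! j) mod u i"
    proof -
      have "(\<Sum>j<c. (u j * ms' ! j) mod u i) = (\<Sum>j<c. (u j * ms ! j) mod u i)"
        by (intro sum.cong) (auto simp: nth mod_mult_right_eq)
      then show ?thesis
        using mod_sum_eq[of "\<lambda>j. u j * ms' ! j" "u i" "{..<c}"] mod_sum_eq[of "\<lambda>j. u j * ms ! j" "u i" "{..<c}"]
        by simp
    qed
    then have "(C + (\<Sum>j<c. u j * ms' ! j)) mod u i = k mod u i" unfolding ms(2) by (rule mod_add_cong[OF refl])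
    moreover have "\<forall>m \<in> set ms'. m < N"
    proof
      fix m assume "m \<in> set ms'"
      then have "m < u i" using i by (auto simp: ms'_def)
      also have "\<dots> < N" using assms i by blast
      finally show "m < N" .
    qed
    ultimately have ?R using i ms by (intro exI[of _ i] conjI exI[of _ ms']) (auto simp: ms'_def)
    then show ?thesis ..
  next
    \<comment> \<open>With all coefficients zero only \<open>C\<close> itself is represented; there
      is no modulus then, which is why \<open>k = C\<close> is a separate disjunct.\<close>
    case False
    then show ?thesis using ms by auto
  qed
next
  assume "k = C \<or> ?R"
  then show ?L
  proof
    assume "k = C"
    then show ?L by (intro exI[of _ "replicate c 0"]) auto
  next
    assume ?R
    then obtain i ms where i: "i < c" "u i > 0" and ms: "length ms = c" "C + (\<Sum>j<c. u j * ms ! j) \<le> k"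
      "(C + (\<Sum>j<c. u j * ms ! j)) mod u i = k mod u i" by blast
    obtain q where q: "k = C + (\<Sum>j<c. u j * ms ! j) + u i * q"
    proof -
      have "u i dvd k - (C + (\<Sum>j<c. u j * ms ! j))" 
        using mod_eq_dvd_iff_nat[OF ms(2), of "u i"] ms(3) by metis
      then obtain q where "k - (C + (\<Sum>j<c. u j * ms ! j)) = u i * q" by (rule dvdE)
      then show thesis using ms(2) that[of q] by linarith
    qed
    define ms' where "ms' = ms[i := ms ! i + q]"
    have "(\<Sum>j<c. u j * ms' ! j) = (\<Sum>j<c. u j * ms ! j + (if j = i then u i * q else 0))"
      using i(1) ms(1) by (intro sum.cong) (auto simp: ms'_def nth_list_update algebra_simps)
    also have "\<dots> = (\<Sum>j<c. u j * ms ! j) + u i * q" using i(1) by (simp add: sum.distrib)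
    finally show ?L using q ms(1) by (intro exI[of _ ms']) (auto simp: ms'_def)
  qed
qed

text \<open>
  The entries \<open>None\<close> of \<open>zs\<close> only pad the list of variables to a fixed length. If \<open>x\<close> is not in
  \<open>zs\<close>, then \<open>class_of zs x\<close> is unspecified.
\<close>

definition class_of :: "nat option list \<Rightarrow> nat \<Rightarrow> nat" where
  "class_of zs x = (LEAST j. j < length zs \<and> zs ! j = Some x)"

lemma class_of:
  assumes "Some x \<in> set zs"
  shows "class_of zs x < length zs" "zs ! class_of zs x = Some x"
proof -
  obtain j where "j < length zs \<and> zs ! j = Some x" using assms by (auto simp: in_set_conv_nth)
  then have "class_of zs x < length zs \<and> zs ! class_of zs x = Some x"
    unfolding class_of_def by (rule LeastI)
  then show "class_of zs x < length zs" "zs ! class_of zs x = Some x" by auto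
qed

definition occurrences :: "nat option list \<Rightarrow> symbol list \<Rightarrow> nat \<Rightarrow> nat" where
  "occurrences zs \<alpha> j = sum_vars (\<lambda>x. of_bool (class_of zs x = j)) \<alpha>"

lemma sum_list_occurrences:
  "(\<And>x. x \<in> vars \<alpha> \<Longrightarrow> class_of zs x < c) \<Longrightarrow>
   sum_vars (\<lambda>x. f (class_of zs x)) \<alpha> = (\<Sum>j<c. occurrences zs \<alpha> j * f j)"
proof (induction \<alpha>)
  case Nil
  then show ?case by (simp add: occurrences_def)
next
  case (Cons s \<alpha>)
  show ?case
  proof (cases s)
    case (Terminal a)
    then show ?thesis using Cons by (simp add: occurrences_def)
  next
    case (Variable x)
    then have x: "class_of zs x < c" using Cons.prems by simp
    have "(\<Sum>j<c. occurrences zs (s # \<alpha>) j * f j)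
        = (\<Sum>j<c. (if j = class_of zs x then f j else 0) + occurrences zs \<alpha> j * f j)"
      using Variable by (intro sum.cong) (auto simp: occurrences_def)
    also have "\<dots> = f (class_of zs x) + (\<Sum>j<c. occurrences zs \<alpha> j * f j)"
      using x by (simp add: sum.distrib)
    finally show ?thesis using Cons Variable by simp
  qed
qed

abbreviation class_subst :: "nat option list \<Rightarrow> nat list list \<Rightarrow> symbol list \<Rightarrow> nat list" where
  "class_subst zs vs \<equiv> apply_subst (\<lambda>x. vs ! class_of zs x)"

text \<open>The coefficient u_j. A representative that misses a letter cannot be pumped, and its
  coefficient 0 leaves \<open>ms ! j\<close> free.\<close>

abbreviation pump_count :: "nat option list \<Rightarrow> nat list list \<Rightarrow> symbol list \<Rightarrow> nat \<Rightarrow> nat" where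
  "pump_count zs vs \<alpha> j \<equiv> if set (vs ! j) = \<Sigma> then occurrences zs \<alpha> j else 0"

text \<open>From left to right, every image is replaced by its representative and an offset;
  conversely, representatives are pumped. The bound on the number of variables belongs to the
  equivalence, because \<open>c\<close> entries can cover all variables only if there are at most
  \<open>c\<close> of them.\<close>

lemma match_univ_bounded_vars:
  assumes \<sigma>: "\<sigma> \<ge> 1" and \<alpha>: "\<alpha> \<in> patterns \<sigma>" and W: "W \<subseteq> lists (\<Sigma>)"
    "\<And>w. w \<in> lists (\<Sigma>) \<Longrightarrow> \<exists>v \<in> W. \<exists>m. shifts m v w \<and> (set v \<noteq> \<Sigma> \<longrightarrow> m = 0)"
  shows "card (vars \<alpha>) \<le> c \<and> match_univ \<sigma> \<alpha> k \<longleftrightarrow>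
    (\<exists>zs. length zs = c \<and> set zs \<subseteq> insert None (Some ` vars \<alpha>) \<and> (\<forall>x \<in> vars \<alpha>. Some x \<in> set zs) \<and>
      (\<exists>vs. length vs = c \<and> set vs \<subseteq> W \<and> (\<exists>ms. length ms = c \<and>
        k = arches (class_subst zs vs \<alpha>) {} +
          (\<Sum>j<c. pump_count zs vs \<alpha> j * ms ! j))))"
  (is "?L \<longleftrightarrow> ?R")
proof
  assume ?L
  then obtain h where card: "card (vars \<alpha>) \<le> c" and h: "\<And>x. h x \<in> lists (\<Sigma>)"
    "arches (apply_subst h \<alpha>) {} = k"
    using match_univ_arches[OF \<sigma> \<alpha>] by (auto simp: substitutions_def)
  obtain v m where vm: "\<And>x. v x \<in> W \<and> shifts (m x) (v x) (h x) \<and> (set (v x) \<noteq> \<Sigma> \<longrightarrow> m x = 0)"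
    using W(2)[OF h(1)] by metis
  obtain xs where xs: "set xs = vars \<alpha>" "distinct xs"
    using finite_distinct_list[OF finite_vars] by blast
  then have lxs: "length xs \<le> c" using card by (metis distinct_card)
  define zs where "zs = map Some xs @ replicate (c - length xs) None"
  have zs: "length zs = c" "set zs \<subseteq> insert None (Some ` vars \<alpha>)" "\<forall>x \<in> vars \<alpha>. Some x \<in> set zs"
    using lxs xs by (auto simp: zs_def)
  \<comment> \<open>Padding entries get the arbitrary variable 0: \<open>vs\<close> must lie in
    \<open>W\<close> at these indices too, while \<open>occurrences\<close> is 0 there.\<close>
  define var where "var = (\<lambda>j. case zs ! j of Some x \<Rightarrow> x | None \<Rightarrow> 0)"
  define vs where "vs = map (\<lambda>j. v (var j)) [0..<c]"
  define ms where "ms = map (\<lambda>j. m (var j)) [0..<c]"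
  have cl: "class_of zs x < c" "var (class_of zs x) = x" if "x \<in> vars \<alpha>" for x
    using class_of[of x zs] zs that by (auto simp: var_def)
  have "shifts (sum_vars m \<alpha>) (apply_subst v \<alpha>) (apply_subst h \<alpha>)"
    using W vm by (intro apply_subst_shifts[OF \<sigma> \<alpha>]) auto
  then have "k = arches (apply_subst v \<alpha>) {} + sum_vars m \<alpha>"
    using h(2) alphabet_nonempty[OF \<sigma>] by (auto simp: shifts_def)
  also have "apply_subst v \<alpha> = class_subst zs vs \<alpha>"
    using cl by (intro apply_subst_cong) (simp add: vs_def)
  also have "sum_vars m \<alpha> =
      sum_vars (\<lambda>x. ms ! class_of zs x) \<alpha>"
    using cl by (intro arg_cong[of _ _ sum_list] map_cong) (auto simp: ms_def vars_def split: symbol.splits)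
  also have "\<dots> = (\<Sum>j<c. occurrences zs \<alpha> j * ms ! j)" using cl by (intro sum_list_occurrences)
  also have "\<dots> = (\<Sum>j<c. pump_count zs vs \<alpha> j * ms ! j)"
    using vm by (intro sum.cong) (auto simp: vs_def ms_def)
  finally have "k = arches (class_subst zs vs \<alpha>) {} +
      (\<Sum>j<c. pump_count zs vs \<alpha> j * ms ! j)" .
  then show ?R using zs vm
    by (intro exI[of _ zs] conjI exI[of _ vs] exI[of _ ms]) (auto simp: vs_def ms_def)
next
  assume ?R
  then obtain zs vs ms where zs: "length zs = c" "\<forall>x \<in> vars \<alpha>. Some x \<in> set zs"
    and vs: "length vs = c" "set vs \<subseteq> W" and ms: "length ms = c"
    and k: "k = arches (class_subst zs vs \<alpha>) {} +
          (\<Sum>j<c. pump_count zs vs \<alpha> j * ms ! j)"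
    by blast
  have "Some ` vars \<alpha> \<subseteq> set zs" using zs by auto
  then have "card (vars \<alpha>) \<le> card (set zs)"
    by (metis List.finite_set card_image card_mono inj_Some subset_UNIV inj_on_subset)
  then have card: "card (vars \<alpha>) \<le> c" using zs(1) card_length[of zs] by simp
  have cl: "class_of zs x < c" if "x \<in> vars \<alpha>" for x
    using class_of[of x zs] zs that by auto
  have vsL: "vs ! j \<in> lists (\<Sigma>)" if "j < c" for j using vs W(1) that nth_mem[of j vs] by blast
  \<comment> \<open>Pumping a word that misses a letter would not act as a shift; such
    representatives are left unpumped.\<close>
  define e where "e = (\<lambda>j. if set (vs ! j) = \<Sigma> then ms ! j else 0)"
  define h where "h = (\<lambda>x. if x \<in> vars \<alpha> then (pump ^^ e (class_of zs x)) (vs ! class_of zs x) else [])"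
  have "shifts (sum_vars (\<lambda>x. e (class_of zs x)) \<alpha>)
      (class_subst zs vs \<alpha>) (apply_subst h \<alpha>)"
  proof (rule apply_subst_shifts[OF \<sigma> \<alpha>])
    fix x assume x: "x \<in> vars \<alpha>"
    show "vs ! class_of zs x \<in> lists (\<Sigma>)" using vsL cl x by blast
    show "shifts (e (class_of zs x)) (vs ! class_of zs x) (h x)"
      using x arches_pump_funpow[OF \<sigma>] by (auto simp: shifts_def h_def e_def)
  qed
  moreover have "sum_vars (\<lambda>x. e (class_of zs x)) \<alpha> = (\<Sum>j<c. occurrences zs \<alpha> j * e j)"
    using cl by (intro sum_list_occurrences)
  moreover have "(\<Sum>j<c. occurrences zs \<alpha> j * e j)
      = (\<Sum>j<c. pump_count zs vs \<alpha> j * ms ! j)"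
    by (intro sum.cong) (auto simp: e_def)
  ultimately have "arches (apply_subst h \<alpha>) {} = k"
    using k alphabet_nonempty[OF \<sigma>] by (auto simp: shifts_def)
  moreover have "h \<in> substitutions \<sigma>"
    using vsL cl by (auto simp: substitutions_def h_def in_lists_conv_set)
  ultimately show ?L using match_univ_arches[OF \<sigma> \<alpha>] card by auto
qed

section \<open>Decoding instances\<close>

abbreviation digit :: "nat \<Rightarrow> bool" where
  "digit a \<equiv> a = \<sigma> + 2 \<or> a = \<sigma> + 3"

text \<open>
  The value is reset at every non-digit, so reading a whole instance leaves the value of its last
  numeral.
\<close>

definition num_step :: "nat \<Rightarrow> nat \<Rightarrow> nat" where
  "num_step n a = (if digit a then 2 * n + (a - (\<sigma> + 2)) else 0)"

definition last_num :: "nat list \<Rightarrow> nat" where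
  "last_num w = foldl (num_step) 0 w"

lemma encode_nat_0: "encode_nat \<sigma> 0 = [\<sigma> + 2]"
  by (simp add: encode_nat_def binary.simps)

lemma encode_nat_1: "encode_nat \<sigma> (Suc 0) = [\<sigma> + 3]"
  by (simp add: encode_nat_def binary.simps)

lemma encode_nat_div: "n \<ge> 2 \<Longrightarrow> encode_nat \<sigma> n = encode_nat \<sigma> (n div 2) @ [\<sigma> + 2 + n mod 2]"
  by (simp add: encode_nat_def binary.simps[of n])

lemma encode_nat_double:
  "n > 0 \<Longrightarrow> encode_nat \<sigma> (2 * n) = encode_nat \<sigma> n @ [\<sigma> + 2]"
  "n > 0 \<Longrightarrow> encode_nat \<sigma> (Suc (2 * n)) = encode_nat \<sigma> n @ [\<sigma> + 3]"
  by (simp_all add: encode_nat_div)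

lemma encode_nat_induct [case_names zero one div]:
  assumes "P 0" "P (Suc 0)" "\<And>n. n \<ge> 2 \<Longrightarrow> P (n div 2) \<Longrightarrow> P n"
  shows "P n"
  using assms(3)
  by (induction n rule: less_induct)
    (metis assms(1,2) div_less_dividend less_2_cases not_less one_less_numeral_iff
      semiring_norm(76) bot_nat_0.not_eq_extremum)

lemma digit_encode_nat: "a \<in> set (encode_nat \<sigma> n) \<Longrightarrow> digit a"
proof (induction n rule: encode_nat_induct)
  case (div n)
  then show ?case by (auto simp: encode_nat_div)
qed (auto simp: encode_nat_0 encode_nat_1)

lemma num_encode_nat: "foldl (num_step) 0 (encode_nat \<sigma> n) = n"
proof (induction n rule: encode_nat_induct)
  case (div n)
  have "n mod 2 = 0 \<or> n mod 2 = 1" by auto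
  then have "digit (\<sigma> + 2 + n mod 2)" by auto
  then show ?case using div by (simp add: encode_nat_div num_step_def)
qed (auto simp: encode_nat_0 encode_nat_1 num_step_def)

abbreviation encode_pattern :: "symbol list \<Rightarrow> nat list" where
  "encode_pattern \<alpha> \<equiv> concat (map (encode_symbol \<sigma>) \<alpha>)"

text \<open>
  States: 0, 2, 3 after a complete symbol (a terminal, the numeral 0, a positive numeral), 1 after a
  variable marker, 4 after the separator, 5 and 6 inside the final numeral, 7 failure.
\<close>

definition next_state :: "nat \<Rightarrow> nat \<Rightarrow> nat" where
  "next_state q a =
     (if q \<in> {0, 2, 3} \<and> a \<in> {1..\<sigma>} then 0
      else if q \<in> {0, 2, 3} \<and> a = \<sigma> + 1 then 1
      else if q \<in> {0, 2, 3} \<and> a = \<sigma> + 4 then 4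
      else if q = 1 \<and> a = \<sigma> + 2 then 2
      else if q = 1 \<and> a = \<sigma> + 3 then 3
      else if q = 3 \<and> digit a then 3
      else if q = 4 \<and> a = \<sigma> + 2 then 5
      else if q = 4 \<and> a = \<sigma> + 3 then 6
      else if q = 6 \<and> digit a then 6
      else 7)"

definition well_formed :: "nat list \<Rightarrow> bool" where
  "well_formed w \<longleftrightarrow> foldl (next_state) 0 w \<in> {5, 6}"

lemma foldl_next_state_encode_nat:
  "foldl (next_state) 1 (encode_nat \<sigma> n) = (if n = 0 then 2 else 3) \<and>
   foldl (next_state) 4 (encode_nat \<sigma> n) = (if n = 0 then 5 else 6)"
proof (induction n rule: encode_nat_induct)
  case (div n)
  have "n mod 2 = 0 \<or> n mod 2 = 1" by auto
  then have "digit (\<sigma> + 2 + n mod 2)" by auto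
  then show ?case using div by (simp add: encode_nat_div) (auto simp: next_state_def)
qed (auto simp: encode_nat_0 encode_nat_1 next_state_def)

lemma foldl_next_state_encode_pattern:
  assumes "\<alpha> \<in> patterns \<sigma>" "q \<in> {0, 2, 3}"
  shows "foldl (next_state) q (encode_pattern \<alpha>) \<in> {0, 2, 3}"
  using assms
proof (induction \<alpha> arbitrary: q)
  case (Cons s \<alpha>)
  have "foldl (next_state) q (encode_symbol \<sigma> s) \<in> {0, 2, 3}"
  proof (cases s)
    case (Terminal a)
    then show ?thesis using Cons.prems by (auto simp: next_state_def alphabet_def)
  next
    case (Variable x)
    have "next_state q (\<sigma> + 1) = 1" using Cons.prems by (auto simp: next_state_def)
    then show ?thesis using Variable foldl_next_state_encode_nat[of x] by auto
  qed
  moreover have "\<alpha> \<in> patterns \<sigma>" using Cons.prems(1) by (cases s) auto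
  ultimately show ?case using Cons.IH by simp
qed simp

lemma well_formed_encode_instance:
  assumes "\<alpha> \<in> patterns \<sigma>"
  shows "well_formed (encode_instance \<sigma> \<alpha> k)"
proof -
  define q where "q = foldl (next_state) 0 (encode_pattern \<alpha>)"
  have "q \<in> {0, 2, 3}" unfolding q_def using foldl_next_state_encode_pattern[OF assms] by simp
  then have "next_state q (\<sigma> + 4) = 4" by (auto simp: next_state_def)
  then show ?thesis
    using foldl_next_state_encode_nat[of k]
    by (simp add: well_formed_def encode_instance_def q_def[symmetric])
qed

text \<open>The invariant of the automaton: what the part read so far looks like in state
  \<open>q\<close>, with nothing claimed about \<open>w\<close> in state 7.\<close>

fun parsed :: "nat \<Rightarrow> nat list \<Rightarrow> bool" where
  "parsed q w = (\<exists>\<alpha> \<in> patterns \<sigma>.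
     if q = 0 then w = encode_pattern \<alpha>
     else if q = 1 then w = encode_pattern \<alpha> @ [\<sigma> + 1]
     else if q = 2 then w = encode_pattern (\<alpha> @ [Variable 0])
     else if q = 3 then \<exists>x>0. w = encode_pattern (\<alpha> @ [Variable x])
     else if q = 4 then w = encode_pattern \<alpha> @ [\<sigma> + 4]
     else if q = 5 then w = encode_instance \<sigma> \<alpha> 0
     else q = 6 \<longrightarrow> (\<exists>k>0. w = encode_instance \<sigma> \<alpha> k))"

lemma parsed_step:
  assumes "parsed q w"
  shows "parsed (next_state q a) (w @ [a])"
proof -
  obtain \<alpha> where \<alpha>: "\<alpha> \<in> patterns \<sigma>" and q:
     "if q = 0 then w = encode_pattern \<alpha>
     else if q = 1 then w = encode_pattern \<alpha> @ [\<sigma> + 1]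
     else if q = 2 then w = encode_pattern (\<alpha> @ [Variable 0])
     else if q = 3 then \<exists>x>0. w = encode_pattern (\<alpha> @ [Variable x])
     else if q = 4 then w = encode_pattern \<alpha> @ [\<sigma> + 4]
     else if q = 5 then w = encode_instance \<sigma> \<alpha> 0
     else q = 6 \<longrightarrow> (\<exists>k>0. w = encode_instance \<sigma> \<alpha> k)"
    using assms by auto
  have complete: "\<exists>\<beta> \<in> patterns \<sigma>. w = encode_pattern \<beta>" if "q \<in> {0, 2, 3}"
    using q \<alpha> that by (metis append_in_patterns Cons_in_patterns(2) Nil_in_patterns insertE singletonD zero_neq_numeral
        numeral_eq_iff num.distinct(5) one_eq_numeral_iff semiring_norm(85,86) empty_iff)
  have dead: "next_state q a = 7" if
    "\<not> (q \<in> {0, 2, 3} \<and> a \<in> {1..\<sigma>})"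
    "\<not> (q \<in> {0, 2, 3} \<and> a = \<sigma> + 1)"
    "\<not> (q \<in> {0, 2, 3} \<and> a = \<sigma> + 4)"
    "\<not> (q = 1 \<and> a = \<sigma> + 2)"
    "\<not> (q = 1 \<and> a = \<sigma> + 3)"
    "\<not> (q = 3 \<and> digit a)"
    "\<not> (q = 4 \<and> a = \<sigma> + 2)"
    "\<not> (q = 4 \<and> a = \<sigma> + 3)"
    "\<not> (q = 6 \<and> digit a)"
    unfolding next_state_def if_not_P[OF that(1)] if_not_P[OF that(2)] if_not_P[OF that(3)] if_not_P[OF that(4)] if_not_P[OF that(5)] if_not_P[OF that(6)] if_not_P[OF that(7)] if_not_P[OF that(8)] if_not_P[OF that(9)] by (rule refl)
  consider "q \<in> {0, 2, 3}" "a \<in> {1..\<sigma>}" | "q \<in> {0, 2, 3}" "a = \<sigma> + 1" | "q \<in> {0, 2, 3}" "a = \<sigma> + 4"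
    | "q = 1" "a = \<sigma> + 2" | "q = 1" "a = \<sigma> + 3" | "q = 3" "digit a"
    | "q = 4" "a = \<sigma> + 2" | "q = 4" "a = \<sigma> + 3" | "q = 6" "digit a" | "next_state q a = 7"
    using dead by argo
  then show ?thesis
  proof cases
    case 1
    then obtain \<beta> where "\<beta> \<in> patterns \<sigma>" "w = encode_pattern \<beta>" using complete by blast
    moreover have "next_state q a = 0" using 1 by (auto simp: next_state_def)
    ultimately show ?thesis using 1 by (auto simp: alphabet_def intro!: bexI[of _ "\<beta> @ [Terminal a]"])
  next
    case 2
    then obtain \<beta> where "\<beta> \<in> patterns \<sigma>" "w = encode_pattern \<beta>" using complete by blast
    moreover have "next_state q a = 1" using 2 by (auto simp: next_state_def)
    ultimately show ?thesis using 2 by auto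
  next
    case 3
    then obtain \<beta> where "\<beta> \<in> patterns \<sigma>" "w = encode_pattern \<beta>" using complete by blast
    moreover have "next_state q a = 4" using 3 by (auto simp: next_state_def)
    ultimately show ?thesis using 3 by auto
  next
    case 4
    then have "next_state q a = 2" by (auto simp: next_state_def)
    then show ?thesis using 4 q \<alpha> by (auto simp: encode_nat_0)
  next
    case 5
    then have "next_state q a = 3" by (auto simp: next_state_def)
    then show ?thesis using 5 q \<alpha> by (auto simp: encode_nat_1 intro!: bexI[of _ \<alpha>] exI[of _ "Suc 0"])
  next
    case 6
    then obtain x where x: "x > 0" "w = encode_pattern (\<alpha> @ [Variable x])" using q by auto
    have n: "next_state q a = 3" using 6 by (auto simp: next_state_def)
    show ?thesis
    proof (cases "a = \<sigma> + 2")
      case True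
      then show ?thesis using n x \<alpha> by (auto simp: encode_nat_double intro!: bexI[of _ \<alpha>] exI[of _ "2 * x"])
    next
      case False
      then show ?thesis using n x \<alpha> 6 by (auto simp: encode_nat_double intro!: bexI[of _ \<alpha>] exI[of _ "Suc (2 * x)"])
    qed
  next
    case 7
    then have "next_state q a = 5" by (auto simp: next_state_def)
    then show ?thesis using 7 q \<alpha> by (auto simp: encode_nat_0 encode_instance_def)
  next
    case 8
    then have "next_state q a = 6" by (auto simp: next_state_def)
    then show ?thesis using 8 q \<alpha> by (auto simp: encode_nat_1 encode_instance_def intro!: bexI[of _ \<alpha>] exI[of _ "Suc 0"])
  next
    case 9
    then obtain x where x: "x > 0" "w = encode_instance \<sigma> \<alpha> x" using q by auto
    have n: "next_state q a = 6" using 9 by (auto simp: next_state_def)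
    show ?thesis
    proof (cases "a = \<sigma> + 2")
      case True
      then show ?thesis using n x \<alpha>
        by (auto simp: encode_nat_double encode_instance_def intro!: bexI[of _ \<alpha>] exI[of _ "2 * x"])
    next
      case False
      then show ?thesis using n x \<alpha> 9
        by (auto simp: encode_nat_double encode_instance_def intro!: bexI[of _ \<alpha>] exI[of _ "Suc (2 * x)"])
    qed
  next
    case 10
    then show ?thesis using \<alpha> by auto
  qed
qed

lemma well_formed_iff:
  "well_formed w \<longleftrightarrow> (\<exists>\<alpha> \<in> patterns \<sigma>. \<exists>k. w = encode_instance \<sigma> \<alpha> k)"
proof
  assume "well_formed w"
  have "parsed (foldl (next_state) 0 w) w"
  proof (induction w rule: rev_induct)
    case Nil
    then show ?case by (auto intro!: bexI[of _ "[]"])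
  next
    case (snoc a w)
    then show ?case using parsed_step[of _ w a] by (simp del: parsed.simps)
  qed
  with \<open>well_formed w\<close> show "\<exists>\<alpha> \<in> patterns \<sigma>. \<exists>k. w = encode_instance \<sigma> \<alpha> k"
    unfolding well_formed_def by auto blast+
qed (auto intro: well_formed_encode_instance)

lemma last_num_encode_instance: "last_num (encode_instance \<sigma> \<alpha> k) = k"
  by (simp add: last_num_def encode_instance_def num_encode_nat num_step_def[of _ "\<sigma> + 4"])

section \<open>Recovering the pattern position by position\<close>

definition block :: "nat list \<Rightarrow> nat list" where
  "block w = takeWhile (digit) w"

text \<open>Digits and the separator yield the empty list. The pattern thus becomes a concatenation
  over all input positions, and a symbol can be identified with the position where its code
  begins.\<close>

definition token :: "nat \<Rightarrow> nat list \<Rightarrow> symbol list" where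
  "token a u = (if a \<in> {1..\<sigma>} then [Terminal a]
     else if a = \<sigma> + 1 then [Variable (foldl (num_step) 0 (block u))] else [])"

fun tokens :: "nat list \<Rightarrow> symbol list" where
  "tokens [] = []"
| "tokens (a # u) = token a u @ tokens u"

lemma tokens_digits: "(\<And>a. a \<in> set ds \<Longrightarrow> digit a) \<Longrightarrow> tokens (ds @ u) = tokens u"
proof (induction ds)
  case (Cons d ds)
  then have "digit d" by simp
  then have "token d (ds @ u) = []" by (auto simp: token_def)
  then show ?case using Cons by simp
qed simp

lemma block_encode_nat: "u = [] \<or> \<not> digit (hd u) \<Longrightarrow> block (encode_nat \<sigma> n @ u) = encode_nat \<sigma> n"
  unfolding block_def using digit_encode_nat
  by (subst takeWhile_append2) (auto simp: takeWhile_eq_Nil_iff)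

lemma hd_encode_pattern:
  assumes "\<alpha> \<in> patterns \<sigma>"
  shows "\<not> digit (hd (encode_pattern \<alpha> @ (\<sigma> + 4) # u))"
proof (cases \<alpha>)
  case (Cons s \<beta>)
  then show ?thesis using assms by (cases s) (auto simp: alphabet_def)
qed simp

lemma tokens_encode_instance:
  assumes "\<alpha> \<in> patterns \<sigma>"
  shows "tokens (encode_instance \<sigma> \<alpha> k) = \<alpha>"
  using assms
proof (induction \<alpha>)
  case Nil
  show ?case using tokens_digits[of "encode_nat \<sigma> k" "[]"] digit_encode_nat
    by (simp add: encode_instance_def token_def)
next
  case (Cons s \<alpha>)
  have \<alpha>: "\<alpha> \<in> patterns \<sigma>" using Cons.prems by (cases s) auto
  define u where "u = encode_instance \<sigma> \<alpha> k"
  have hd: "\<not> digit (hd u)" unfolding u_def encode_instance_def by (rule hd_encode_pattern[OF \<alpha>])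
  have "encode_instance \<sigma> (s # \<alpha>) k = encode_symbol \<sigma> s @ u" by (simp add: u_def encode_instance_def)
  moreover have "tokens (encode_symbol \<sigma> s @ u) = s # tokens u"
  proof (cases s)
    case (Terminal a)
    then show ?thesis using Cons.prems by (simp add: token_def alphabet_def)
  next
    case (Variable x)
    then show ?thesis using tokens_digits[of "encode_nat \<sigma> x" u] digit_encode_nat block_encode_nat[of u x] hd
      by (simp add: token_def num_encode_nat)
  qed
  ultimately show ?case using Cons.IH[OF \<alpha>] by (simp add: u_def)
qed

abbreviation token_at :: "nat list \<Rightarrow> nat \<Rightarrow> symbol list" where
  "token_at w i \<equiv> token (w ! i) (drop (Suc i) w)"

lemma tokens_eq_concat: "tokens w = concat (map (token_at w) [0..<length w])"
proof (induction w)
  case (Cons a w)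
  have "[0..<length (a # w)] = 0 # map Suc [0..<length w]" by (simp add: map_Suc_upt upt_conv_Cons del: upt_Suc)
  then show ?case using Cons by (simp add: o_def del: upt_Suc)
qed simp

text \<open>The code \<open>\<sigma> + 1\<close> occurs only as a variable marker, so the digits
  after it form the numeral of one variable, which ends at the first code of the next symbol or at
  the separator.\<close>

lemma block_canonical:
  assumes "\<alpha> \<in> patterns \<sigma>" "w = encode_instance \<sigma> \<alpha> k" "i < length w" "w ! i = \<sigma> + 1"
  shows "\<exists>x. block (drop (Suc i) w) = encode_nat \<sigma> x"
  using assms
proof (induction \<alpha> arbitrary: w i)
  case Nil
  show ?case
  proof (cases i)
    case (Suc j)
    then have "w ! i = encode_nat \<sigma> k ! j" "j < length (encode_nat \<sigma> k)"
      using Nil by (simp_all add: encode_instance_def)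
    then have "w ! i \<in> set (encode_nat \<sigma> k)" by (simp only: nth_mem)
    then show ?thesis using Nil digit_encode_nat by fastforce
  qed (use Nil in \<open>simp add: encode_instance_def\<close>)
next
  case (Cons s \<alpha>)
  have \<alpha>: "\<alpha> \<in> patterns \<sigma>" using Cons.prems(1) by (cases s) auto
  define u where "u = encode_instance \<sigma> \<alpha> k"
  have hd: "\<not> digit (hd u)" unfolding u_def encode_instance_def by (rule hd_encode_pattern[OF \<alpha>])
  have w: "w = encode_symbol \<sigma> s @ u" using Cons.prems by (simp add: u_def encode_instance_def)
  show ?case
  proof (cases "i < length (encode_symbol \<sigma> s)")
    case True
    then have i: "encode_symbol \<sigma> s ! i = \<sigma> + 1" using Cons.prems(4) w by (simp add: nth_append)
    show ?thesis
    proof (cases s)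
      case (Terminal a)
      then show ?thesis using i True Cons.prems(1) by (auto simp: alphabet_def)
    next
      case (Variable x)
      have "i = 0"
      proof (rule ccontr)
        assume "i \<noteq> 0"
        then have "\<sigma> + 1 \<in> set (encode_nat \<sigma> x)" using i True Variable
          by (metis Suc_less_eq encode_symbol.simps(2) length_Cons nth_Cons_Suc nth_mem not0_implies_Suc)
        then show False using digit_encode_nat by fastforce
      qed
      then show ?thesis using w Variable block_encode_nat[of u x] hd by auto
    qed
  next
    case False
    define j where "j = i - length (encode_symbol \<sigma> s)"
    have "i = length (encode_symbol \<sigma> s) + j" using False by (simp add: j_def)
    then show ?thesis using Cons.IH[OF \<alpha> refl, of j] Cons.prems(3,4) w by (simp add: u_def)
  qed
qed

text \<open>Indices may be exponential in the input length. As numerals are canonical, comparing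
  digit strings replaces comparing values.\<close>

lemma same_variable_iff:
  assumes "\<alpha> \<in> patterns \<sigma>" "w = encode_instance \<sigma> \<alpha> k"
    "i < length w" "w ! i = \<sigma> + 1" "j < length w" "w ! j = \<sigma> + 1"
  shows "token_at w i = token_at w j \<longleftrightarrow> block (drop (Suc i) w) = block (drop (Suc j) w)"
  using block_canonical[OF assms(1,2,3,4)] block_canonical[OF assms(1,2,5,6)] assms(4,6)
  by (auto simp: token_def num_encode_nat)

section \<open>Reading the input\<close>

text \<open>A function of two numbers below constants is a finite table that can be built into the
  program, however \<open>T\<close> is defined.\<close>

lemma pc_table2:
  assumes f: "pc A k f" and g: "pc A k g"
  shows "pc A k (\<lambda>w xs. if f w xs < P \<and> g w xs < R then T (f w xs) (g w xs) else 0)"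
proof -
  have "pc A k (\<lambda>w xs. if f w xs < P then (\<lambda>u w xs. if g w xs < R then (\<lambda>v w xs. T u v) (g w xs) w xs else 0) (f w xs) w xs else 0)"
    by (intro pc_finite_case f g pc_const)
  then show ?thesis by (rule pc_cong[rotated]) auto
qed

lemma pc_input_length: "pc A k (\<lambda>w xs. length w)"
  using pc_pred[OF pc_length[of A k]] by simp

abbreviation letter :: "nat \<Rightarrow> nat list \<Rightarrow> nat \<Rightarrow> nat" where
  "letter A w i \<equiv> cell A w (Suc i)"

lemma letter_nth: "i < length w \<Longrightarrow> letter A w i = w ! i"
  by (simp add: cell_def)

text \<open>Cell 0 holds the left marker, whence the shift in \<open>letter\<close>. Beyond the
  input, neither possible value is a letter of \<open>{1..A}\<close>, so testing for a letter also
  tests the range.\<close>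

lemma letter_outside: "\<not> i < length w \<Longrightarrow> letter A w i = 0 \<or> letter A w i = A + 2"
  by (simp add: cell_def)

lemma pc_letter: "pc A k f \<Longrightarrow> pc A k (\<lambda>w xs. letter A w (f w xs))"
  by (rule pc_comp1[of A "\<lambda>w x. cell A w x", OF pc_cell[of 0 1 A] pc_Suc]) simp

text \<open>Runs a finite automaton: \<open>\<delta>\<close> becomes a table over states below
  \<open>Q\<close> and cell contents below \<open>A + 3\<close>.\<close>

lemma pc_foldl:
  assumes "q0 < Q" "\<And>q a. \<delta> q a < Q"
  shows "pc A k (\<lambda>w xs. foldl \<delta> q0 w)"
proof -
  define g where "g = (\<lambda>w ys. if ys ! 1 < Q \<and> letter A w (ys ! 0) < A + 3 then \<delta> (ys ! 1) (letter A w (ys ! 0)) else 0)"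
  have "pc A (Suc (Suc k)) g"
    unfolding g_def by (intro pc_table2 pc_letter pc_nth) auto
  moreover have Q: "g w ys < Q" for w ys using assms by (auto simp: g_def)
  ultimately have "pc A k (\<lambda>w xs. rec_nat q0 (\<lambda>i a. g w (i # a # xs)) (length w))"
    using assms(1) by (intro pc_rec_finite[where Q = Q] pc_const pc_input_length) auto
  then show ?thesis
  proof (rule pc_cong[rotated])
    fix w and xs :: "nat list" assume w: "w \<in> lists {1..A}"
    have lt: "foldl \<delta> q0 u < Q" for u
      by (cases u rule: rev_cases) (auto simp: assms)
    have "rec_nat q0 (\<lambda>i a. g w (i # a # xs)) n = foldl \<delta> q0 (take n w)" if "n \<le> length w" for n
      using that
    proof (induction n)
      case (Suc n)
      then show ?case
        using lt cell_less[OF w, of "Suc n"] by (simp add: g_def take_Suc_conv_app_nth letter_nth)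
    qed simp
    then show "rec_nat q0 (\<lambda>i a. g w (i # a # xs)) (length w) = foldl \<delta> q0 w" by simp
  qed
qed

lemma pd_well_formed: "pd (\<sigma> + 4) k (\<lambda>w xs. well_formed w)"
proof -
  have "pc (\<sigma> + 4) k (\<lambda>w xs. foldl (next_state) 0 w)"
    by (rule pc_foldl[of 0 8]) (auto simp: next_state_def)
  then show ?thesis unfolding well_formed_def insert_iff empty_iff
    by (intro pd_disj pd_eq pc_const) auto
qed

lemma pd_digit: "pc A k f \<Longrightarrow> pd A k (\<lambda>w xs. digit (f w xs))"
  by (intro pd_disj pd_eq pc_const)

text \<open>\<open>last_num w\<close> itself may be exponential. Horner's rule commutes with
  truncation at \<open>f w xs\<close> and with reduction modulo it, so both results are found with
  intermediate values at most \<open>f w xs\<close>. Modulus 0 gets the default 0, as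
  \<open>last_num w mod 0\<close> would be the whole number again.\<close>

lemma pc_last_num:
  assumes f: "pc (\<sigma> + 4) k f"
  shows "pc (\<sigma> + 4) k (\<lambda>w xs. min (f w xs) (last_num w))"
    and "pc (\<sigma> + 4) k (\<lambda>w xs. if f w xs = 0 then 0 else last_num w mod f w xs)"
proof -
  let ?A = "\<sigma> + 4"
  define h where "h = (\<lambda>w ys. 2 * ys ! 1 + (letter ?A w (ys ! 0) - (\<sigma> + 2)))"
  have h: "pc ?A (Suc (Suc k)) h"
    unfolding h_def by (intro pc_add pc_mult pc_minus pc_letter pc_nth pc_const) auto
  have f': "pc ?A (Suc (Suc k)) (\<lambda>w ys. f w (tl (tl ys)))" by (rule pc_tl_tl[OF f])
  have d: "pd ?A (Suc (Suc k)) (\<lambda>w ys. digit (letter ?A w (ys ! 0)))"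
    by (intro pd_digit pc_letter pc_nth) auto
  have step: "last_num (take (Suc n) w) = (if digit (letter ?A w n)
      then 2 * last_num (take n w) + (letter ?A w n - (\<sigma> + 2)) else 0)" if "n < length w" for n w
    using that by (simp add: take_Suc_conv_app_nth last_num_def num_step_def letter_nth)
  define g1 where "g1 = (\<lambda>w ys. if digit (letter ?A w (ys ! 0)) then min (f w (tl (tl ys))) (h w ys) else 0)"
  have r1: "rec_nat 0 (\<lambda>i a. g1 w (i # a # xs)) n = min (f w xs) (last_num (take n w))" if "n \<le> length w" for n w xs
    using that
  proof (induction n)
    case (Suc n)
    have "min m (2 * min m a + b) = min m (2 * a + b)" for a b m :: nat by (auto simp: min_def)
    then show ?case using Suc by (simp add: g1_def h_def step)
  qed (simp add: last_num_def)
  have "pc ?A k (\<lambda>w xs. rec_nat 0 (\<lambda>i a. g1 w (i # a # xs)) (length w))"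
  proof (rule pc_rec[OF pc_zero _ pc_input_length pc_imp_poly_bounded[OF f]])
    show "pc ?A (Suc (Suc k)) g1" unfolding g1_def by (intro pd_If d pc_min f' h pc_zero)
  qed (simp add: r1)
  then show "pc ?A k (\<lambda>w xs. min (f w xs) (last_num w))" by (simp add: r1)
  define g2 where "g2 = (\<lambda>w ys. if digit (letter ?A w (ys ! 0)) then
      (if f w (tl (tl ys)) = 0 then 0 else h w ys mod f w (tl (tl ys))) else 0)"
  have r2: "rec_nat 0 (\<lambda>i a. g2 w (i # a # xs)) n = (if f w xs = 0 then 0 else last_num (take n w) mod f w xs)"
    if "n \<le> length w" for n w xs
    using that
  proof (induction n)
    case (Suc n)
    have "(2 * (a mod m) + b) mod m = (2 * a + b) mod m" for a b m :: nat
      by (metis mod_add_left_eq mod_mult_right_eq)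
    then show ?case using Suc by (simp add: g2_def h_def step)
  qed (simp add: last_num_def)
  have "pc ?A k (\<lambda>w xs. rec_nat 0 (\<lambda>i a. g2 w (i # a # xs)) (length w))"
  proof (rule pc_rec[OF pc_zero _ pc_input_length pc_imp_poly_bounded[OF f]])
    show "pc ?A (Suc (Suc k)) g2" unfolding g2_def by (intro pd_If pd_eq pc_mod d f' h pc_zero)
    fix i and w xs :: "nat list" assume "i \<le> length w"
    then show "rec_nat 0 (\<lambda>i a. g2 w (i # a # xs)) i \<le> f w xs"
      by (simp add: r2 less_imp_le)
  qed
  then show "pc ?A k (\<lambda>w xs. if f w xs = 0 then 0 else last_num w mod f w xs)" by (simp add: r2 cong: if_cong)
qed

abbreviation sym_at :: "nat list \<Rightarrow> nat \<Rightarrow> nat" where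
  "sym_at w i \<equiv> letter (\<sigma> + 4) w i"

lemma digit_letter_less: "digit (sym_at w p) \<Longrightarrow> p < length w"
  using letter_outside[of p w "\<sigma> + 4"] by fastforce

lemma block_drop:
  assumes "\<And>j. j < l \<Longrightarrow> digit (sym_at w (p + j))" "\<not> digit (sym_at w (p + l))"
  shows "block (drop p w) = map (\<lambda>j. sym_at w (p + j)) [0..<l]"
  using assms
proof (induction l arbitrary: p)
  case 0
  show ?case
  proof (cases "p < length w")
    case True
    then have "drop p w = w ! p # drop (Suc p) w" by (simp add: Cons_nth_drop_Suc)
    then show ?thesis using 0 letter_nth[OF True] by (simp add: block_def)
  qed (simp add: block_def)
next
  case (Suc l)
  have d: "digit (sym_at w p)" using Suc.prems(1)[of 0] by simp
  then have p: "p < length w" by (rule digit_letter_less)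
  then have "drop p w = w ! p # drop (Suc p) w" by (simp add: Cons_nth_drop_Suc)
  then have "block (drop p w) = sym_at w p # block (drop (Suc p) w)"
    using d letter_nth[OF p] by (simp add: block_def)
  also have "block (drop (Suc p) w) = map (\<lambda>j. sym_at w (Suc p + j)) [0..<l]"
    using Suc.prems(1)[of "Suc _"] Suc.prems(2) by (intro Suc.IH) auto
  also have "sym_at w p # \<dots> = map (\<lambda>j. sym_at w (p + j)) (0 # map Suc [0..<l])" by simp
  also have "0 # map Suc [0..<l] = [0..<Suc l]" by (simp add: map_Suc_upt upt_conv_Cons del: upt_Suc)
  finally show ?case .
qed

lemma block_length:
  obtains l where "l < Suc (length w)" "\<And>j. j < l \<Longrightarrow> digit (sym_at w (p + j))"
    "\<not> digit (sym_at w (p + l))"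
proof -
  define l where "l = (LEAST l. \<not> digit (sym_at w (p + l)))"
  have n: "\<not> digit (sym_at w (p + length w))" using digit_letter_less[of w "p + length w"] by auto
  show thesis
  proof (rule that[of l])
    show "l < Suc (length w)" unfolding l_def less_Suc_eq_le using n by (rule Least_le)
    show "\<not> digit (sym_at w (p + l))" unfolding l_def using n by (rule LeastI)
    show "digit (sym_at w (p + j))" if "j < l" for j
      using not_less_Least that unfolding l_def by blast
  qed
qed

text \<open>Expresses the equality by letters and quantifiers bounded by the input length, the form
  that \<open>pd_ex\<close> and \<open>pd_all\<close> can handle; \<open>l\<close> is the common
  length of the blocks.\<close>

lemma block_eq_iff:
  "block (drop p w) = block (drop q w) \<longleftrightarrow> (\<exists>l<Suc (length w).
     (\<forall>j<l. digit (sym_at w (p + j)) \<and> sym_at w (p + j) = sym_at w (q + j)) \<and>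
     \<not> digit (sym_at w (p + l)) \<and> \<not> digit (sym_at w (q + l)))" (is "?L \<longleftrightarrow> ?R")
proof
  assume L: ?L
  obtain l where l: "l < Suc (length w)" "\<And>j. j < l \<Longrightarrow> digit (sym_at w (p + j))"
    "\<not> digit (sym_at w (p + l))" using block_length by blast
  obtain l' where l': "\<And>j. j < l' \<Longrightarrow> digit (sym_at w (q + j))"
    "\<not> digit (sym_at w (q + l'))" using block_length by blast
  have m: "map (\<lambda>j. sym_at w (p + j)) [0..<l] = map (\<lambda>j. sym_at w (q + j)) [0..<l']"
    using L block_drop[of l w p, OF l(2,3)] block_drop[of l' w q, OF l'] by simp
  then have ll: "l' = l" by (metis diff_zero length_map length_upt)
  have "sym_at w (p + j) = sym_at w (q + j)" if "j < l" for j
    using arg_cong[OF m, of "\<lambda>x. x ! j"] that ll by simp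
  then show ?R using l l' ll by blast
next
  assume ?R
  then obtain l where l: "\<And>j. j < l \<Longrightarrow> digit (sym_at w (p + j))"
    "\<And>j. j < l \<Longrightarrow> sym_at w (p + j) = sym_at w (q + j)"
    "\<not> digit (sym_at w (p + l))" "\<not> digit (sym_at w (q + l))" by blast
  have "block (drop p w) = map (\<lambda>j. sym_at w (p + j)) [0..<l]" using l by (intro block_drop) auto
  moreover have "block (drop q w) = map (\<lambda>j. sym_at w (q + j)) [0..<l]" using l by (intro block_drop) force+
  ultimately show ?L using l(2) by simp
qed

lemma pd_block_eq:
  assumes "pc (\<sigma> + 4) k f" "pc (\<sigma> + 4) k g"
  shows "pd (\<sigma> + 4) k (\<lambda>w xs. block (drop (f w xs) w) = block (drop (g w xs) w))"
proof (rule pc_comp2[OF _ assms, of "\<lambda>w p q. of_bool (block (drop p w) = block (drop q w))"])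
  let ?A = "\<sigma> + 4"
  have in2: "pd ?A (Suc (Suc 2)) (\<lambda>w zs. digit (letter ?A w (zs ! 2 + zs ! 0)) \<and>
      letter ?A w (zs ! 2 + zs ! 0) = letter ?A w (zs ! 3 + zs ! 0))"
    by (intro pd_conj pd_digit pd_eq pc_letter pc_add pc_nth) auto
  have in1: "pd ?A (Suc 2) (\<lambda>w ys. (\<forall>j<ys ! 0. digit (letter ?A w ((j # ys) ! 2 + (j # ys) ! 0)) \<and>
      letter ?A w ((j # ys) ! 2 + (j # ys) ! 0) = letter ?A w ((j # ys) ! 3 + (j # ys) ! 0)) \<and>
      \<not> digit (letter ?A w (ys ! 1 + ys ! 0)) \<and> \<not> digit (letter ?A w (ys ! 2 + ys ! 0)))"
    by (intro pd_conj pd_all[OF _ in2] pd_not pd_digit pc_letter pc_add pc_nth) auto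
  have "pd ?A 2 (\<lambda>w xs. \<exists>l<Suc (length w). (\<lambda>w ys. (\<forall>j<ys ! 0. digit (letter ?A w ((j # ys) ! 2 + (j # ys) ! 0)) \<and>
      letter ?A w ((j # ys) ! 2 + (j # ys) ! 0) = letter ?A w ((j # ys) ! 3 + (j # ys) ! 0)) \<and>
      \<not> digit (letter ?A w (ys ! 1 + ys ! 0)) \<and> \<not> digit (letter ?A w (ys ! 2 + ys ! 0))) w (l # xs))"
    by (rule pd_ex[OF pc_length in1])
  then show "pd ?A 2 (\<lambda>w xs. block (drop (xs ! 0) w) = block (drop (xs ! 1) w))"
    by (rule pc_cong[rotated]) (simp add: block_eq_iff numeral_2_eq_2 numeral_3_eq_3)
qed

lemma arches_concat:
  "arches (concat (map g [0..<n])) S = (\<Sum>i<n. arches (g i) (rest (concat (map g [0..<i])) S))"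
  by (induction n) auto

text \<open>The states are the constantly many proper subsets of \<open>\<Sigma>\<close>, numbered
  by \<open>enc\<close>. A recursion on these numbers gives the state before each block, a table
  gives the arches that the block then completes, and these are summed. The blocks
  \<open>G v\<close> come from a finite stock, and \<open>e\<close> selects the one at a
  position.\<close>

lemma pc_arches:
  assumes \<sigma>: "\<sigma> \<ge> 1" and e: "pc A (Suc k) e" and b: "pc A k b"
    and E: "\<And>w i xs. w \<in> lists {1..A} \<Longrightarrow> length xs = k \<Longrightarrow> e w (i # xs) < E"
    and G: "\<And>v. v < E \<Longrightarrow> G v \<in> lists (\<Sigma>)"
  shows "pc A k (\<lambda>w xs. arches (concat (map (\<lambda>i. G (e w (i # xs))) [0..<b w xs])) {})"
proof -
  define Q where "Q = card {S. S \<subset> \<Sigma>}"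
  have fin: "finite {S. S \<subset> \<Sigma>}"
    by (rule finite_subset[of _ "Pow (\<Sigma>)"]) (auto simp: finite_alphabet)
  obtain enc where enc: "bij_betw enc {S. S \<subset> \<Sigma>} {0..<Q}"
    using ex_bij_betw_finite_nat[OF fin] by (auto simp: Q_def)
  define dec where "dec = inv_into {S. S \<subset> \<Sigma>} enc"
  have dec: "dec (enc S) = S" "enc S < Q" if "S \<subset> \<Sigma>" for S
    using that enc bij_betwE[OF enc] by (auto simp: dec_def bij_betw_inv_into_left)
  have Q0: "enc {} < Q" by (rule dec(2)[OF alphabet_nonempty[OF \<sigma>]])
  \<comment> \<open>Cutting off at \<open>Q\<close> makes the values of \<open>g\<close> smaller
    than \<open>Q\<close> for all arguments, as bounded recursion demands.\<close>
  define T where "T = (\<lambda>a v. let r = enc (rest (G v) (dec a)) in if r < Q then r else 0)"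
  define g where "g = (\<lambda>w ys. if ys ! 1 < Q \<and> e w (ys ! 0 # tl (tl ys)) < E then T (ys ! 1) (e w (ys ! 0 # tl (tl ys))) else 0)"
  define st where "st = (\<lambda>w xs n. rec_nat (enc {}) (\<lambda>i a. g w (i # a # xs)) n)"
  have g: "pc A (Suc (Suc j)) g" if "pc A (Suc j) e" for j
    unfolding g_def by (intro pc_table2 pc_nth pc_skip_acc[OF that]) simp
  have gQ: "g w ys < Q" for w ys using Q0 by (auto simp: g_def T_def Let_def)
  \<comment> \<open>Inside the sum the environment begins with the summation index. The inner
    recursion has to skip it along with its own index and accumulator, hence
    \<open>drop 3\<close>.\<close>
  have e': "pc A (Suc (Suc (Suc k))) (\<lambda>w ys. g w (ys ! 0 # ys ! 1 # drop 3 ys))"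
  proof (rule pc_cong[OF _ pc_reindex[OF g[OF e], of "0 # 1 # [3..<Suc (Suc (Suc k))]"]])
    fix w and ys :: "nat list" assume l: "length ys = Suc (Suc (Suc k))"
    have "map ((!) ys) [3..<Suc (Suc (Suc k))] = drop 3 ys"
      by (rule nth_equalityI) (use l in \<open>auto simp del: upt_Suc\<close>)
    then show "g w (map ((!) ys) (0 # 1 # [3..<Suc (Suc (Suc k))])) = g w (ys ! 0 # ys ! 1 # drop 3 ys)"
      by (simp del: upt_Suc)
  qed auto
  have "pc A (Suc k) (\<lambda>w ys. rec_nat (enc {}) (\<lambda>i a. g w ((i # a # ys) ! 0 # (i # a # ys) ! 1 # drop 3 (i # a # ys))) (ys ! 0))"
    by (rule pc_rec_finite[OF pc_const e' pc_nth, where Q = Q]) (simp_all add: Q0 gQ)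
  moreover have "st w (tl ys) (ys ! 0) = rec_nat (enc {})
      (\<lambda>i a. g w ((i # a # ys) ! 0 # (i # a # ys) ! 1 # drop 3 (i # a # ys))) (ys ! 0)" for w ys
    by (simp add: st_def numeral_3_eq_3 drop_Suc)
  ultimately have st: "pc A (Suc k) (\<lambda>w ys. st w (tl ys) (ys ! 0))" by simp
  define cnt where "cnt = (\<lambda>w ys. if st w (tl ys) (ys ! 0) < Q \<and> e w ys < E
      then arches (G (e w ys)) (dec (st w (tl ys) (ys ! 0))) else 0)"
  have "pc A (Suc k) cnt"
    unfolding cnt_def by (rule pc_table2[OF st e])
  then have "pc A k (\<lambda>w xs. \<Sum>i<b w xs. cnt w (i # xs))" by (rule pc_sum[OF b])
  then show ?thesis
  proof (rule pc_cong[rotated])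
    fix w and xs :: "nat list" assume w: "w \<in> lists {1..A}" "length xs = k"
    define G' where "G' = (\<lambda>i. G (e w (i # xs)))"
    have G'L: "G' i \<in> lists (\<Sigma>)" for i unfolding G'_def using G E[OF w] by blast
    have cL: "concat (map G' [0..<n]) \<in> lists (\<Sigma>)" for n
    proof (induction n)
      case (Suc n)
      then show ?case using G'L[of n] by simp
    qed simp
    have sub: "rest (concat (map G' [0..<n])) {} \<subset> \<Sigma>" for n
      by (rule rest_psubset[OF cL alphabet_nonempty[OF \<sigma>]])
    have st_eq: "st w xs n = enc (rest (concat (map G' [0..<n])) {})" for n
    proof (induction n)
      case (Suc n)
      have "g w (n # st w xs n # xs) = enc (rest (G' n) (rest (concat (map G' [0..<n])) {}))"
        using Suc dec[OF sub[of n]] dec(2)[OF sub[of "Suc n"]] E[OF w, of n]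
        by (simp add: g_def T_def G'_def)
      then show ?case by (simp add: st_def)
    qed (simp add: st_def)
    have "cnt w (i # xs) = arches (G' i) (rest (concat (map G' [0..<i])) {})" for i
      using dec[OF sub[of i]] E[OF w, of i] by (simp add: cnt_def st_eq G'_def)
    then show "(\<Sum>i<b w xs. cnt w (i # xs)) = arches (concat (map (\<lambda>i. G (e w (i # xs))) [0..<b w xs])) {}"
      unfolding G'_def[symmetric] by (simp add: arches_concat)
  qed
qed

section \<open>Deciding the matching problem\<close>

definition var_at :: "nat list \<Rightarrow> nat \<Rightarrow> nat option" where
  "var_at w i = (if sym_at w i = \<sigma> + 1
     then Some (foldl (num_step) 0 (block (drop (Suc i) w))) else None)"

text \<open>The computable substitute for comparing the values of \<open>var_at\<close>, which may
  be exponential and therefore occur only in specifications.\<close>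

definition same_var :: "nat list \<Rightarrow> nat \<Rightarrow> nat \<Rightarrow> bool" where
  "same_var w i j \<longleftrightarrow> sym_at w i = \<sigma> + 1 \<and> sym_at w j = \<sigma> + 1 \<and>
     block (drop (Suc i) w) = block (drop (Suc j) w)"

lemma var_at_less: "var_at w i = Some x \<Longrightarrow> i < length w"
  using letter_outside[of i w "\<sigma> + 4"] by (auto simp: var_at_def split: if_splits)

lemma token_at_eq:
  assumes "i < length w"
  shows "token_at w i = (if sym_at w i \<in> {1..\<sigma>} then [Terminal (sym_at w i)]
     else case var_at w i of Some x \<Rightarrow> [Variable x] | None \<Rightarrow> [])"
  using assms by (auto simp: token_def var_at_def letter_nth)

context
  fixes k :: nat and \<alpha> :: "symbol list" and w :: "nat list"
  assumes \<alpha>: "\<alpha> \<in> patterns \<sigma>" and w: "w = encode_instance \<sigma> \<alpha> k"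
begin

lemma pattern_eq: "\<alpha> = concat (map (token_at w) [0..<length w])"
  using tokens_encode_instance[OF \<alpha>, of k] tokens_eq_concat[of w] w by simp

lemma same_var_iff: "same_var w i j \<longleftrightarrow> var_at w i \<noteq> None \<and> var_at w i = var_at w j"
proof (cases "sym_at w i = \<sigma> + 1 \<and> sym_at w j = \<sigma> + 1")
  case True
  then have l: "i < length w" "j < length w"
    using letter_outside[of i w "\<sigma> + 4"] letter_outside[of j w "\<sigma> + 4"] by fastforce+
  with True have "w ! i = \<sigma> + 1" "w ! j = \<sigma> + 1" by (simp_all add: letter_nth)
  with same_variable_iff[OF \<alpha> w] l True show ?thesis by (auto simp: same_var_def var_at_def token_def)
qed (auto simp: same_var_def var_at_def)

lemma vars_eq: "vars \<alpha> = {x. \<exists>i<length w. var_at w i = Some x}"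
proof -
  have "x \<in> vars \<alpha> \<longleftrightarrow> (\<exists>i<length w. Variable x \<in> set (token_at w i))" for x
    unfolding vars_def by (subst pattern_eq) auto
  moreover have "Variable x \<in> set (token_at w i) \<longleftrightarrow> var_at w i = Some x" if "i < length w" for i x
    unfolding token_at_eq[OF that] by (auto simp: var_at_def split: option.splits)
  ultimately show ?thesis by blast
qed

lemma sum_list_pattern: "(\<Sum>s\<leftarrow>\<alpha>. f s) = (\<Sum>i<length w. \<Sum>s\<leftarrow>token_at w i. f s :: nat)"
proof -
  have "(\<Sum>s\<leftarrow>concat (map g [0..<n]). f s) = (\<Sum>i<n. \<Sum>s\<leftarrow>g i. f s)" for g :: "nat \<Rightarrow> symbol list" and n
    by (induction n) auto
  then show ?thesis by (subst pattern_eq) (simp only:)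
qed

lemma apply_subst_pattern:
  "apply_subst h \<alpha> = concat (map (\<lambda>i. apply_subst h (token_at w i)) [0..<length w])"
proof -
  have "apply_subst h (concat (map g [0..<n])) = concat (map (\<lambda>i. apply_subst h (g i)) [0..<n])"
    for g :: "nat \<Rightarrow> symbol list" and n by (induction n) auto
  then show ?thesis by (subst pattern_eq) (simp only:)
qed

lemma count_list_pattern: "count_list \<alpha> (Variable x) = card {i. i < length w \<and> var_at w i = Some x}"
proof -
  have "count_list xs y = (\<Sum>s\<leftarrow>xs. of_bool (s = y))" for xs :: "symbol list" and y
    by (induction xs) auto
  then have "count_list \<alpha> (Variable x) = (\<Sum>i<length w. \<Sum>s\<leftarrow>token_at w i. of_bool (s = Variable x))"
    using sum_list_pattern by simp
  also have "\<dots> = (\<Sum>i<length w. of_bool (var_at w i = Some x))"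
    by (intro sum.cong refl) (auto simp: token_at_eq var_at_def split: option.splits)
  also have "\<dots> = card {i. i < length w \<and> var_at w i = Some x}"
    by (simp add: Int_def)
  finally show ?thesis .
qed

lemma count_list_eq_1:
  assumes "var_at w i = Some x"
  shows "count_list \<alpha> (Variable x) = 1 \<longleftrightarrow> (\<forall>j<length w. same_var w i j \<longrightarrow> j = i)"
proof -
  define S where "S = {j. j < length w \<and> var_at w j = Some x}"
  have S: "j \<in> S \<longleftrightarrow> j < length w \<and> same_var w i j" for j
    unfolding S_def same_var_iff assms by auto
  have i: "i \<in> S" using assms var_at_less by (simp add: S_def)
  have "count_list \<alpha> (Variable x) = card S" by (simp add: count_list_pattern S_def)
  also have "\<dots> = 1 \<longleftrightarrow> (\<forall>j \<in> S. j = i)" using i by (auto simp: card_1_singleton_iff)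
  finally show ?thesis using S by blast
qed

lemma var_at_None: "var_at w i = None \<longleftrightarrow> sym_at w i \<noteq> \<sigma> + 1"
  by (simp add: var_at_def)

lemma has_unique_variable_iff: "has_unique_variable \<alpha> \<longleftrightarrow>
  (\<exists>i<length w. sym_at w i = \<sigma> + 1 \<and> (\<forall>j<length w. same_var w i j \<longrightarrow> j = i))" (is "_ \<longleftrightarrow> ?R")
proof
  assume "has_unique_variable \<alpha>"
  then obtain x where x: "count_list \<alpha> (Variable x) = 1" by (auto simp: has_unique_variable_def)
  then have "card {i. i < length w \<and> var_at w i = Some x} \<noteq> 0" unfolding count_list_pattern by simp
  then obtain i where i: "i < length w" "var_at w i = Some x" by (metis (mono_tags, lifting) Collect_empty_eq card.empty)
  then show ?R using count_list_eq_1[OF i(2)] x var_at_None[of i] by auto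
next
  assume ?R
  then obtain i where i: "sym_at w i = \<sigma> + 1" "\<forall>j<length w. same_var w i j \<longrightarrow> j = i" by blast
  then obtain x where "var_at w i = Some x" by (auto simp: var_at_def)
  then show "has_unique_variable \<alpha>" using count_list_eq_1 i(2) by (auto simp: has_unique_variable_def)
qed

lemma regular_pattern_iff: "regular_pattern \<alpha> \<longleftrightarrow>
  (\<forall>i<length w. sym_at w i = \<sigma> + 1 \<longrightarrow> (\<forall>j<length w. same_var w i j \<longrightarrow> j = i))" (is "_ \<longleftrightarrow> ?R")
proof
  assume r: "regular_pattern \<alpha>"
  show ?R
  proof (intro allI impI)
    fix i j assume i: "i < length w" "sym_at w i = \<sigma> + 1" and j: "j < length w" "same_var w i j"
    then obtain x where x: "var_at w i = Some x" by (auto simp: var_at_def)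
    then have "x \<in> vars \<alpha>" using i by (auto simp: vars_eq)
    then show "j = i" using r count_list_eq_1[OF x] j by (auto simp: regular_pattern_def)
  qed
next
  assume R: ?R
  show "regular_pattern \<alpha>"
    unfolding regular_pattern_def
  proof
    fix x assume "x \<in> vars \<alpha>"
    then obtain i where i: "i < length w" "var_at w i = Some x" by (auto simp: vars_eq)
    then show "count_list \<alpha> (Variable x) = 1" using R count_list_eq_1[OF i(2)] var_at_None[of i] by auto
  qed
qed

lemma no_variable_iff: "vars \<alpha> = {} \<longleftrightarrow> \<not> (\<exists>i<length w. sym_at w i = \<sigma> + 1)"
proof -
  have "(\<exists>x. var_at w i = Some x) \<longleftrightarrow> sym_at w i = \<sigma> + 1" for i by (simp add: var_at_def)
  then show ?thesis unfolding vars_eq by blast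
qed

lemma position_of:
  assumes "z \<in> insert None (Some ` vars \<alpha>)"
  shows "\<exists>p<length w. var_at w p = z"
proof (cases z)
  case None
  \<comment> \<open>The separator is present in every instance and is not a variable marker, so its
    position can stand for the padding entry \<open>None\<close>.\<close>
  define p where "p = length (encode_pattern \<alpha>)"
  have "p < length w" "w ! p = \<sigma> + 4" by (simp_all add: w encode_instance_def p_def)
  then show ?thesis using None by (intro exI[of _ p]) (simp add: var_at_def letter_nth)
qed (use assms in \<open>auto simp: vars_eq\<close>)

end

text \<open>
  In the list argument, the position \<open>xs ! 0\<close> is followed by the positions of \<open>c\<close> representatives of
  the variables. The event 0 contributes nothing to the word, an event \<open>a \<le> \<sigma>\<close> is a terminal, and
  \<open>\<sigma> + 1 + j\<close> is an occurrence of the \<open>j\<close>-th represented variable.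
\<close>

definition event :: "nat \<Rightarrow> nat list \<Rightarrow> nat list \<Rightarrow> nat" where
  "event c w xs = (if sym_at w (xs ! 0) \<in> {1..\<sigma>} then sym_at w (xs ! 0)
     else if \<exists>j<c. same_var w (xs ! 0) (xs ! Suc j)
     then \<sigma> + 1 + (LEAST j. j < c \<and> same_var w (xs ! 0) (xs ! Suc j)) else 0)"

definition event_word :: "nat list list \<Rightarrow> nat \<Rightarrow> nat list" where
  "event_word vs v = (if v = 0 then [] else if v \<le> \<sigma> then [v] else vs ! (v - (\<sigma> + 1)))"

lemma pd_same_var:
  assumes "pc (\<sigma> + 4) k f" "pc (\<sigma> + 4) k g"
  shows "pd (\<sigma> + 4) k (\<lambda>w xs. same_var w (f w xs) (g w xs))"
  unfolding same_var_def
  by (intro pd_conj pd_eq pc_letter pc_const assms pd_block_eq[of k "\<lambda>w xs. Suc (f w xs)" "\<lambda>w xs. Suc (g w xs)"] pc_Suc)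

lemma Least_less_Suc:
  assumes "\<exists>j<c. P j"
  shows "(LEAST j. j < Suc c \<and> P j) = (LEAST j. j < c \<and> P j)"
proof (rule Least_equality)
  have l: "(LEAST j. j < c \<and> P j) < c \<and> P (LEAST j. j < c \<and> P j)" using assms by (rule LeastI_ex)
  then show "(LEAST j. j < c \<and> P j) < Suc c \<and> P (LEAST j. j < c \<and> P j)" by simp
  fix y assume "y < Suc c \<and> P y"
  then show "(LEAST j. j < c \<and> P j) \<le> y"
    using l by (cases "y < c") (auto intro: Least_le)
qed

text \<open>As \<open>c\<close> is a constant, the search is unrolled into nested conditionals, and
  \<open>F\<close> is applied to constants only.\<close>

lemma pc_Least:
  fixes c :: nat
  assumes "\<And>j. j < c \<Longrightarrow> pd A k (P j)"
  shows "pc A k (\<lambda>w xs. if \<exists>j<c. P j w xs then F (LEAST j. j < c \<and> P j w xs) else 0)"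
  using assms
proof (induction c)
  case (Suc c)
  have ex: "pd A k (\<lambda>w xs. \<exists>j \<in> {..<c}. P j w xs)" by (intro pd_finite_ex) (auto intro: Suc.prems)
  have "pc A k (\<lambda>w xs. if \<exists>j \<in> {..<c}. P j w xs then
      (if \<exists>j<c. P j w xs then F (LEAST j. j < c \<and> P j w xs) else 0) else if P c w xs then F c else 0)"
    by (intro pd_If ex Suc.IH Suc.prems pc_const) auto
  then show ?case
  proof (rule pc_cong[rotated])
    fix w xs
    show "(if \<exists>j \<in> {..<c}. P j w xs then
      (if \<exists>j<c. P j w xs then F (LEAST j. j < c \<and> P j w xs) else 0) else if P c w xs then F c else 0) =
      (if \<exists>j<Suc c. P j w xs then F (LEAST j. j < Suc c \<and> P j w xs) else 0)"
    proof (cases "\<exists>j<c. P j w xs")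
      case True
      then show ?thesis using Least_less_Suc[of c "\<lambda>j. P j w xs"] by (auto simp: less_Suc_eq)
    next
      case False
      have "P c w xs \<Longrightarrow> (LEAST j. j < Suc c \<and> P j w xs) = c"
        by (rule Least_equality) (use False in \<open>auto simp: less_Suc_eq not_less\<close>)
      then show ?thesis using False by (auto simp: less_Suc_eq)
    qed
  qed
qed (simp add: pc_zero)

lemma pc_event: "pc (\<sigma> + 4) (Suc c) (event c)"
proof -
  have l: "pc (\<sigma> + 4) (Suc c) (\<lambda>w xs. sym_at w (xs ! 0))" by (intro pc_letter pc_nth) simp
  have "pc (\<sigma> + 4) (Suc c) (\<lambda>w xs. if 1 \<le> sym_at w (xs ! 0) \<and> sym_at w (xs ! 0) \<le> \<sigma>
     then sym_at w (xs ! 0)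
     else if \<exists>j<c. same_var w (xs ! 0) (xs ! Suc j)
     then \<sigma> + 1 + (LEAST j. j < c \<and> same_var w (xs ! 0) (xs ! Suc j)) else 0)"
    by (intro pd_If pd_conj pd_le pc_const l
        pc_Least[where P = "\<lambda>j w xs. same_var w (xs ! 0) (xs ! Suc j)" and F = "\<lambda>v. \<sigma> + 1 + v"] pd_same_var pc_nth) auto
  then show ?thesis by (rule pc_cong[rotated]) (simp add: event_def)
qed

lemma event_less: "event c w xs < \<sigma> + c + 1"
proof -
  have "(LEAST j. j < c \<and> same_var w (xs ! 0) (xs ! Suc j)) < c" if "\<exists>j<c. same_var w (xs ! 0) (xs ! Suc j)"
    using LeastI_ex[OF that] by simp
  then show ?thesis by (auto simp: event_def)
qed

lemma pc_finite_sum: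
  fixes c :: nat
  assumes "\<And>j. j < c \<Longrightarrow> pc A k (f j)"
  shows "pc A k (\<lambda>w xs. \<Sum>j<c. f j w xs)"
  using assms by (induction c) (auto intro!: pc_zero pc_add)

context
  fixes k c :: nat and \<alpha> :: "symbol list" and w :: "nat list" and ps zs
  assumes \<alpha>: "\<alpha> \<in> patterns \<sigma>" and w: "w = encode_instance \<sigma> \<alpha> k"
    and ps: "length ps = c" and zs: "zs = map (var_at w) ps"
begin

lemma length_zs: "length zs = c"
  by (simp add: zs ps)

lemma nth_zs: "j < c \<Longrightarrow> zs ! j = var_at w (ps ! j)"
  by (simp add: zs ps)

lemma event_variable:
  assumes "var_at w i = Some x"
  shows "event c w (i # ps) = (if Some x \<in> set zs then \<sigma> + 1 + class_of zs x else 0)"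
proof -
  have s: "j < c \<Longrightarrow> same_var w i (ps ! j) \<longleftrightarrow> zs ! j = Some x" for j
    using assms by (auto simp: same_var_iff[OF \<alpha> w] nth_zs)
  have "(\<exists>j<c. same_var w i (ps ! j)) \<longleftrightarrow> Some x \<in> set zs"
    using s by (auto simp: in_set_conv_nth length_zs)
  moreover have "(\<lambda>j. j < c \<and> same_var w i (ps ! j)) = (\<lambda>j. j < length zs \<and> zs ! j = Some x)"
    using s by (auto simp: length_zs)
  moreover have "sym_at w i = \<sigma> + 1" using assms by (auto simp: var_at_def split: if_splits)
  ultimately show ?thesis by (simp add: event_def class_of_def)
qed

text \<open>Variables without a representative are erased. With \<open>c = 0\<close> this produces
  the erased pattern, with a covering list the substitution of the classes, so one program serves
  all cases.\<close>

lemma event_word_eq: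
  assumes i: "i < length w"
  shows "event_word vs (event c w (i # ps)) =
    apply_subst (\<lambda>x. if Some x \<in> set zs then vs ! class_of zs x else []) (token_at w i)"
proof (cases "var_at w i")
  case None
  then have "\<not> same_var w i j" for j by (simp add: same_var_iff[OF \<alpha> w])
  then show ?thesis using None i by (auto simp: token_at_eq event_def event_word_def)
next
  case (Some x)
  then have "sym_at w i = \<sigma> + 1" by (auto simp: var_at_def split: if_splits)
  then show ?thesis using Some i event_variable[OF Some] by (auto simp: token_at_eq event_word_def)
qed

lemma concat_event_word:
  "concat (map (\<lambda>i. event_word vs (event c w (i # ps))) [0..<length w]) =
    apply_subst (\<lambda>x. if Some x \<in> set zs then vs ! class_of zs x else []) \<alpha>"
  unfolding apply_subst_pattern[OF \<alpha> w] by (intro arg_cong[of _ _ concat] map_cong) (auto simp: event_word_eq)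

text \<open>For an uncovered variable \<open>class_of\<close> is unspecified and might equal
  \<open>j\<close>, while its event is 0; the cover rules this out.\<close>

lemma occurrences_event:
  assumes cover: "\<forall>x \<in> vars \<alpha>. Some x \<in> set zs"
  shows "occurrences zs \<alpha> j = (\<Sum>i<length w. of_bool (event c w (i # ps) = \<sigma> + 1 + j))"
  unfolding occurrences_def sum_list_pattern[OF \<alpha> w]
proof (intro sum.cong refl)
  fix i assume "i \<in> {..<length w}"
  then have i: "i < length w" by simp
  show "sum_vars (\<lambda>x. of_bool (class_of zs x = j)) (token_at w i) =
    (of_bool (event c w (i # ps) = \<sigma> + 1 + j) :: nat)"
  proof (cases "var_at w i")
    case None
    then have "\<not> same_var w i j" for j by (simp add: same_var_iff[OF \<alpha> w])
    then show ?thesis using None i by (auto simp: token_at_eq event_def)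
  next
    case (Some x)
    then have "sym_at w i = \<sigma> + 1" by (auto simp: var_at_def split: if_splits)
    moreover have "x \<in> vars \<alpha>" using Some i by (auto simp: vars_eq[OF \<alpha> w])
    ultimately show ?thesis using Some i event_variable[OF Some] cover by (auto simp: token_at_eq)
  qed
qed

lemma cover_iff:
  "(\<forall>x \<in> vars \<alpha>. Some x \<in> set zs) \<longleftrightarrow>
   (\<forall>i<length w. sym_at w i = \<sigma> + 1 \<longrightarrow> (\<exists>j<c. same_var w i (ps ! j)))" (is "?L \<longleftrightarrow> ?R")
proof
  assume L: ?L
  show ?R
  proof (intro allI impI)
    fix i assume i: "i < length w" "sym_at w i = \<sigma> + 1"
    then obtain x where x: "var_at w i = Some x" by (auto simp: var_at_def)
    then have "Some x \<in> set zs" using L i by (auto simp: vars_eq[OF \<alpha> w])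
    then show "\<exists>j<c. same_var w i (ps ! j)"
      using x by (auto simp: in_set_conv_nth length_zs nth_zs same_var_iff[OF \<alpha> w])
  qed
next
  assume R: ?R
  show ?L
  proof
    fix x assume "x \<in> vars \<alpha>"
    then obtain i where i: "i < length w" "var_at w i = Some x" by (auto simp: vars_eq[OF \<alpha> w])
    then have "sym_at w i = \<sigma> + 1" by (auto simp: var_at_def split: if_splits)
    then obtain j where "j < c" "same_var w i (ps ! j)" using R i by blast
    then show "Some x \<in> set zs"
      using i nth_mem[of j zs] by (simp add: same_var_iff[OF \<alpha> w] nth_zs length_zs)
  qed
qed

end

text \<open>
  The index of the pattern with its \<open>j\<close>-th represented variable replaced by \<open>vs ! j\<close>.
\<close>

definition event_arches :: "nat \<Rightarrow> nat list list \<Rightarrow> nat list \<Rightarrow> nat list \<Rightarrow> nat" where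
  "event_arches c vs w ps =
     arches (concat (map (\<lambda>i. event_word vs (event c w (i # ps))) [0..<length w])) {}"

lemma pc_event_arches:
  assumes "\<sigma> \<ge> 1" "length vs = c" "set vs \<subseteq> lists (\<Sigma>)"
  shows "pc (\<sigma> + 4) c (event_arches c vs)"
  unfolding event_arches_def
proof (rule pc_arches[OF assms(1) pc_event pc_input_length event_less])
  fix v assume v: "v < \<sigma> + c + 1"
  show "event_word vs v \<in> lists (\<Sigma>)"
  proof (cases "v \<le> \<sigma>")
    case True
    then show ?thesis by (auto simp: event_word_def alphabet_def)
  next
    case False
    then have "v - (\<sigma> + 1) < length vs" using v assms(2) by simp
    then show ?thesis using assms(3) False nth_mem by (fastforce simp: event_word_def)
  qed
qed

lemma event_arches_Nil:
  assumes "\<alpha> \<in> patterns \<sigma>" "w = encode_instance \<sigma> \<alpha> k"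
  shows "event_arches 0 [] w [] = arches (erase \<alpha>) {}"
  unfolding event_arches_def using concat_event_word[OF assms, of "[]" 0 "[]" "[]"] by simp

section \<open>Decision procedures for the three classes of patterns\<close>

lemma encode_instance_in_lists:
  assumes "\<alpha> \<in> patterns \<sigma>"
  shows "encode_instance \<sigma> \<alpha> k \<in> lists {1..\<sigma> + 4}"
proof -
  have d: "encode_nat \<sigma> x \<in> lists {1..\<sigma> + 4}" for x using digit_encode_nat by fastforce
  have "encode_pattern \<alpha> \<in> lists {1..\<sigma> + 4}"
    using assms
  proof (induction \<alpha>)
    case (Cons s \<alpha>)
    then show ?case using d by (cases s) (auto simp: alphabet_def)
  qed simp
  then show ?thesis using d by (simp add: encode_instance_def)
qed

text \<open>A criterion has to be correct on encodings only; the automaton for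
  \<open>well_formed\<close> rejects all other inputs.\<close>

lemma match_univ_in_PI:
  assumes P: "pd (\<sigma> + 4) 0 P"
    and eq: "\<And>\<alpha> k. \<alpha> \<in> patterns \<sigma> \<Longrightarrow> P (encode_instance \<sigma> \<alpha> k) [] \<longleftrightarrow> \<alpha> \<in> C \<and> match_univ \<sigma> \<alpha> k"
  shows "match_univ_in_P \<sigma> C"
proof -
  have "match_univ_language \<sigma> C = {w \<in> lists {1..\<sigma> + 4}. well_formed w \<and> P w []}"
    unfolding match_univ_language_def well_formed_iff using encode_instance_in_lists eq by blast
  then show ?thesis
    unfolding match_univ_in_P_def using pd_in_P[OF pd_conj[OF pd_well_formed P]] by simp
qed

lemma pd_le_last_num:
  assumes "pc (\<sigma> + 4) k f"
  shows "pd (\<sigma> + 4) k (\<lambda>w xs. f w xs \<le> last_num w)"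
proof -
  have "pd (\<sigma> + 4) k (\<lambda>w xs. min (f w xs) (last_num w) = f w xs)"
    by (intro pd_eq pc_last_num assms)
  then show ?thesis by (simp only: min.absorb_iff1)
qed

lemma pd_eq_last_num:
  assumes "pc (\<sigma> + 4) k f"
  shows "pd (\<sigma> + 4) k (\<lambda>w xs. f w xs = last_num w)"
proof -
  \<comment> \<open>The cap lies one above \<open>f w xs\<close>, so that equality is distinguished
    from a larger number.\<close>
  have "pd (\<sigma> + 4) k (\<lambda>w xs. min (Suc (f w xs)) (last_num w) = f w xs)"
    by (intro pd_eq pc_last_num pc_Suc assms)
  then show ?thesis by (rule pc_cong[rotated]) (auto simp: min_def)
qed

lemma pd_unique: "pd (\<sigma> + 4) 1 (\<lambda>w xs. sym_at w (xs ! 0) = \<sigma> + 1 \<and>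
   (\<forall>j<length w. same_var w ((j # xs) ! 1) ((j # xs) ! 0) \<longrightarrow> (j # xs) ! 0 = (j # xs) ! 1))"
  by (intro pd_conj pd_eq pc_letter pc_const pc_nth pc_input_length
      pd_all[where P = "\<lambda>w xs. same_var w (xs ! 1) (xs ! 0) \<longrightarrow> xs ! 0 = xs ! 1"] pd_imp pd_same_var) auto

lemma match_univ_unique_in_P:
  assumes "\<sigma> \<ge> 1"
  shows "match_univ_in_P \<sigma> {\<alpha>. has_unique_variable \<alpha>}"
proof (rule match_univ_in_PI)
  define P where "P = (\<lambda>w (xs :: nat list). (\<exists>i<length w. sym_at w i = \<sigma> + 1 \<and>
     (\<forall>j<length w. same_var w i j \<longrightarrow> j = i)) \<and> event_arches 0 [] w xs \<le> last_num w)"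
  have "pd (\<sigma> + 4) 0 (\<lambda>w xs. \<exists>i<length w. sym_at w ((i # xs) ! 0) = \<sigma> + 1 \<and>
     (\<forall>j<length w. same_var w ((j # i # xs) ! 1) ((j # i # xs) ! 0) \<longrightarrow> (j # i # xs) ! 0 = (j # i # xs) ! 1))"
    using pd_ex[OF pc_input_length pd_unique[unfolded One_nat_def]] by simp
  moreover have "pc (\<sigma> + 4) 0 (event_arches 0 [])" by (rule pc_event_arches[OF assms]) auto
  ultimately show "pd (\<sigma> + 4) 0 P" unfolding P_def by (intro pd_conj pd_le_last_num) simp_all
  fix \<alpha> k assume \<alpha>: "\<alpha> \<in> patterns \<sigma>"
  show "P (encode_instance \<sigma> \<alpha> k) [] \<longleftrightarrow> \<alpha> \<in> {\<alpha>. has_unique_variable \<alpha>} \<and> match_univ \<sigma> \<alpha> k"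
    using has_unique_variable_iff[OF \<alpha> refl, of k] match_univ_unique_variable[OF assms \<alpha>, of _ k]
    unfolding P_def event_arches_Nil[OF \<alpha> refl] last_num_encode_instance
    by (auto simp: has_unique_variable_def)
qed

text \<open>A regular pattern may contain no variable at all; then only its own index is attained,
  so \<open>\<le>\<close> is replaced by an equality.\<close>

lemma match_univ_regular_in_P:
  assumes "\<sigma> \<ge> 1"
  shows "match_univ_in_P \<sigma> {\<alpha>. regular_pattern \<alpha>}"
proof (rule match_univ_in_PI)
  define V where "V = (\<lambda>w (xs :: nat list). \<exists>i<length w. sym_at w i = \<sigma> + 1)"
  define R where "R = (\<lambda>w (xs :: nat list). \<forall>i<length w. sym_at w i = \<sigma> + 1 \<longrightarrow>
     (\<forall>j<length w. same_var w i j \<longrightarrow> j = i))"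
  define P where "P = (\<lambda>w xs. R w xs \<and> (if V w xs then event_arches 0 [] w xs \<le> last_num w
     else event_arches 0 [] w xs = last_num w))"
  have l: "pd (\<sigma> + 4) (Suc 0) (\<lambda>w xs. sym_at w (xs ! 0) = \<sigma> + 1)"
    by (intro pd_eq pc_letter pc_const pc_nth) simp
  have V: "pd (\<sigma> + 4) 0 V"
    using pd_ex[OF pc_input_length l] by (simp add: V_def)
  have R: "pd (\<sigma> + 4) 0 R"
    using pd_all[OF pc_input_length pd_imp[OF l pd_unique[unfolded One_nat_def]]] by (simp add: R_def cong: imp_cong)
  have a: "pc (\<sigma> + 4) 0 (event_arches 0 [])" by (rule pc_event_arches[OF assms]) auto
  have "pd (\<sigma> + 4) 0 (\<lambda>w xs. R w xs \<and> ((V w xs \<and> event_arches 0 [] w xs \<le> last_num w) \<or>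
     (\<not> V w xs \<and> event_arches 0 [] w xs = last_num w)))"
    by (intro pd_conj pd_disj pd_not V R pd_le_last_num pd_eq_last_num a)
  then show "pd (\<sigma> + 4) 0 P" by (rule pc_cong[rotated]) (auto simp: P_def)
  fix \<alpha> k assume \<alpha>: "\<alpha> \<in> patterns \<sigma>"
  let ?w = "encode_instance \<sigma> \<alpha> k"
  have R': "R ?w [] \<longleftrightarrow> regular_pattern \<alpha>" using regular_pattern_iff[OF \<alpha> refl, of k] by (simp add: R_def)
  have V': "V ?w [] \<longleftrightarrow> vars \<alpha> \<noteq> {}" using no_variable_iff[OF \<alpha> refl, of k] by (simp add: V_def)
  show "P ?w [] \<longleftrightarrow> \<alpha> \<in> {\<alpha>. regular_pattern \<alpha>} \<and> match_univ \<sigma> \<alpha> k"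
  proof (cases "vars \<alpha> = {}")
    case True
    then show ?thesis using match_univ_no_variable[OF assms \<alpha> True, of k]
      unfolding P_def R' V' event_arches_Nil[OF \<alpha> refl] last_num_encode_instance by auto
  next
    case False
    then obtain x where "x \<in> vars \<alpha>" by blast
    then have "regular_pattern \<alpha> \<Longrightarrow> match_univ \<sigma> \<alpha> k \<longleftrightarrow> arches (erase \<alpha>) {} \<le> k"
      using match_univ_unique_variable[OF assms \<alpha>, of x k] by (simp add: regular_pattern_def)
    then show ?thesis using False
      unfolding P_def R' V' event_arches_Nil[OF \<alpha> refl] last_num_encode_instance by auto
  qed
qed

text \<open>The counterpart of \<open>pump_count\<close> in terms of positions. The test on
  \<open>vs ! j\<close> is made when the program is built, since \<open>vs\<close> is fixed.\<close>

definition weight :: "nat \<Rightarrow> nat list list \<Rightarrow> nat \<Rightarrow> nat list \<Rightarrow> nat list \<Rightarrow> nat" where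
  "weight c vs j w ps = (if set (vs ! j) = \<Sigma>
     then \<Sum>i<length w. of_bool (event c w (i # ps) = \<sigma> + 1 + j) else 0)"

lemma pc_weight: "pc (\<sigma> + 4) c (weight c vs j)"
proof (cases "set (vs ! j) = \<Sigma>")
  case True
  have "pc (\<sigma> + 4) c (\<lambda>w ps. \<Sum>i<length w. (\<lambda>w xs. of_bool (event c w xs = \<sigma> + 1 + j)) w (i # ps))"
    by (intro pc_sum pc_input_length pd_eq pc_event pc_const)
  moreover have "weight c vs j = (\<lambda>w ps. \<Sum>i<length w. of_bool (event c w (i # ps) = \<sigma> + 1 + j))"
    by (intro ext) (simp only: weight_def True simp_thms if_True)
  ultimately show ?thesis by (simp only:)
next
  case False
  then have "weight c vs j = (\<lambda>w ps. 0)" by (intro ext) (simp add: weight_def)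
  then show ?thesis by (simp add: pc_zero)
qed

lemma weight_le: "weight c vs j w ps \<le> length w"
proof -
  have "(\<Sum>i<length w. of_bool (event c w (i # ps) = \<sigma> + 1 + j)) \<le> (\<Sum>i<length w. (1 :: nat))"
    by (intro sum_mono) simp
  then show ?thesis by (simp add: weight_def)
qed

definition total_arches :: "nat \<Rightarrow> nat list list \<Rightarrow> nat list \<Rightarrow> nat list \<Rightarrow> nat list \<Rightarrow> nat" where
  "total_arches c vs w ps ms = event_arches c vs w ps + (\<Sum>j<c. weight c vs j w ps * ms ! j)"

text \<open>The right-hand side of \<open>representable_iff\<close> for
  \<open>N = Suc (length w)\<close>, which exceeds every coefficient because coefficients count
  input positions.\<close>

definition solvable :: "nat \<Rightarrow> nat list list \<Rightarrow> nat list \<Rightarrow> nat list \<Rightarrow> bool" where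
  "solvable c vs w ps \<longleftrightarrow> event_arches c vs w ps = last_num w \<or>
     (\<exists>i \<in> {..<c}. 0 < weight c vs i w ps \<and>
       (\<exists>ms. length ms = c \<and> (\<forall>m \<in> set ms. m < Suc (length w)) \<and>
          total_arches c vs w ps ms \<le> last_num w \<and>
          total_arches c vs w ps ms mod weight c vs i w ps = last_num w mod weight c vs i w ps))"

lemma solvable_iff:
  "solvable c vs w ps \<longleftrightarrow> (\<exists>ms. length ms = c \<and> last_num w = total_arches c vs w ps ms)"
  unfolding total_arches_def
  by (subst representable_iff[where N = "Suc (length w)"])
    (auto simp: solvable_def total_arches_def less_Suc_eq_le weight_le)

lemma pd_solvable:
  assumes "\<sigma> \<ge> 1" "length vs = c" "set vs \<subseteq> lists (\<Sigma>)"
  shows "pd (\<sigma> + 4) c (solvable c vs)"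
proof -
  let ?A = "\<sigma> + 4"
  note ea = pc_event_arches[OF assms]
  have t: "pc ?A (c + c) (\<lambda>w xs. event_arches c vs w (drop c xs) + (\<Sum>j<c. weight c vs j w (drop c xs) * xs ! j))"
    by (intro pc_add pc_finite_sum pc_mult pc_drop ea pc_weight pc_nth) simp
  define t where "t = (\<lambda>w xs. event_arches c vs w (drop c xs) + (\<Sum>j<c. weight c vs j w (drop c xs) * xs ! j))"
  \<comment> \<open>The remainder of \<open>last_num w\<close> is available only with the default 0
    for modulus 0; the condition \<open>0 < weight c vs i w ps\<close> excludes that modulus
    below.\<close>
  have inner: "pd ?A (c + c) (\<lambda>w xs. t w xs \<le> last_num w \<and>
     t w xs mod weight c vs i w (drop c xs) = (if weight c vs i w (drop c xs) = 0 then 0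
       else last_num w mod weight c vs i w (drop c xs)))" for i
    using t unfolding t_def[symmetric]
    by (intro pd_conj pd_le_last_num pd_eq pc_mod pc_drop pc_weight
        pc_last_num(2)[where f = "\<lambda>w xs. weight c vs i w (drop c xs)"])
  have "pd ?A c (\<lambda>w ps. event_arches c vs w ps = last_num w \<or> (\<exists>i \<in> {..<c}. 0 < weight c vs i w ps \<and>
     (\<exists>ms. length ms = c \<and> (\<forall>m \<in> set ms. m < Suc (length w)) \<and>
       (\<lambda>w xs. t w xs \<le> last_num w \<and>
     t w xs mod weight c vs i w (drop c xs) = (if weight c vs i w (drop c xs) = 0 then 0
       else last_num w mod weight c vs i w (drop c xs))) w (ms @ ps))))"
    by (intro pd_disj pd_eq_last_num ea pd_finite_ex pd_conj pd_less pc_const pc_weight pd_list_ex pc_length inner) simp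
  then show ?thesis
  proof (rule pd_cong[rotated])
    fix w and ps :: "nat list"
    have t_eq: "t w (ms @ ps) = total_arches c vs w ps ms" if "length ms = c" for ms
      using that by (simp add: t_def total_arches_def nth_append)
    show "(event_arches c vs w ps = last_num w \<or> (\<exists>i \<in> {..<c}. 0 < weight c vs i w ps \<and>
     (\<exists>ms. length ms = c \<and> (\<forall>m \<in> set ms. m < Suc (length w)) \<and>
       t w (ms @ ps) \<le> last_num w \<and>
     t w (ms @ ps) mod weight c vs i w (drop c (ms @ ps)) = (if weight c vs i w (drop c (ms @ ps)) = 0 then 0
       else last_num w mod weight c vs i w (drop c (ms @ ps)))))) \<longleftrightarrow> solvable c vs w ps"
      unfolding solvable_def using t_eq by (auto cong: conj_cong)
  qed
qed

text \<open>The program searches for \<open>c\<close> positions in place of \<open>c\<close>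
  variables. The tuples of representatives do not depend on the input, so their choice becomes a
  finite disjunction inside the program.\<close>

lemma match_univ_bounded_in_P:
  assumes \<sigma>: "\<sigma> \<ge> 1"
  shows "match_univ_in_P \<sigma> {\<alpha>. card (vars \<alpha>) \<le> c}"
proof -
  let ?A = "\<sigma> + 4"
  obtain W where W: "finite W" "W \<subseteq> lists (\<Sigma>)"
    "\<forall>w \<in> lists (\<Sigma>). \<exists>v \<in> W. \<exists>m. shifts m v w \<and> (set v \<noteq> \<Sigma> \<longrightarrow> m = 0)"
    using finite_representatives[OF \<sigma>] .
  define VS where "VS = {vs. set vs \<subseteq> W \<and> length vs = c}"
  have VS: "finite VS" using finite_lists_length_eq[OF W(1)] by (simp add: VS_def)
  define cover where "cover = (\<lambda>w ps. \<forall>i<length w. letter ?A w i = \<sigma> + 1 \<longrightarrow> (\<exists>j<c. same_var w i (ps ! j)))"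
  define P where "P = (\<lambda>w xs. \<exists>ps. length ps = c \<and> (\<forall>p \<in> set ps. p < length w) \<and>
    (\<lambda>w ps. cover w ps \<and> (\<exists>vs \<in> VS. solvable c vs w ps)) w (ps @ xs))"
  have "pd ?A (Suc c) (\<lambda>w xs. letter ?A w (xs ! 0) = \<sigma> + 1 \<longrightarrow> (\<exists>j \<in> {..<c}. same_var w (xs ! 0) (xs ! Suc j)))"
    by (intro pd_imp pd_eq pc_letter pc_nth pc_const pd_finite_ex pd_same_var) auto
  from pd_all[OF pc_input_length this]
  have "pd ?A c cover" by (rule pc_cong[rotated]) (auto simp: cover_def)
  moreover have "pd ?A c (\<lambda>w ps. \<exists>vs \<in> VS. solvable c vs w ps)"
    using W(2) by (intro pd_finite_ex VS pd_solvable[OF \<sigma>]) (auto simp: VS_def)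
  ultimately have P: "pd ?A 0 P"
    unfolding P_def by (intro pd_list_ex pc_input_length) (simp add: pd_conj)
  show ?thesis
  proof (rule match_univ_in_PI[OF P])
    fix \<alpha> k assume \<alpha>: "\<alpha> \<in> patterns \<sigma>"
    define w where "w = encode_instance \<sigma> \<alpha> k"
    have k: "last_num w = k" by (simp add: w_def last_num_encode_instance)
    define sol where "sol = (\<lambda>zs. (\<forall>x \<in> vars \<alpha>. Some x \<in> set zs) \<and>
      (\<exists>vs. length vs = c \<and> set vs \<subseteq> W \<and> (\<exists>ms. length ms = c \<and>
        k = arches (class_subst zs vs \<alpha>) {} +
          (\<Sum>j<c. pump_count zs vs \<alpha> j * ms ! j))))"
    have sol: "cover w ps \<and> (\<exists>vs \<in> VS. solvable c vs w ps) \<longleftrightarrow> sol (map (var_at w) ps)"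
      if ps: "length ps = c" for ps
    proof -
      define zs where "zs = map (var_at w) ps"
      have c: "cover w ps \<longleftrightarrow> (\<forall>x \<in> vars \<alpha>. Some x \<in> set zs)"
        unfolding cover_def cover_iff[OF \<alpha> w_def ps zs_def] ..
      have tot: "total_arches c vs w ps ms = arches (class_subst zs vs \<alpha>) {} +
          (\<Sum>j<c. pump_count zs vs \<alpha> j * ms ! j)"
        if cov: "\<forall>x \<in> vars \<alpha>. Some x \<in> set zs" for vs ms
      proof -
        have "apply_subst (\<lambda>x. if Some x \<in> set zs then vs ! class_of zs x else []) \<alpha> =
          class_subst zs vs \<alpha>" using cov by (intro apply_subst_cong) auto
        then show ?thesis
          unfolding total_arches_def event_arches_def concat_event_word[OF \<alpha> w_def ps zs_def]
          by (simp only: weight_def occurrences_event[OF \<alpha> w_def ps zs_def cov])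
      qed
      show ?thesis
      proof (cases "\<forall>x \<in> vars \<alpha>. Some x \<in> set zs")
        case True
        then show ?thesis
          unfolding c sol_def zs_def[symmetric] solvable_iff k tot[OF True] VS_def by blast
      next
        case False
        then show ?thesis unfolding c sol_def zs_def[symmetric] by blast
      qed
    qed
    have "P w [] \<longleftrightarrow> (\<exists>ps. length ps = c \<and> (\<forall>p \<in> set ps. p < length w) \<and> sol (map (var_at w) ps))"
      using sol unfolding P_def by (simp cong: conj_cong)
    also have "\<dots> \<longleftrightarrow> (\<exists>zs. length zs = c \<and> set zs \<subseteq> insert None (Some ` vars \<alpha>) \<and> sol zs)" (is "?L \<longleftrightarrow> ?R")
    proof
      assume ?L
      then obtain ps where ps: "length ps = c" "\<forall>p \<in> set ps. p < length w" "sol (map (var_at w) ps)" by blast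
      have "var_at w p \<in> insert None (Some ` vars \<alpha>)" if "p < length w" for p
        using that by (cases "var_at w p") (auto simp: vars_eq[OF \<alpha> w_def])
      with ps show ?R by (intro exI[of _ "map (var_at w) ps"]) auto
    next
      assume ?R
      then obtain zs where zs: "length zs = c" "set zs \<subseteq> insert None (Some ` vars \<alpha>)" "sol zs" by blast
      obtain pos where pos: "\<And>z. z \<in> set zs \<Longrightarrow> pos z < length w \<and> var_at w (pos z) = z"
        using position_of[OF \<alpha> w_def] zs(2) by (metis subsetD)
      have "map (var_at w) (map pos zs) = zs" using pos by (simp add: map_idI)
      with zs pos show ?L by (intro exI[of _ "map pos zs"]) auto
    qed
    also have "\<dots> \<longleftrightarrow> card (vars \<alpha>) \<le> c \<and> match_univ \<sigma> \<alpha> k"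
      unfolding sol_def by (rule match_univ_bounded_vars[OF \<sigma> \<alpha> W(2) bspec[OF W(3)], symmetric])
    finally show "P (encode_instance \<sigma> \<alpha> k) [] \<longleftrightarrow> \<alpha> \<in> {\<alpha>. card (vars \<alpha>) \<le> c} \<and> match_univ \<sigma> \<alpha> k"
      by (simp add: w_def)
  qed
qed


end

theorem proposition2:
  fixes \<sigma> :: nat
  assumes "\<sigma> \<ge> 2"
  shows "match_univ_in_P \<sigma> {\<alpha>. has_unique_variable \<alpha>} \<and>
         match_univ_in_P \<sigma> {\<alpha>. regular_pattern \<alpha>} \<and>
         (\<forall>c :: nat. match_univ_in_P \<sigma> {\<alpha>. card (vars \<alpha>) \<le> c})"
  using assms match_univ_unique_in_P match_univ_regular_in_P match_univ_bounded_in_P by simp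
end
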